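(* Let $R$ be a set of bases closed under multiplicative dependence. There are real numbers normal to every base in $R$ and not simply normal to any base in the complement of $R$ (among bases). Furthermore, such a real number can be obtained computably from $R$.
   Context: A base is an integer $\geq 2$. Two bases are multiplicatively dependent if one is a rational power of the other. For a real $x$, $\{x\}$ is its fractional part. For $\vec\xi=(\xi_1,\dots,\xi_N)$ in $[0,1]$, $D(\vec\xi)=\sup_{0\leq u<v\leq 1}\bigl|\#\{n:1\leq n\leq N,\ u\leq \xi_n<v\}/N-(v-u)\bigr|$, and for a family $F$ of subintervals, $D(F,\vec\xi)=\sup_{I\in F}\bigl|\#\{n:\xi_n\in I\}/N-\mu(I)\bigr|$ with $\mu$ the length. $\xi$ is normal to base $r$ iff $\lim_{N\to\infty}D(\{r^j\xi\}:0\leq j<N)=0$. $\xi$ is simply normal to base $r$ iff $\lim_{N\to\infty}D(F_r,(\{r^j\xi\}:0\leq j<N))=0$, where $F_r=\{[a/r,(a+1)/r):0\leq a<r\}$. "Obtained computably from $R$" means computable relative to an oracle for $R$. *)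

theory Defs
  imports "HOL-Analysis.Analysis"
begin

definition bases :: "nat set" where
  "bases = {r. 2 \<le> r}"

definition mult_dependent :: "nat \<Rightarrow> nat \<Rightarrow> bool" where
  "mult_dependent r s \<longleftrightarrow>
     (\<exists>q::rat. real r = real s powr of_rat q \<or> real s = real r powr of_rat q)"

definition closed_mult_dependent :: "nat set \<Rightarrow> bool" where
  "closed_mult_dependent R \<longleftrightarrow>
     (\<forall>r\<in>R. \<forall>s\<in>bases. mult_dependent r s \<longrightarrow> s \<in> R)"

definition discrepancy :: "real list \<Rightarrow> real" where
  "discrepancy xs = (SUP (u, v)\<in>{(u, v). 0 \<le> u \<and> u < v \<and> v \<le> 1}.
     \<bar>real (card {n. n < length xs \<and> u \<le> xs ! n \<and> xs ! n < v}) / real (length xs) - (v - u)\<bar>)"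

definition discrepancy_on :: "real set set \<Rightarrow> real list \<Rightarrow> real" where
  "discrepancy_on F xs = (SUP I\<in>F.
     \<bar>real (card {n. n < length xs \<and> xs ! n \<in> I}) / real (length xs) - measure lborel I\<bar>)"

definition orbit :: "nat \<Rightarrow> real \<Rightarrow> nat \<Rightarrow> real list" where
  "orbit r \<xi> N = map (\<lambda>j. frac (real r ^ j * \<xi>)) [0..<N]"

definition digit_intervals :: "nat \<Rightarrow> real set set" where
  "digit_intervals r = {{real a / real r ..< (real a + 1) / real r} | a. a < r}"

definition normal_to_base :: "nat \<Rightarrow> real \<Rightarrow> bool" where
  "normal_to_base r \<xi> \<longleftrightarrow> (\<lambda>N. discrepancy (orbit r \<xi> N)) \<longlonglongrightarrow> 0"

definition simply_normal_to_base :: "nat \<Rightarrow> real \<Rightarrow> bool" where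
  "simply_normal_to_base r \<xi> \<longleftrightarrow>
     (\<lambda>N. discrepancy_on (digit_intervals r) (orbit r \<xi> N)) \<longlonglongrightarrow> 0"

text \<open>
  Computability relative to an oracle, in Kleene's form: programs for the partial recursive
  functions with the characteristic function of the oracle as an additional initial function.
  The relation \<open>eval R p xs y\<close> says that \<open>p\<close> with oracle \<open>R\<close> halts on the argument tuple \<open>xs\<close>
  with output \<open>y\<close>. Divergence (including an arity mismatch) means that there is no such \<open>y\<close>.
\<close>

datatype program =
    Zero
  | Succ
  | Proj nat
  | Oracle
  | Comp program "program list"
  | PrimRec program program
  | Mu program

inductive eval :: "nat set \<Rightarrow> program \<Rightarrow> nat list \<Rightarrow> nat \<Rightarrow> bool" for R :: "nat set" where
  eval_Zero: "eval R Zero xs 0"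
| eval_Succ: "eval R Succ [x] (Suc x)"
| eval_Proj: "i < length xs \<Longrightarrow> eval R (Proj i) xs (xs ! i)"
| eval_Oracle: "eval R Oracle [x] (if x \<in> R then 1 else 0)"
| eval_Comp: "list_all2 (\<lambda>g y. eval R g xs y) gs ys \<Longrightarrow> eval R f ys z
    \<Longrightarrow> eval R (Comp f gs) xs z"
| eval_PrimRec_0: "eval R f xs y \<Longrightarrow> eval R (PrimRec f g) (0 # xs) y"
| eval_PrimRec_Suc: "eval R (PrimRec f g) (n # xs) y \<Longrightarrow> eval R g (n # y # xs) z
    \<Longrightarrow> eval R (PrimRec f g) (Suc n # xs) z"
| eval_Mu: "(\<And>i. i < k \<Longrightarrow> \<exists>y. eval R f (i # xs) (Suc y)) \<Longrightarrow> eval R f (k # xs) 0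
    \<Longrightarrow> eval R (Mu f) xs k"

inductive_cases eval_ZeroE: "eval R Zero xs y"
inductive_cases eval_SuccE: "eval R Succ xs y"
inductive_cases eval_ProjE: "eval R (Proj i) xs y"
inductive_cases eval_OracleE: "eval R Oracle xs y"
inductive_cases eval_CompE: "eval R (Comp f gs) xs y"
inductive_cases eval_PrimRec_0E: "eval R (PrimRec f g) (0 # xs) y"
inductive_cases eval_PrimRec_SucE: "eval R (PrimRec f g) (Suc n # xs) y"
inductive_cases eval_MuE: "eval R (Mu f) xs y"

lemma eval_deterministic: "eval R p xs y \<Longrightarrow> eval R p xs y' \<Longrightarrow> y = y'"
proof (induction arbitrary: y' rule: eval.induct)
  case (eval_Zero xs)
  then show ?case by (rule eval_ZeroE) simp
next
  case (eval_Succ x)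
  then show ?case by (rule eval_SuccE) simp
next
  case (eval_Proj i xs)
  from eval_Proj.prems show ?case by (rule eval_ProjE) simp
next
  case (eval_Oracle x)
  then show ?case by (rule eval_OracleE) simp
next
  case (eval_Comp xs gs ys f z)
  obtain ys' where ys': "list_all2 (\<lambda>g y. eval R g xs y) gs ys'" and f: "eval R f ys' y'"
    using eval_Comp.prems by (rule eval_CompE)
  have "ys = ys'"
    using eval_Comp.IH(1) ys' by (simp add: list_all2_conv_all_nth list_eq_iff_nth_eq)
  then show ?case using eval_Comp.IH(2) f by blast
next
  case (eval_PrimRec_0 f xs y g)
  from eval_PrimRec_0.prems show ?case
    by (rule eval_PrimRec_0E) (rule eval_PrimRec_0.IH)
next
  case (eval_PrimRec_Suc f g n xs y z)
  obtain w where w: "eval R (PrimRec f g) (n # xs) w" and g: "eval R g (n # w # xs) y'"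
    using eval_PrimRec_Suc.prems by (rule eval_PrimRec_SucE)
  then show ?case using eval_PrimRec_Suc.IH by blast
next
  case (eval_Mu k f xs)
  have a: "\<exists>y. eval R f (i # xs) (Suc y)" if "i < y'" for i
    using eval_Mu.prems by (rule eval_MuE) (use that in blast)
  have b: "eval R f (y' # xs) 0"
    using eval_Mu.prems by (rule eval_MuE)
  show ?case
  proof (rule linorder_cases[of k y'])
    assume "k < y'"
    then show ?thesis using a[of k] eval_Mu.IH(2) by blast
  next
    assume "y' < k"
    then show ?thesis using b eval_Mu.IH(1)[of y'] by blast
  qed
qed

definition computable_in :: "nat set \<Rightarrow> (nat \<Rightarrow> nat) \<Rightarrow> bool" where
  "computable_in R f \<longleftrightarrow> (\<exists>p. \<forall>n. eval R p [n] (f n))"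

text \<open>
  A real is computable from \<open>R\<close> if an \<open>R\<close>-computable sequence of rationals converges to it with
  error at most \<open>2\<^sup>-\<^sup>n\<close> at stage \<open>n\<close>; the rational is presented as \<open>(a n - b n) / (c n + 1)\<close>.
\<close>

definition computable_real_in :: "nat set \<Rightarrow> real \<Rightarrow> bool" where
  "computable_real_in R \<xi> \<longleftrightarrow>
     (\<exists>a b c. computable_in R a \<and> computable_in R b \<and> computable_in R c \<and>
        (\<forall>n. \<bar>\<xi> - (real (a n) - real (b n)) / (real (c n) + 1)\<bar> \<le> 1 / 2 ^ n))"

end

theory Submission
  imports Defs "HOL-Library.Nat_Bijection"
begin

text \<open>
  The real is the limit of rationals \<open>x\<^sub>0 \<le> x\<^sub>1 \<le> \<dots>\<close>, where \<open>x\<^sub>i\<close> has denominator \<open>T\<^sub>i\<close> and fixes the orbits up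
  to multiplier about \<open>T\<^sub>i\<close>. A step of level \<open>m\<close> appends base-\<open>b\<close> digits 0 and 1 only, where \<open>b = s\<^sup>8\<close> for
  a base \<open>s\<close> that is multiplicatively independent of every \<open>r \<in> R\<close> with \<open>r \<le> m\<close>. Hence at least three
  quarters of the new base-\<open>s\<close> digits are 0, and a long run of such steps destroys simple normality to \<open>s\<close>.

  For random digits the second moment of an exponential sum over \<open>h r\<^sup>j x\<close> is a double sum of products
  of cosines at \<open>t r\<^sup>i / b\<^sup>k\<close>. Such a product is small unless the leading base-\<open>b\<close> digits of \<open>t r\<^sup>i\<close> are
  exceptional, and these leading digits are governed by the rotation by the irrational number
  \<open>log b r\<close>, uniformly in \<open>t\<close>. So, for a block length that depends only on \<open>m\<close>, some choice of the new
  digits equidistributes, up to precision \<open>1 / m\<close>, the orbits to all \<open>r \<in> R\<close> with \<open>r \<le> m\<close>.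

  The required block length is not known in advance. Each step therefore uses the largest currently
  allowed level that admits a good block which is short compared with what has been built already;
  a new level is allowed only after a long uninterrupted run at the top level. All searches are
  bounded, so the sequence is primitive recursive in \<open>R\<close>.
\<close>

text \<open>Only the irrationality of \<open>log b r\<close> enters, never a quantitative measure of
  it. The equidistribution constants, which also pass through Stone-Weierstrass approximation,
  therefore come without a formula, and no block length is computed in advance. What the analysis
  does provide is uniformity: for a fixed level the constants do not depend on the approximation
  reached so far. Hence one length serves all large denominators, every level is feasible from some
  denominator on, and a blind bounded search must eventually succeed.

  Two demands pull against each other. Normality must survive truncation at every length, so a step
  may add only a small proportion of the digits already present. Bias towards 0 in base
  \<open>s\<close> must dominate at infinitely many lengths, so one level has to last until all
  earlier digits are negligible. The first demand dictates how short a step must be, the second when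
  the level may rise.\<close>

section \<open>Trigonometric approximation and Weyl's criterion\<close>

text \<open>\<open>trig_mean f a\<close>: \<open>f\<close> is a trigonometric polynomial with constant coefficient \<open>a\<close>.\<close>

inductive trig_mean :: "(real \<Rightarrow> complex) \<Rightarrow> complex \<Rightarrow> bool" where
  monomial: "trig_mean (\<lambda>t. c * cis (2 * pi * of_int h * t)) (if h = 0 then c else 0)"
| add: "trig_mean f a \<Longrightarrow> trig_mean g b \<Longrightarrow> trig_mean (\<lambda>t. f t + g t) (a + b)"

lemma trig_mean_const: "trig_mean (\<lambda>t. c) c"
  using trig_mean.monomial[of c 0] by simp

lemma trig_mean_monomial_mult:
  assumes "trig_mean f a"
  shows "\<exists>a'. trig_mean (\<lambda>t. (c * cis (2 * pi * of_int h * t)) * f t) a'"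
  using assms
proof induction
  case (monomial c' h')
  have "(\<lambda>t. (c * cis (2 * pi * of_int h * t)) * (c' * cis (2 * pi * of_int h' * t)))
      = (\<lambda>t. (c * c') * cis (2 * pi * of_int (h + h') * t))"
    by (simp add: fun_eq_iff cis_mult[symmetric] algebra_simps)
  then show ?case using trig_mean.monomial[of "c * c'" "h + h'"] by metis
next
  case (add f a g b)
  then obtain a' b' where "trig_mean (\<lambda>t. (c * cis (2 * pi * of_int h * t)) * f t) a'"
    "trig_mean (\<lambda>t. (c * cis (2 * pi * of_int h * t)) * g t) b'" by blast
  from trig_mean.add[OF this] show ?case by (auto simp: distrib_left)
qed

text \<open>The constant coefficient of a product is left open: products arise only from
  Stone-Weierstrass polynomials, and \<open>trig_mean_has_integral\<close> identifies the
  coefficient with the mean afterwards.\<close>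

lemma trig_mean_mult:
  assumes "trig_mean f a" "trig_mean g b"
  shows "\<exists>c. trig_mean (\<lambda>t. f t * g t) c"
  using assms(1)
proof induction
  case (monomial c h)
  then show ?case using trig_mean_monomial_mult[OF assms(2)] by blast
next
  case (add f a f' a')
  then obtain c c' where "trig_mean (\<lambda>t. f t * g t) c" "trig_mean (\<lambda>t. f' t * g t) c'" by blast
  from trig_mean.add[OF this] show ?case by (auto simp: distrib_right)
qed

lemma trig_mean_has_integral:
  assumes "trig_mean f a"
  shows "(f has_integral a) {x..x + 1}"
  using assms
proof induction
  case (monomial c h)
  show ?case
  proof (cases "h = 0")
    case True
    then show ?thesis using has_integral_const_real[of c x "x + 1"] by simp
  next
    case False
    let ?F = "\<lambda>t. c * cis (2 * pi * of_int h * t) / (2 * pi * of_int h * \<i>)"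
    have d: "(?F has_vector_derivative c * cis (2 * pi * of_int h * t)) (at t within {x..x + 1})" for t
    proof -
      have "((\<lambda>z. c * exp (\<i> * (2 * pi * of_int h) * z) / (2 * pi * of_int h * \<i>)) has_field_derivative
          c * exp (\<i> * (2 * pi * of_int h) * of_real t)) (at (of_real t))"
        using False by (auto intro!: derivative_eq_intros simp: mult_ac)
      from has_vector_derivative_real_field[OF this] show ?thesis
        by (simp add: cis_conv_exp mult_ac)
    qed
    have eq: "cis (2 * pi * of_int h * (x + 1)) = cis (2 * pi * of_int h * x)"
    proof -
      have "cis (2 * pi * of_int h * (x + 1)) = cis (2 * pi * of_int h * x) * cis (2 * pi * of_int h)"
        by (simp add: cis_mult algebra_simps)
      then show ?thesis by (simp add: cis_multiple_2pi)
    qed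
    have "((\<lambda>t. c * cis (2 * pi * of_int h * t)) has_integral (?F (x + 1) - ?F x)) {x..x + 1}"
      by (rule fundamental_theorem_of_calculus) (use d in auto)
    then show ?thesis using False eq by simp
  qed
next
  case (add f a g b)
  then show ?case by (intro has_integral_add)
qed

text \<open>\<open>H\<close> and \<open>C\<close> depend on \<open>f\<close> alone, not on the
  points or their number; all later uniformity starts here. A negative frequency gives a conjugate
  sum of the same modulus, so positive ones suffice.\<close>

lemma trig_mean_sum_bound:
  assumes "trig_mean f a"
  shows "\<exists>H C. C \<ge> 0 \<and> (\<forall>(J::nat set) x. finite J \<longrightarrow>
     norm ((\<Sum>j\<in>J. f (x j)) - of_nat (card J) * a)
       \<le> C * (\<Sum>h=1..H. norm (\<Sum>j\<in>J. cis (2 * pi * real h * x j))))"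
  using assms
proof induction
  case (monomial c h)
  show ?case
  proof (cases "h = 0")
    case True
    then show ?thesis by (intro exI[of _ 0]) simp
  next
    case False
    define H where "H = nat \<bar>h\<bar>"
    have H: "H \<ge> 1" "real H = \<bar>of_int h\<bar>" using False by (auto simp: H_def)
    have "norm (\<Sum>j\<in>J. c * cis (2 * pi * of_int h * x j))
        \<le> norm c * (\<Sum>h=1..H. norm (\<Sum>j\<in>J. cis (2 * pi * real h * x j)))" if "finite J"
      for J :: "nat set" and x
    proof -
      have "norm (\<Sum>j\<in>J. cis (2 * pi * of_int h * x j)) = norm (\<Sum>j\<in>J. cis (2 * pi * real H * x j))"
      proof (cases "h > 0")
        case True
        then show ?thesis using H by simp
      next
        case False
        then have "real H = - of_int h" using H by simp
        then have "(\<Sum>j\<in>J. cis (2 * pi * of_int h * x j)) = cnj (\<Sum>j\<in>J. cis (2 * pi * real H * x j))"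
          by (simp add: cis_cnj)
        then show ?thesis by (metis complex_mod_cnj)
      qed
      also have "\<dots> \<le> (\<Sum>h=1..H. norm (\<Sum>j\<in>J. cis (2 * pi * real h * x j)))"
        using H by (intro member_le_sum) auto
      finally show ?thesis
        by (simp add: sum_distrib_left[symmetric] norm_mult mult_left_mono)
    qed
    then show ?thesis using False by (intro exI[of _ H] exI[of _ "norm c"]) simp
  qed
next
  case (add f a g b)
  then obtain H1 C1 H2 C2 where 1: "C1 \<ge> 0" "\<And>(J::nat set) x. finite J \<Longrightarrow>
     norm ((\<Sum>j\<in>J. f (x j)) - of_nat (card J) * a)
       \<le> C1 * (\<Sum>h=1..H1. norm (\<Sum>j\<in>J. cis (2 * pi * real h * x j)))"
    and 2: "C2 \<ge> 0" "\<And>(J::nat set) x. finite J \<Longrightarrow>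
     norm ((\<Sum>j\<in>J. g (x j)) - of_nat (card J) * b)
       \<le> C2 * (\<Sum>h=1..H2. norm (\<Sum>j\<in>J. cis (2 * pi * real h * x j)))" by blast
  have "norm ((\<Sum>j\<in>J. f (x j) + g (x j)) - of_nat (card J) * (a + b))
      \<le> (C1 + C2) * (\<Sum>h=1..max H1 H2. norm (\<Sum>j\<in>J. cis (2 * pi * real h * x j)))"
    if J: "finite J" for J :: "nat set" and x
  proof -
    let ?S = "\<lambda>H. \<Sum>h=1..H. norm (\<Sum>j\<in>J. cis (2 * pi * real h * x j))"
    have m: "?S H1 \<le> ?S (max H1 H2)" "?S H2 \<le> ?S (max H1 H2)" by (intro sum_mono2; auto)+
    have "(\<Sum>j\<in>J. f (x j) + g (x j)) - of_nat (card J) * (a + b)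
       = ((\<Sum>j\<in>J. f (x j)) - of_nat (card J) * a) + ((\<Sum>j\<in>J. g (x j)) - of_nat (card J) * b)"
      by (simp add: sum.distrib algebra_simps)
    then have "norm ((\<Sum>j\<in>J. f (x j) + g (x j)) - of_nat (card J) * (a + b)) \<le> C1 * ?S H1 + C2 * ?S H2"
      using 1(2)[OF J, of x] 2(2)[OF J, of x] by (metis (no_types, lifting) norm_triangle_mono)
    also have "\<dots> \<le> C1 * ?S (max H1 H2) + C2 * ?S (max H1 H2)"
      using m 1 2 by (intro add_mono mult_left_mono) auto
    finally show ?thesis by (simp add: distrib_right)
  qed
  then show ?case using 1(1) 2(1) by (intro exI[of _ "max H1 H2"] exI[of _ "C1 + C2"]) auto
qed

lemma trig_mean_real_polynomial_function:
  assumes "real_polynomial_function (g :: complex \<Rightarrow> real)"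
  shows "\<exists>a. trig_mean (\<lambda>t. of_real (g (cis (2 * pi * t)))) a"
  using assms
proof induction
  case (linear f)
  interpret bounded_linear f by fact
  have fc: "f (cis (2 * pi * t)) = cos (2 * pi * t) * f 1 + sin (2 * pi * t) * f \<i>" for t
  proof -
    have "cis (2 * pi * t) = cos (2 * pi * t) *\<^sub>R 1 + sin (2 * pi * t) *\<^sub>R \<i>"
      by (simp add: complex_eq_iff)
    then show ?thesis by (simp only: add scale real_scaleR_def)
  qed
  have eq: "complex_of_real (f (cis (2 * pi * t))) =
      ((f 1 - \<i> * f \<i>) / 2) * cis (2 * pi * of_int 1 * t) +
      ((f 1 + \<i> * f \<i>) / 2) * cis (2 * pi * of_int (-1) * t)" for t
    unfolding complex_eq_iff fc by (simp add: field_simps)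
  show ?case unfolding eq by (rule exI, rule trig_mean.add; rule trig_mean.monomial)
next
  case (const c)
  then show ?case using trig_mean_const by blast
next
  case (add f g)
  then show ?case by (auto intro: trig_mean.add)
next
  case (mult f g)
  then show ?case using trig_mean_mult by fastforce
qed

lemma trig_approx:
  fixes f :: "real \<Rightarrow> real"
  assumes "continuous_on {0..1} f" "f 0 = f 1" "e > 0"
  obtains g a where "trig_mean g a" "\<And>t. norm (complex_of_real (f (frac t)) - g t) \<le> e"
proof -
  \<comment> \<open>Equal end values make \<open>f\<close> a loop. A loop homotopic to itself
    descends to a continuous function on the circle, which settles continuity at the cut of
    \<open>Arg2pi\<close>.\<close>
  have "homotopic_loops UNIV f f"
    using assms by (simp add: homotopic_loops_refl path_def pathfinish_def pathstart_def)
  then have "continuous_on (sphere 0 1) (f \<circ> (\<lambda>z. Arg2pi z / (2 * pi)))"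
    using homotopic_loops_imp_homotopic_circlemaps homotopic_with_imp_continuous by blast
  then obtain g :: "complex \<Rightarrow> real" where g: "real_polynomial_function g"
    "\<And>z. z \<in> sphere 0 1 \<Longrightarrow> \<bar>(f \<circ> (\<lambda>z. Arg2pi z / (2 * pi))) z - g z\<bar> < e"
    using Stone_Weierstrass_real_polynomial_function[of "sphere 0 1"] assms(3) compact_sphere by metis
  obtain a where a: "trig_mean (\<lambda>t. of_real (g (cis (2 * pi * t)))) a"
    using trig_mean_real_polynomial_function[OF g(1)] by blast
  have "norm (complex_of_real (f (frac t)) - of_real (g (cis (2 * pi * t)))) \<le> e" for t
  proof -
    have c: "cis (2 * pi * t) = cis (2 * pi * frac t)"
    proof -
      have "cis (2 * pi * t) = cis (2 * pi * frac t) * cis (2 * pi * of_int \<lfloor>t\<rfloor>)"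
        by (simp add: cis_mult frac_def algebra_simps)
      then show ?thesis by (simp add: cis_multiple_2pi)
    qed
    have "Arg2pi (cis (2 * pi * t)) = 2 * pi * frac t"
    proof -
      have "Arg2pi (exp (\<i> * of_real (2 * pi * frac t))) = 2 * pi * frac t"
        using Arg2pi_exp[of "\<i> * of_real (2 * pi * frac t)"] frac_lt_1[of t] frac_ge_0[of t] by simp
      then show ?thesis by (metis c cis_conv_exp)
    qed
    then show ?thesis using g(2)[of "cis (2 * pi * t)"]
      by (simp flip: of_real_diff)
  qed
  with a show ?thesis using that by blast
qed

text \<open>Weyl's criterion in quantitative form. Replacing \<open>f\<close> by a trigonometric
  polynomial costs \<open>e / 2\<close> per point and another \<open>e / 2\<close> in the mean;
  finitely many exponential sums remain.\<close>

lemma weyl_bound: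
  fixes f :: "real \<Rightarrow> real"
  assumes f: "continuous_on {0..1} f" "f 0 = f 1" and e: "e > 0"
  shows "\<exists>H C. C \<ge> 0 \<and> (\<forall>(J::nat set) x. finite J \<longrightarrow>
     \<bar>(\<Sum>j\<in>J. f (frac (x j))) - real (card J) * integral {0..1} f\<bar>
       \<le> e * real (card J) + C * (\<Sum>h=1..H. norm (\<Sum>j\<in>J. cis (2 * pi * real h * x j))))"
proof -
  obtain g a where g: "trig_mean g a" "\<And>t. norm (complex_of_real (f (frac t)) - g t) \<le> e / 2"
    using trig_approx[OF f, of "e / 2"] e by auto
  obtain H C where HC: "C \<ge> 0" "\<And>(J::nat set) x. finite J \<Longrightarrow>
     norm ((\<Sum>j\<in>J. g (x j)) - of_nat (card J) * a)
       \<le> C * (\<Sum>h=1..H. norm (\<Sum>j\<in>J. cis (2 * pi * real h * x j)))"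
    using trig_mean_sum_bound[OF g(1)] by blast
  have gi: "(g has_integral a) {0..1}" using trig_mean_has_integral[OF g(1), of 0] by simp
  have fi: "((\<lambda>t. complex_of_real (f t)) has_integral of_real (integral {0..1} f)) {0..1}"
    using integrable_integral[OF integrable_continuous_real[OF f(1)]]
    by (rule has_integral_of_real)
  have "((\<lambda>t. complex_of_real (f t) - g t) has_integral of_real (integral {0..1} f) - a) {0..1}"
    by (rule has_integral_diff[OF fi gi])
  moreover have "norm (complex_of_real (f t) - g t) \<le> e / 2" if "t \<in> {0..1}" for t
  proof (cases "t = 1")
    case True
    \<comment> \<open>Since \<open>frac 1 = 0\<close>, the estimate at the right end has to come
      from 0 by periodicity.\<close>
    have "g 1 = g 0" using g(1)
      by induction (use cis_multiple_2pi in auto)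
    then show ?thesis using g(2)[of 0] True f(2) by simp
  next
    case False
    then have "frac t = t" using that by (simp add: frac_eq)
    then show ?thesis using g(2)[of t] by simp
  qed
  ultimately have I: "norm (of_real (integral {0..1} f) - a) \<le> e / 2"
    using has_integral_bound[of "e/2" "\<lambda>t. complex_of_real (f t) - g t" _ 0 1] e by simp
  have "\<bar>(\<Sum>j\<in>J. f (frac (x j))) - real (card J) * integral {0..1} f\<bar>
       \<le> e * real (card J) + C * (\<Sum>h=1..H. norm (\<Sum>j\<in>J. cis (2 * pi * real h * x j)))"
    if J: "finite J" for J :: "nat set" and x
  proof -
    have "\<bar>(\<Sum>j\<in>J. f (frac (x j))) - real (card J) * integral {0..1} f\<bar>
        = norm (complex_of_real ((\<Sum>j\<in>J. f (frac (x j))) - real (card J) * integral {0..1} f))"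
      by (simp only: norm_of_real)
    also have "complex_of_real ((\<Sum>j\<in>J. f (frac (x j))) - real (card J) * integral {0..1} f)
      = (\<Sum>j\<in>J. complex_of_real (f (frac (x j))) - g (x j)) - of_nat (card J) * (of_real (integral {0..1} f) - a)
        + ((\<Sum>j\<in>J. g (x j)) - of_nat (card J) * a)"
      by (simp add: sum_subtractf algebra_simps)
    also have "norm \<dots> \<le> norm (\<Sum>j\<in>J. complex_of_real (f (frac (x j))) - g (x j))
       + norm (of_nat (card J) * (of_real (integral {0..1} f) - a))
       + norm ((\<Sum>j\<in>J. g (x j)) - of_nat (card J) * a)"
      by (meson add_mono norm_triangle_ineq norm_triangle_ineq4 order_refl order_trans)
    also have "norm (\<Sum>j\<in>J. complex_of_real (f (frac (x j))) - g (x j)) \<le> real (card J) * (e / 2)"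
      by (rule sum_norm_bound) (rule g(2))
    also have "norm (of_nat (card J) * (of_real (integral {0..1} f) - a)) \<le> real (card J) * (e / 2)"
      using mult_left_mono[OF I, of "real (card J)"] by (simp only: norm_mult norm_of_nat of_nat_0_le_iff)
    also have "norm ((\<Sum>j\<in>J. g (x j)) - of_nat (card J) * a)
        \<le> C * (\<Sum>h=1..H. norm (\<Sum>j\<in>J. cis (2 * pi * real h * x j)))"
      by (rule HC(2)[OF J])
    finally show ?thesis by (simp add: algebra_simps)
  qed
  then show ?thesis using HC(1) by blast
qed

section \<open>Exponential sums over random digit blocks\<close>

text \<open>A Riesz product: the squared modulus of the characteristic function, at frequency
  \<open>a\<close>, of \<open>L\<close> independent random digits 0 and 1 placed at consecutive
  powers of \<open>b\<close>.\<close>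

definition riesz :: "nat \<Rightarrow> nat \<Rightarrow> real \<Rightarrow> real" where
  "riesz b L a = (\<Prod>l<L. (cos (pi * real b ^ l * a))\<^sup>2)"

lemma riesz_nonneg: "0 \<le> riesz b L a"
  by (simp add: riesz_def prod_nonneg)

lemma continuous_on_riesz [continuous_intros]:
  "continuous_on S f \<Longrightarrow> continuous_on (S :: real set) (\<lambda>x. riesz b L (f x))"
  unfolding riesz_def
  by (intro continuous_on_prod continuous_on_power continuous_on_cos continuous_on_mult continuous_on_const)

text \<open>The squared cosine is 1/2 plus terms of frequency 1 and -1. After rescaling by
  \<open>b\<close> all frequencies of \<open>f\<close> are multiples of \<open>b\<close>, so adding
  1 or -1 never produces 0 and the constant coefficient is exactly halved.\<close>

lemma trig_mean_cos_squared_mult: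
  assumes "trig_mean f a" "b \<ge> 2"
  shows "trig_mean (\<lambda>t. of_real ((cos (pi * t))\<^sup>2) * f (real b * t)) (a / 2)"
  using assms(1)
proof induction
  case (monomial c h)
  have cc: "complex_of_real ((cos (pi * t))\<^sup>2) = 1 / 2 + cis (2 * pi * t) / 4 + cis (- (2 * pi * t)) / 4" for t
    using cos_double_cos[of "pi * t"] by (simp add: complex_eq_iff field_simps)
  have nz: "h * int b + 1 \<noteq> 0" "h * int b - 1 \<noteq> 0"
  proof -
    have "\<not> int b dvd 1" using assms(2) by (simp add: zdvd1_eq)
    moreover have "int b dvd 1" if "h * int b + 1 = 0"
      using that by (intro dvdI[of _ _ "- h"]) (simp add: algebra_simps)
    moreover have "int b dvd 1" if "h * int b - 1 = 0"
      using that by (intro dvdI[of _ _ h]) (simp add: algebra_simps)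
    ultimately show "h * int b + 1 \<noteq> 0" "h * int b - 1 \<noteq> 0" by blast+
  qed
  have eq: "(\<lambda>t. complex_of_real ((cos (pi * t))\<^sup>2) * (c * cis (2 * pi * of_int h * (real b * t)))) =
     (\<lambda>t. (c / 2 * cis (2 * pi * of_int (h * int b) * t) + c / 4 * cis (2 * pi * of_int (h * int b + 1) * t))
        + c / 4 * cis (2 * pi * of_int (h * int b - 1) * t))"
  proof
    fix t
    have e1: "cis (2 * pi * of_int (h * int b + 1) * t) = cis (2 * pi * t) * cis (2 * pi * of_int h * (real b * t))"
      "cis (2 * pi * of_int (h * int b - 1) * t) = cis (- (2 * pi * t)) * cis (2 * pi * of_int h * (real b * t))"
      "cis (2 * pi * of_int (h * int b) * t) = cis (2 * pi * of_int h * (real b * t))"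
      unfolding cis_mult by (simp_all add: algebra_simps)
    show "complex_of_real ((cos (pi * t))\<^sup>2) * (c * cis (2 * pi * of_int h * (real b * t))) =
      (c / 2 * cis (2 * pi * of_int (h * int b) * t) + c / 4 * cis (2 * pi * of_int (h * int b + 1) * t))
        + c / 4 * cis (2 * pi * of_int (h * int b - 1) * t)"
      unfolding e1 cc by (simp add: algebra_simps)
  qed
  have "trig_mean (\<lambda>t. (c / 2 * cis (2 * pi * of_int (h * int b) * t) + c / 4 * cis (2 * pi * of_int (h * int b + 1) * t))
        + c / 4 * cis (2 * pi * of_int (h * int b - 1) * t))
     (((if h * int b = 0 then c / 2 else 0) + (if h * int b + 1 = 0 then c / 4 else 0)) + (if h * int b - 1 = 0 then c / 4 else 0))"
    by (intro trig_mean.add trig_mean.monomial)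
  moreover have "((if h * int b = 0 then c / 2 else 0) + (if h * int b + 1 = 0 then c / 4 else 0)) + (if h * int b - 1 = 0 then c / 4 else 0)
     = (if h = 0 then c else 0) / 2"
    using nz assms(2) by auto
  ultimately show ?case unfolding eq by (simp only:)
next
  case (add f a g b)
  from trig_mean.add[OF add.IH] show ?case by (simp add: distrib_left add_divide_distrib)
qed

lemma trig_mean_riesz:
  assumes "b \<ge> 2"
  shows "trig_mean (\<lambda>t. complex_of_real (riesz b L t)) (1 / 2 ^ L)"
proof (induction L)
  case 0
  then show ?case using trig_mean_const[of 1] by (simp add: riesz_def)
next
  case (Suc L)
  have "riesz b (Suc L) t = (cos (pi * t))\<^sup>2 * riesz b L (real b * t)" for t
    unfolding riesz_def by (subst prod.lessThan_Suc_shift) (simp add: mult_ac)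
  then show ?case using trig_mean_cos_squared_mult[OF Suc assms] by (simp add: mult.commute)
qed

lemma has_integral_riesz:
  assumes "b \<ge> 2"
  shows "(riesz b L has_integral real n / 2 ^ L) {x..x + real n}"
proof (induction n)
  case 0
  then show ?case using has_integral_null_real[of x x] by simp
next
  case (Suc n)
  have this': "((\<lambda>t. complex_of_real (riesz b L t)) has_integral 1 / 2 ^ L) {x + real n..x + real n + 1}"
    by (rule trig_mean_has_integral[OF trig_mean_riesz[OF assms]])
  have riesz: "(riesz b L has_integral 1 / 2 ^ L) {x + real n..x + real n + 1}"
  proof -
    have "Re (1 / 2 ^ L) = 1 / 2 ^ L"
      by (metis Re_complex_of_real of_real_1 of_real_divide of_real_numeral of_real_power)
    with has_integral_Re[OF this'] show ?thesis by simp
  qed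
  from has_integral_combine[OF _ _ Suc riesz] show ?case by (simp add: add_divide_distrib add_ac)
qed

text \<open>
  With \<open>\<tau>\<close> the fractional part of \<open>log b \<xi>\<close>, both summands bound the same cosine product at \<open>\<xi>\<close>, read off from
  windows of leading digits that differ by one position. The interpolation between them makes the
  weight continuous on the circle, with equal values at 0 and 1.
\<close>

definition lead_weight :: "nat \<Rightarrow> nat \<Rightarrow> nat \<Rightarrow> real \<Rightarrow> real" where
  "lead_weight b L c \<tau> = (1 - \<tau>) * riesz b L (real b powr (\<tau> + real (c + 1)))
     + \<tau> * riesz b L (real b powr (\<tau> + real c))"

text \<open>The substitution \<open>a = b powr (\<tau> + c)\<close> turns each summand into an
  integral of \<open>riesz b L\<close> from \<open>b ^ c\<close> to \<open>b ^ (c + 1)\<close>,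
  where every unit interval contributes exactly \<open>1 / 2 ^ L\<close>. The Jacobian is at least
  \<open>b ^ c / 2\<close>, because \<open>ln b \<ge> 1 / 2\<close>.\<close>

lemma lead_weight_props:
  assumes "b \<ge> 2"
  shows "continuous_on {0..1} (lead_weight b L c)" "lead_weight b L c 0 = lead_weight b L c 1"
    "\<And>\<tau>. \<tau> \<in> {0..1} \<Longrightarrow> 0 \<le> lead_weight b L c \<tau>"
    "integral {0..1} (lead_weight b L c) \<le> 4 * real b / 2 ^ L"
proof -
  have cont: "continuous_on {0..1} (\<lambda>\<tau>. riesz b L (real b powr (\<tau> + real c)))" for c
    using assms by (intro continuous_intros) auto
  show cl: "continuous_on {0..1} (lead_weight b L c)"
    unfolding lead_weight_def by (intro continuous_intros cont)
  show "lead_weight b L c 0 = lead_weight b L c 1"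
    by (simp add: lead_weight_def add_ac)
  show "0 \<le> lead_weight b L c \<tau>" if "\<tau> \<in> {0..1}" for \<tau>
    using that by (simp add: lead_weight_def riesz_nonneg)
  have int: "integral {0..1} (\<lambda>\<tau>. riesz b L (real b powr (\<tau> + real c))) \<le> 2 * real b / 2 ^ L" for c
  proof -
    let ?g = "\<lambda>\<tau>. real b powr (\<tau> + real c)"
    have b: "real b \<ge> 2" "real b > 0" using assms by auto
    have ln: "ln (real b) \<ge> 1 / 2"
    proof -
      have "ln (real b) \<ge> ln 2" using b by simp
      moreover have "ln (2::real) \<ge> 1 / 2" using ln2_ge_two_thirds by simp
      ultimately show ?thesis by simp
    qed
    have g0: "?g 0 = real b ^ c" "?g 1 = real b ^ (c + 1)"
      using b by (auto simp: powr_realpow powr_add)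
    have gmono: "?g \<tau> \<in> {real b ^ c..real b ^ (c + 1)}" if "\<tau> \<in> {0..1}" for \<tau>
      unfolding g0[symmetric] using that b by (auto intro!: powr_mono)
    have "((\<lambda>\<tau>. (real b powr (\<tau> + real c) * ln (real b)) *\<^sub>R riesz b L (?g \<tau>)) has_integral
        integral {?g 0..?g 1} (riesz b L)) {0..1}"
    proof (rule has_integral_substitution)
      show "?g ` {0..1} \<subseteq> {real b ^ c..real b ^ (c + 1)}" using gmono by blast
      show "continuous_on {real b ^ c..real b ^ (c + 1)} (riesz b L)"
        using continuous_on_riesz[OF continuous_on_id] by simp
      show "?g 0 \<le> ?g 1" using g0 b by (simp add: power_increasing)
      show "(?g has_real_derivative real b powr (\<tau> + real c) * ln (real b)) (at \<tau> within {0..1})"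
        if "\<tau> \<in> {0..1}" for \<tau>
        using b by (auto simp: powr_def intro!: derivative_eq_intros)
    qed auto
    moreover have "integral {?g 0..?g 1} (riesz b L) = (real b ^ (c + 1) - real b ^ c) / 2 ^ L"
    proof -
      have "b ^ c \<le> b ^ (c + 1)" using assms by (simp add: power_increasing)
      then have "real b ^ (c + 1) = real b ^ c + real (b ^ (c + 1) - b ^ c)"
        by (simp add: of_nat_diff)
      then show ?thesis unfolding g0
        using integral_unique[OF has_integral_riesz[OF assms, of L "b ^ (c + 1) - b ^ c" "real b ^ c"]] by simp
    qed
    ultimately have 1: "((\<lambda>\<tau>. (real b powr (\<tau> + real c) * ln (real b)) * riesz b L (?g \<tau>)) has_integral
        (real b ^ (c + 1) - real b ^ c) / 2 ^ L) {0..1}" by simp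
    have 2: "((\<lambda>\<tau>. real b ^ c / 2 * riesz b L (?g \<tau>)) has_integral
        real b ^ c / 2 * integral {0..1} (\<lambda>\<tau>. riesz b L (?g \<tau>))) {0..1}"
      by (intro has_integral_mult_right integrable_integral integrable_continuous_real cont)
    have "real b ^ c / 2 * integral {0..1} (\<lambda>\<tau>. riesz b L (?g \<tau>)) \<le> (real b ^ (c + 1) - real b ^ c) / 2 ^ L"
    proof (rule has_integral_le[OF 2 1])
      fix \<tau> :: real assume "\<tau> \<in> {0..1}"
      then have "real b ^ c \<le> real b powr (\<tau> + real c)" using gmono[of \<tau>] by simp
      then have "real b ^ c * (1 / 2) \<le> real b powr (\<tau> + real c) * ln (real b)"
        using ln by (intro mult_mono) auto
      then show "real b ^ c / 2 * riesz b L (?g \<tau>) \<le> real b powr (\<tau> + real c) * ln (real b) * riesz b L (?g \<tau>)"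
        by (intro mult_right_mono riesz_nonneg) simp
    qed
    also have "\<dots> \<le> real b ^ c * real b / 2 ^ L"
      by (simp add: divide_right_mono mult.commute)
    finally have "real b ^ c * (integral {0..1} (\<lambda>\<tau>. riesz b L (?g \<tau>))) \<le> real b ^ c * (2 * real b / 2 ^ L)"
      by (simp add: mult_ac)
    then show ?thesis by (rule mult_left_le_imp_le) (use b in simp)
  qed
  have "integral {0..1} (lead_weight b L c) \<le> integral {0..1} (\<lambda>\<tau>. riesz b L (real b powr (\<tau> + real (c + 1)))
     + riesz b L (real b powr (\<tau> + real c)))"
  proof (rule integral_le)
    show "lead_weight b L c integrable_on {0..1}" by (rule integrable_continuous_real[OF cl])
    show "(\<lambda>\<tau>. riesz b L (real b powr (\<tau> + real (c + 1))) + riesz b L (real b powr (\<tau> + real c))) integrable_on {0..1}"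
      by (intro integrable_continuous_real continuous_on_add cont)
    show "lead_weight b L c \<tau> \<le> riesz b L (real b powr (\<tau> + real (c + 1))) + riesz b L (real b powr (\<tau> + real c))"
      if "\<tau> \<in> {0..1}" for \<tau>
      unfolding lead_weight_def using that riesz_nonneg[of b L]
      by (intro add_mono mult_left_le_one_le) auto
  qed
  also have "\<dots> = integral {0..1} (\<lambda>\<tau>. riesz b L (real b powr (\<tau> + real (c + 1)))) + integral {0..1} (\<lambda>\<tau>. riesz b L (real b powr (\<tau> + real c)))"
    by (intro integral_add integrable_continuous_real cont)
  also have "\<dots> \<le> 4 * real b / 2 ^ L" using int[of "c + 1"] int[of c] by simp
  finally show "integral {0..1} (lead_weight b L c) \<le> 4 * real b / 2 ^ L" .
qed

section \<open>Irrational rotations and cosine products along geometric progressions\<close>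

text \<open>The starting point \<open>\<tau>\<close> contributes only a unimodular factor to each
  exponential sum, and irrationality bounds the remaining geometric sums independently of
  \<open>N\<close>. Hence \<open>C\<close> precedes both.\<close>

lemma rotation_sum_bound:
  fixes f :: "real \<Rightarrow> real"
  assumes f: "continuous_on {0..1} f" "f 0 = f 1" and e: "e > 0"
    and irr: "\<And>h::nat. h \<ge> 1 \<Longrightarrow> real h * \<theta> \<notin> \<int>"
  shows "\<exists>C\<ge>0. \<forall>\<tau> N. (\<Sum>i<N. f (frac (\<tau> + real i * \<theta>))) \<le> (integral {0..1} f + e) * real N + C"
proof -
  obtain H C where HC: "C \<ge> 0" "\<And>(J::nat set) x. finite J \<Longrightarrow>
     \<bar>(\<Sum>j\<in>J. f (frac (x j))) - real (card J) * integral {0..1} f\<bar>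
       \<le> e * real (card J) + C * (\<Sum>h=1..H. norm (\<Sum>j\<in>J. cis (2 * pi * real h * x j)))"
    using weyl_bound[OF f e] by blast
  define D where "D = (\<Sum>h=1..H. 2 / norm (1 - cis (2 * pi * real h * \<theta>)))"
  have geo: "norm (\<Sum>i<N. cis (2 * pi * real h * (\<tau> + real i * \<theta>))) \<le> 2 / norm (1 - cis (2 * pi * real h * \<theta>))"
    if "h \<ge> 1" for h N \<tau>
  proof -
    let ?z = "cis (2 * pi * real h * \<theta>)"
    have z1: "?z \<noteq> 1"
    proof
      assume "?z = 1"
      then have "cos (2 * pi * real h * \<theta>) = 1" by (metis cis.sel(1) one_complex.sel(1))
      then obtain k :: int where "2 * pi * real h * \<theta> = of_int k * (2 * pi)"
        unfolding cos_one_2pi_int by (auto simp: mult_ac)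
      then have "real h * \<theta> = of_int k" by simp
      then show False using irr[OF that] by auto
    qed
    have "(\<Sum>i<N. cis (2 * pi * real h * (\<tau> + real i * \<theta>))) = cis (2 * pi * real h * \<tau>) * (\<Sum>i<N. ?z ^ i)"
      unfolding sum_distrib_left Complex.DeMoivre cis_mult by (simp add: ring_distribs mult_ac)
    also have "(\<Sum>i<N. ?z ^ i) = (1 - ?z ^ N) / (1 - ?z)"
      using z1 by (simp add: sum_gp_strict)
    finally have "norm (\<Sum>i<N. cis (2 * pi * real h * (\<tau> + real i * \<theta>))) = norm (1 - ?z ^ N) / norm (1 - ?z)"
      by (simp add: norm_mult norm_divide)
    moreover have "norm (1 - ?z ^ N) \<le> 2"
      using norm_triangle_ineq4[of 1 "?z ^ N"] by (simp add: norm_power)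
    ultimately show ?thesis by (simp add: divide_right_mono)
  qed
  have "(\<Sum>i<N. f (frac (\<tau> + real i * \<theta>))) \<le> (integral {0..1} f + e) * real N + C * D" for \<tau> N
  proof -
    have "(\<Sum>h=1..H. norm (\<Sum>i<N. cis (2 * pi * real h * (\<tau> + real i * \<theta>)))) \<le> D"
      unfolding D_def by (intro sum_mono geo) auto
    then have "C * (\<Sum>h=1..H. norm (\<Sum>i<N. cis (2 * pi * real h * (\<tau> + real i * \<theta>)))) \<le> C * D"
      using HC(1) by (rule mult_left_mono)
    then show ?thesis using HC(2)[of "{..<N}" "\<lambda>i. \<tau> + real i * \<theta>"] by (simp add: algebra_simps abs_le_iff)
  qed
  moreover have "C * D \<ge> 0" using HC(1) by (auto simp: D_def intro!: mult_nonneg_nonneg sum_nonneg)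
  ultimately show ?thesis by blast
qed

text \<open>The modulus of the characteristic function, at \<open>\<xi>\<close>, of the random sum
  that keeps each \<open>1 / b ^ (K + k)\<close> with probability 1/2;
  \<open>norm_sum_Pow_cis\<close> makes this precise.\<close>

definition cosprod :: "nat \<Rightarrow> nat \<Rightarrow> nat \<Rightarrow> real \<Rightarrow> real" where
  "cosprod b K n \<xi> = (\<Prod>k=1..n. \<bar>cos (pi * \<xi> / real b ^ (K + k))\<bar>)"

lemma cosprod_bounds: "0 \<le> cosprod b K n \<xi>" "cosprod b K n \<xi> \<le> 1"
  by (auto simp: cosprod_def intro!: prod_nonneg prod_le_1)

lemma cosprod_minus: "cosprod b K n (- \<xi>) = cosprod b K n \<xi>"
  by (simp add: cosprod_def)

lemma cosprod_zero: "cosprod b K n 0 = 1"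
  by (simp add: cosprod_def)

text \<open>All factors are at most 1, so it is enough to keep \<open>L\<close> consecutive ones;
  read downwards from position \<open>M\<close> they form a Riesz product.\<close>

lemma cosprod_squared_le_riesz:
  assumes "b \<ge> 1" "K + L \<le> M" "M \<le> K + n"
  shows "(cosprod b K n \<xi>)\<^sup>2 \<le> riesz b L (\<xi> / real b ^ M)"
proof -
  let ?f = "\<lambda>k. (cos (pi * \<xi> / real b ^ (K + k)))\<^sup>2"
  let ?g = "\<lambda>l. M - l - K"
  have inj: "inj_on ?g {..<L}" using assms by (auto simp: inj_on_def)
  have sub: "?g ` {..<L} \<subseteq> {1..n}" using assms by auto
  have "(cosprod b K n \<xi>)\<^sup>2 = (\<Prod>k=1..n. ?f k)"
    unfolding cosprod_def prod_power_distrib by simp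
  also have "\<dots> = (\<Prod>k\<in>{1..n} - ?g ` {..<L}. ?f k) * (\<Prod>k\<in>?g ` {..<L}. ?f k)"
    using sub by (intro prod.subset_diff) auto
  also have "\<dots> \<le> 1 * (\<Prod>k\<in>?g ` {..<L}. ?f k)"
    by (intro mult_right_mono prod_le_1 prod_nonneg) (auto simp: power_le_one abs_square_le_1)
  also have "\<dots> = (\<Prod>l<L. ?f (?g l))"
    using prod.reindex[OF inj] by (simp add: o_def)
  also have "\<dots> = riesz b L (\<xi> / real b ^ M)"
    unfolding riesz_def
  proof (intro prod.cong refl)
    fix l assume "l \<in> {..<L}"
    then have "K + (M - l - K) + l = M" using assms by auto
    then have "real b ^ M = real b ^ (K + (M - l - K)) * real b ^ l" by (metis power_add)
    then show "?f (?g l) = (cos (pi * real b ^ l * (\<xi> / real b ^ M)))\<^sup>2"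
      using assms(1) by simp
  qed
  finally show ?thesis by simp
qed

text \<open>With \<open>e\<close> the integer part of \<open>log b \<xi>\<close>, reading from
  position \<open>e - c\<close> or \<open>e - c - 1\<close> gives Riesz products that depend on
  \<open>frac (log b \<xi>)\<close> alone. The two hypotheses place both windows inside the
  \<open>n\<close> available factors; a convex combination of the two bounds is the weight.\<close>

lemma cosprod_squared_le_lead_weight:
  assumes b: "b \<ge> 2" and "\<xi> > 0"
    and lo: "log b \<xi> \<ge> real (K + L + c + 1)" and hi: "log b \<xi> < real (c + K + n + 1)"
  shows "(cosprod b K n \<xi>)\<^sup>2 \<le> lead_weight b L c (frac (log b \<xi>))"
proof -
  define \<tau> where "\<tau> = log b \<xi>"
  define e where "e = nat \<lfloor>\<tau>\<rfloor>"
  have \<tau>: "\<tau> \<ge> 0" using lo by (simp add: \<tau>_def)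
  have e: "real e = of_int \<lfloor>\<tau>\<rfloor>" using \<tau> by (simp add: e_def)
  have elo: "e \<ge> K + L + c + 1" using lo unfolding \<tau>_def[symmetric] e_def by (simp add: le_nat_iff le_floor_iff)
  have ehi: "e \<le> c + K + n"
  proof -
    have "real e \<le> \<tau>" unfolding e by simp
    then have "real e < real (c + K + n + 1)" using hi by (simp add: \<tau>_def)
    then show ?thesis by linarith
  qed
  have \<xi>: "\<xi> = real b powr \<tau>" using assms by (simp add: \<tau>_def)
  have *: "\<xi> / real b ^ (e - d) = real b powr (frac \<tau> + real d)" if "d \<le> e" for d
  proof -
    have "\<xi> = real b powr (frac \<tau> + real d + real (e - d))"
      using that e by (simp add: \<xi> frac_def of_nat_diff)
    also have "\<dots> = real b powr (frac \<tau> + real d) * real b ^ (e - d)"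
      unfolding powr_add using b by (simp add: powr_realpow)
    finally show ?thesis using b by simp
  qed
  have 1: "(cosprod b K n \<xi>)\<^sup>2 \<le> riesz b L (real b powr (frac \<tau> + real c))"
    using cosprod_squared_le_riesz[of b K L "e - c" n \<xi>] * [of c] b elo ehi by simp
  have 2: "(cosprod b K n \<xi>)\<^sup>2 \<le> riesz b L (real b powr (frac \<tau> + real (c + 1)))"
    using cosprod_squared_le_riesz[of b K L "e - (c + 1)" n \<xi>] * [of "c + 1"] b elo ehi by simp
  have "(cosprod b K n \<xi>)\<^sup>2 = (1 - frac \<tau>) * (cosprod b K n \<xi>)\<^sup>2 + frac \<tau> * (cosprod b K n \<xi>)\<^sup>2"
    by (simp add: algebra_simps)
  also have "\<dots> \<le> lead_weight b L c (frac \<tau>)"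
    unfolding lead_weight_def using 1 2 frac_lt_1[of \<tau>] frac_ge_0[of \<tau>]
    by (intro add_mono mult_left_mono) auto
  finally show ?thesis by (simp add: \<tau>_def)
qed

text \<open>Multiplication by \<open>r\<close> moves the logarithm by a fixed irrational amount, so
  the squares are dominated by a rotation average of \<open>lead_weight\<close>. It matters that
  \<open>C\<close> is chosen before \<open>\<xi>\<close>: the multiplier will range over infinitely
  many values.\<close>

lemma cosprod_sum_bound:
  assumes b: "b \<ge> 2" and r: "r \<ge> 2" and e: "e > 0"
    and irr: "\<And>h::nat. h \<ge> 1 \<Longrightarrow> real h * log b r \<notin> \<int>"
  shows "\<exists>C\<ge>0. \<forall>K n N \<xi>. \<xi> > 0 \<longrightarrow> real b ^ K \<le> real b * \<xi> \<longrightarrow> (\<forall>i<N. \<xi> * real r ^ i < real b ^ (c + K + n))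
     \<longrightarrow> (\<Sum>i<N. cosprod b K n (\<xi> * real r ^ i)) \<le> e * real N + C"
proof -
  define \<theta> where "\<theta> = log b r"
  have \<theta>: "\<theta> > 0" using b r by (simp add: \<theta>_def)
  \<comment> \<open>The weight then has mean at most \<open>e\<^sup>2 / 8\<close>. The rotation
    error adds the same amount, and the factor \<open>2 / e\<close> from \<open>amgm\<close> turns
    the total into \<open>e / 2\<close>.\<close>
  obtain L where L: "4 * real b / 2 ^ L \<le> e\<^sup>2 / 8"
  proof -
    obtain L where "32 * real b / e\<^sup>2 < 2 ^ L" using real_arch_pow[of 2 "32 * real b / e\<^sup>2"] by auto
    then have "4 * real b / 2 ^ L \<le> e\<^sup>2 / 8" using e by (simp add: field_simps)
    then show ?thesis using that by blast
  qed
  note lw = lead_weight_props[OF b, where L = L and c = c]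
  have irr': "\<And>h::nat. h \<ge> 1 \<Longrightarrow> real h * \<theta> \<notin> \<int>" using irr by (simp add: \<theta>_def)
  have "e\<^sup>2 / 8 > 0" using e by simp
  from rotation_sum_bound[OF lw(1,2) this irr']
  obtain C0 where C0: "C0 \<ge> 0" "\<And>\<tau> N. (\<Sum>i<N. lead_weight b L c (frac (\<tau> + real i * \<theta>)))
      \<le> (integral {0..1} (lead_weight b L c) + e\<^sup>2 / 8) * real N + C0" by blast
  \<comment> \<open>From index \<open>C1\<close> on, the logarithm is large enough for the windows
    to fit; the earlier terms are bounded by 1.\<close>
  define C1 where "C1 = nat \<lceil>real (L + c + 2) / \<theta>\<rceil>"
  have C1: "real i * \<theta> \<ge> real (L + c + 2)" if "i \<ge> C1" for i
  proof -
    have "real i \<ge> real (L + c + 2) / \<theta>" using that unfolding C1_def by linarith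
    then show ?thesis using \<theta> by (simp add: field_simps)
  qed
  have "(\<Sum>i<N. cosprod b K n (\<xi> * real r ^ i)) \<le> e * real N + (2 / e) * (real C1 + C0)"
    if \<xi>: "\<xi> > 0" and lo: "real b ^ K \<le> real b * \<xi>" and hi: "\<forall>i<N. \<xi> * real r ^ i < real b ^ (c + K + n)"
    for K n N \<xi>
  proof -
    define \<tau> where "\<tau> = log b \<xi>"
    have \<tau>: "\<tau> \<ge> real K - 1"
    proof -
      have "log b (real b ^ K) \<le> log b (real b * \<xi>)" using b lo \<xi> by (subst log_le_cancel_iff) auto
      then show ?thesis using b \<xi> by (simp add: \<tau>_def log_mult log_nat_power)
    qed
    have lg: "log b (\<xi> * real r ^ i) = \<tau> + real i * \<theta>" for i
      using b r \<xi> by (simp add: \<tau>_def \<theta>_def log_mult log_nat_power)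
    have sq: "(cosprod b K n (\<xi> * real r ^ i))\<^sup>2 \<le> (if i < C1 then 1 else 0) + lead_weight b L c (frac (\<tau> + real i * \<theta>))"
      if i: "i < N" for i
    proof (cases "i < C1")
      case True
      have "(cosprod b K n (\<xi> * real r ^ i))\<^sup>2 \<le> 1"
        using cosprod_bounds by (simp add: power_le_one)
      moreover have "lead_weight b L c (frac (\<tau> + real i * \<theta>)) \<ge> 0"
        using lw(3)[of "frac (\<tau> + real i * \<theta>)"] frac_lt_1[of "\<tau> + real i * \<theta>"] by simp
      ultimately show ?thesis using True by simp
    next
      case False
      have "log b (\<xi> * real r ^ i) < log b (real b ^ (c + K + n))"
        using hi i b r \<xi> by (subst log_less_cancel_iff) auto
      then have "log b (\<xi> * real r ^ i) < real (c + K + n + 1)"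
        using b by (simp add: log_nat_power)
      moreover have "log b (\<xi> * real r ^ i) \<ge> real (K + L + c + 1)"
        unfolding lg using \<tau> C1[of i] False by simp
      ultimately have "(cosprod b K n (\<xi> * real r ^ i))\<^sup>2 \<le> lead_weight b L c (frac (log b (\<xi> * real r ^ i)))"
        using \<xi> r b by (intro cosprod_squared_le_lead_weight) auto
      then show ?thesis using False by (simp add: lg)
    qed
    \<comment> \<open>The rotation argument controls squares only; this linear trade returns to
      first powers term by term.\<close>
    have amgm: "g \<le> e / 2 + (2 / e) * g\<^sup>2" if "g \<ge> 0" for g
    proof (cases "g \<le> e / 2")
      case True
      then show ?thesis using e by (simp add: add_increasing2)
    next
      case False
      then have "g * 1 \<le> g * (2 / e * g)" using e that by (intro mult_left_mono) (auto simp: field_simps)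
      then show ?thesis using e by (simp add: power2_eq_square algebra_simps)
    qed
    have "(\<Sum>i<N. cosprod b K n (\<xi> * real r ^ i)) \<le> (\<Sum>i<N. e / 2 + (2 / e) * (cosprod b K n (\<xi> * real r ^ i))\<^sup>2)"
      by (intro sum_mono amgm cosprod_bounds)
    also have "\<dots> \<le> (\<Sum>i<N. e / 2 + (2 / e) * ((if i < C1 then 1 else 0) + lead_weight b L c (frac (\<tau> + real i * \<theta>))))"
      using e by (intro sum_mono add_left_mono mult_left_mono sq) auto
    also have "\<dots> = e / 2 * real N + (2 / e) * ((\<Sum>i<N. if i < C1 then 1 else 0) + (\<Sum>i<N. lead_weight b L c (frac (\<tau> + real i * \<theta>))))"
      by (simp add: sum.distrib sum_distrib_left algebra_simps)
    also have "\<dots> \<le> e / 2 * real N + (2 / e) * (real C1 + (e\<^sup>2 / 4 * real N + C0))"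
    proof (intro add_left_mono mult_left_mono add_mono)
      have "(\<Sum>i<N. if i < C1 then 1 else 0 :: real) = real (card ({..<N} \<inter> {..<C1}))"
        by (simp add: sum.If_cases lessThan_def Collect_conj_eq[symmetric])
      also have "\<dots> \<le> real C1" using card_mono[of "{..<C1}" "{..<N} \<inter> {..<C1}"] by simp
      finally show "(\<Sum>i<N. if i < C1 then 1 else 0 :: real) \<le> real C1" .
      have "(integral {0..1} (lead_weight b L c) + e\<^sup>2 / 8) * real N \<le> (e\<^sup>2 / 4) * real N"
        using lw(4) L by (intro mult_right_mono) auto
      then show "(\<Sum>i<N. lead_weight b L c (frac (\<tau> + real i * \<theta>))) \<le> e\<^sup>2 / 4 * real N + C0"
        using C0(2)[of \<tau> N] by simp
    qed (use e in auto)
    also have "\<dots> = e * real N + (2 / e) * (real C1 + C0)"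
      using e by (simp add: field_simps power2_eq_square)
    finally show ?thesis .
  qed
  moreover have "(2 / e) * (real C1 + C0) \<ge> 0" using e C0 by simp
  ultimately show ?thesis by blast
qed

text \<open>Grouping by the distance to the diagonal counts the diagonal itself twice, which
  nonnegativity permits.\<close>

lemma double_sum_by_difference:
  fixes F :: "nat \<Rightarrow> nat \<Rightarrow> real"
  assumes "\<And>i j. F i j \<ge> 0"
  shows "(\<Sum>i<N. \<Sum>j<N. F i j) \<le> (\<Sum>d<N. \<Sum>i<N - d. F i (i + d) + F (i + d) i)"
proof (induction N)
  case 0
  then show ?case by simp
next
  case (Suc N)
  let ?g = "\<lambda>d i. F i (i + d) + F (i + d) i"
  have "(\<Sum>i<Suc N. \<Sum>j<Suc N. F i j) = (\<Sum>i<N. \<Sum>j<N. F i j) + ((\<Sum>i<N. F i N + F N i) + F N N)"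
    by (simp add: sum.distrib)
  also have "\<dots> \<le> (\<Sum>d<N. \<Sum>i<N - d. ?g d i) + (\<Sum>i<Suc N. F i N + F N i)"
    using Suc assms[of N N] by simp
  also have "(\<Sum>i<Suc N. F i N + F N i) = (\<Sum>d<Suc N. ?g d (N - d))"
    by (subst sum.nat_diff_reindex[symmetric]) (auto intro!: sum.cong)
  also have "(\<Sum>d<N. \<Sum>i<N - d. ?g d i) + (\<Sum>d<Suc N. ?g d (N - d))
     = (\<Sum>d<Suc N. (\<Sum>i<N - d. ?g d i) + ?g d (N - d))"
    by (simp add: sum.distrib)
  also have "\<dots> = (\<Sum>d<Suc N. \<Sum>i<Suc N - d. ?g d i)"
    by (intro sum.cong refl) (simp add: Suc_diff_le)
  finally show ?case .
qed

text \<open>For a fixed difference \<open>d\<close> of exponents the differences of frequencies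
  again form a geometric progression with ratio \<open>r\<close>, now with multiplier
  \<open>h * (r ^ d - 1) * r ^ j0\<close>. One constant from \<open>cosprod_sum_bound\<close>
  therefore serves all \<open>d\<close>.\<close>

lemma cosprod_pair_sum_bound:
  assumes b: "b \<ge> 2" and r: "r \<ge> 2" and e: "e > 0" and h: "h \<ge> (1::nat)"
    and irr: "\<And>h::nat. h \<ge> 1 \<Longrightarrow> real h * log b r \<notin> \<int>"
  shows "\<exists>C\<ge>0. \<forall>K n N j0. real b ^ K \<le> real b * real r ^ j0 \<longrightarrow> (\<forall>j<N. real r ^ (j0 + j) < real b ^ (K + n))
     \<longrightarrow> (\<Sum>i<N. \<Sum>j<N. cosprod b K n (real h * real r ^ (j0 + j) - real h * real r ^ (j0 + i)))
        \<le> e * (real N)\<^sup>2 + C * real N"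
proof -
  have "e / 2 > 0" using e by simp
  \<comment> \<open>The slack parameter is \<open>h\<close> itself, since
    \<open>h \<le> b ^ h\<close> bounds what the factor \<open>h\<close> adds to the
    logarithm.\<close>
  from cosprod_sum_bound[OF b r this irr, of h]
  obtain C where C: "C \<ge> 0" "\<And>K n N \<xi>. \<xi> > 0 \<Longrightarrow> real b ^ K \<le> real b * \<xi> \<Longrightarrow> (\<forall>i<N. \<xi> * real r ^ i < real b ^ (h + K + n))
     \<Longrightarrow> (\<Sum>i<N. cosprod b K n (\<xi> * real r ^ i)) \<le> e / 2 * real N + C" by blast
  have "(\<Sum>i<N. \<Sum>j<N. cosprod b K n (real h * real r ^ (j0 + j) - real h * real r ^ (j0 + i)))
        \<le> e * (real N)\<^sup>2 + (2 + 2 * C) * real N"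
    if lo: "real b ^ K \<le> real b * real r ^ j0" and hi: "\<forall>j<N. real r ^ (j0 + j) < real b ^ (K + n)"
    for K n N j0
  proof -
    let ?F = "\<lambda>i j. cosprod b K n (real h * real r ^ (j0 + j) - real h * real r ^ (j0 + i))"
    have sym: "?F (i + d) i = ?F i (i + d)" for i d
      using cosprod_minus[of b K n "real h * real r ^ (j0 + (i + d)) - real h * real r ^ (j0 + i)"] by simp
    have dsum: "(\<Sum>i<N - d. ?F i (i + d) + ?F (i + d) i) \<le> (if d = 0 then 2 * real N else 0) + 2 * (e / 2 * real N + C)" if "d < N" for d
    proof (cases "d = 0")
      case True
      then show ?thesis using e C(1) by (simp add: cosprod_zero)
    next
      case False
      define \<xi> where "\<xi> = real h * (real r ^ d - 1) * real r ^ j0"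
      have rd: "real r ^ d - 1 \<ge> 1"
      proof -
        have "real r ^ 1 \<le> real r ^ d" using False r by (intro power_increasing) auto
        moreover have "real r \<ge> 2" using r by simp
        ultimately show ?thesis unfolding power_one_right by linarith
      qed
      have rj: "real r ^ j > 0" for j using r by simp
      have "1 * real r ^ j0 \<le> real h * (real r ^ d - 1) * real r ^ j0"
        using rd h mult_mono[of 1 "real h" 1 "real r ^ d - 1"] by (intro mult_right_mono) auto
      then have \<xi>: "\<xi> \<ge> real r ^ j0" by (simp add: \<xi>_def)
      have F: "?F i (i + d) = cosprod b K n (\<xi> * real r ^ i)" for i
        by (simp add: \<xi>_def power_add algebra_simps)
      have "(\<Sum>i<N - d. cosprod b K n (\<xi> * real r ^ i)) \<le> e / 2 * real (N - d) + C"
      proof (rule C(2))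
        show "\<xi> > 0" using \<xi> rj[of j0] by linarith
        show "real b ^ K \<le> real b * \<xi>"
          using lo \<xi> b by (meson mult_left_mono of_nat_0_le_iff order_trans)
        show "\<forall>i<N - d. \<xi> * real r ^ i < real b ^ (h + K + n)"
        proof (intro allI impI)
          fix i assume i: "i < N - d"
          have "\<xi> * real r ^ i = real h * (real r ^ d - 1) * real r ^ (j0 + i)"
            by (simp add: \<xi>_def power_add)
          also have "\<dots> \<le> real h * real r ^ d * real r ^ (j0 + i)"
            by (intro mult_right_mono mult_left_mono) auto
          also have "\<dots> = real h * real r ^ (j0 + (i + d))" by (simp add: power_add)
          also have "\<dots> < real h * real b ^ (K + n)"
            using hi i h by (intro mult_strict_left_mono) auto
          also have "\<dots> \<le> real b ^ h * real b ^ (K + n)"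
          proof (intro mult_right_mono)
            have "h < 2 ^ h" by (rule less_exp)
            also have "(2::nat) ^ h \<le> b ^ h" using b by (rule power_mono) simp
            finally show "real h \<le> real b ^ h" by (metis less_imp_le of_nat_le_iff of_nat_power)
          qed simp
          finally show "\<xi> * real r ^ i < real b ^ (h + K + n)" by (simp add: power_add mult_ac)
        qed
      qed
      also have "\<dots> \<le> e / 2 * real N + C" using e by simp
      finally show ?thesis unfolding sym F using False by (simp add: sum_distrib_left[symmetric])
    qed
    have "(\<Sum>i<N. \<Sum>j<N. ?F i j) \<le> (\<Sum>d<N. \<Sum>i<N - d. ?F i (i + d) + ?F (i + d) i)"
      by (rule double_sum_by_difference) (rule cosprod_bounds)
    also have "\<dots> \<le> (\<Sum>d<N. (if d = 0 then 2 * real N else 0) + 2 * (e / 2 * real N + C))"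
      by (intro sum_mono dsum) auto
    also have "\<dots> \<le> 2 * real N + (\<Sum>d<N. 2 * (e / 2 * real N + C))"
      unfolding sum.distrib by (cases N) (auto simp: sum.delta')
    also have "\<dots> = e * (real N)\<^sup>2 + (2 + 2 * C) * real N"
      by (simp add: power2_eq_square algebra_simps)
    finally show ?thesis .
  qed
  then show ?thesis using C(1) by (intro exI[of _ "2 + 2 * C"]) auto
qed

section \<open>Second moments over all choices of digits\<close>

text \<open>Independence of the digits: the sum over subsets factors into terms
  \<open>cis (2 * x) + 1\<close>, each of modulus \<open>2 * \<bar>cos x\<bar>\<close>.\<close>

lemma norm_sum_Pow_cis:
  assumes "finite I"
  shows "norm (\<Sum>A\<in>Pow I. cis (2 * pi * \<xi> * (y + (\<Sum>k\<in>A. v k)))) = 2 ^ card I * (\<Prod>k\<in>I. \<bar>cos (pi * \<xi> * v k)\<bar>)"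
proof -
  have n1: "norm (cis (2 * pi * \<xi> * v k) + 1) = 2 * \<bar>cos (pi * \<xi> * v k)\<bar>" for k
  proof -
    have "cis (2 * pi * \<xi> * v k) + 1 = of_real (2 * cos (pi * \<xi> * v k)) * cis (pi * \<xi> * v k)"
      using cos_double_cos[of "pi * \<xi> * v k"] sin_double[of "pi * \<xi> * v k"]
      by (simp add: complex_eq_iff power2_eq_square mult.assoc)
    then show ?thesis by (simp add: norm_mult)
  qed
  have "cis (2 * pi * \<xi> * (y + (\<Sum>k\<in>A. v k))) = cis (2 * pi * \<xi> * y) * (\<Prod>k\<in>A. cis (2 * pi * \<xi> * v k))"
    if "A \<subseteq> I" for A
  proof -
    have "finite A" using that assms finite_subset by blast
    then have "(\<Prod>k\<in>A. cis (2 * pi * \<xi> * v k)) = cis (2 * pi * \<xi> * (\<Sum>k\<in>A. v k))"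
      by induction (auto simp: cis_mult algebra_simps)
    then show ?thesis by (simp add: cis_mult algebra_simps)
  qed
  then have "(\<Sum>A\<in>Pow I. cis (2 * pi * \<xi> * (y + (\<Sum>k\<in>A. v k))))
     = cis (2 * pi * \<xi> * y) * (\<Sum>A\<in>Pow I. (\<Prod>k\<in>A. cis (2 * pi * \<xi> * v k)) * (\<Prod>k\<in>I - A. 1))"
    unfolding sum_distrib_left by (intro sum.cong) auto
  also have "\<dots> = cis (2 * pi * \<xi> * y) * (\<Prod>k\<in>I. cis (2 * pi * \<xi> * v k) + 1)"
    by (subst prod_add[OF assms]) simp
  finally show ?thesis
    by (simp add: norm_mult prod_norm[symmetric] n1 prod.distrib)
qed

lemma second_moment_bound:
  fixes a :: "nat \<Rightarrow> real"
  assumes I: "finite I" and J: "finite J"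
  shows "(\<Sum>A\<in>Pow I. (norm (\<Sum>j\<in>J. cis (2 * pi * a j * (y + (\<Sum>k\<in>A. v k)))))\<^sup>2)
     \<le> 2 ^ card I * (\<Sum>i\<in>J. \<Sum>j\<in>J. \<Prod>k\<in>I. \<bar>cos (pi * (a j - a i) * v k)\<bar>)"
proof -
  let ?x = "\<lambda>A. y + (\<Sum>k\<in>A. v k)"
  have sq: "complex_of_real ((norm (\<Sum>j\<in>J. cis (2 * pi * a j * ?x A)))\<^sup>2)
      = (\<Sum>i\<in>J. \<Sum>j\<in>J. cis (2 * pi * (a j - a i) * ?x A))" for A
  proof -
    have "complex_of_real ((norm (\<Sum>j\<in>J. cis (2 * pi * a j * ?x A)))\<^sup>2)
      = cnj (\<Sum>j\<in>J. cis (2 * pi * a j * ?x A)) * (\<Sum>j\<in>J. cis (2 * pi * a j * ?x A))"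
      using complex_norm_square[of "\<Sum>j\<in>J. cis (2 * pi * a j * ?x A)"] by (simp add: mult.commute)
    also have "\<dots> = (\<Sum>i\<in>J. \<Sum>j\<in>J. cis (- (2 * pi * a i * ?x A)) * cis (2 * pi * a j * ?x A))"
      by (simp add: sum_product cis_cnj)
    also have "\<dots> = (\<Sum>i\<in>J. \<Sum>j\<in>J. cis (2 * pi * (a j - a i) * ?x A))"
      unfolding cis_mult by (simp add: algebra_simps)
    finally show ?thesis .
  qed
  have "(\<Sum>A\<in>Pow I. (norm (\<Sum>j\<in>J. cis (2 * pi * a j * ?x A)))\<^sup>2)
     = norm (complex_of_real (\<Sum>A\<in>Pow I. (norm (\<Sum>j\<in>J. cis (2 * pi * a j * ?x A)))\<^sup>2))"
    unfolding norm_of_real by (simp add: sum_nonneg)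
  also have "complex_of_real (\<Sum>A\<in>Pow I. (norm (\<Sum>j\<in>J. cis (2 * pi * a j * ?x A)))\<^sup>2)
     = (\<Sum>A\<in>Pow I. \<Sum>i\<in>J. \<Sum>j\<in>J. cis (2 * pi * (a j - a i) * ?x A))"
    unfolding of_real_sum sq ..
  also have "\<dots> = (\<Sum>i\<in>J. \<Sum>j\<in>J. \<Sum>A\<in>Pow I. cis (2 * pi * (a j - a i) * ?x A))"
    by (subst sum.swap, intro sum.cong refl, subst sum.swap) simp
  also have "norm \<dots> \<le> (\<Sum>i\<in>J. \<Sum>j\<in>J. norm (\<Sum>A\<in>Pow I. cis (2 * pi * (a j - a i) * ?x A)))"
    by (intro order_trans[OF norm_sum] sum_mono norm_sum)
  also have "\<dots> = 2 ^ card I * (\<Sum>i\<in>J. \<Sum>j\<in>J. \<Prod>k\<in>I. \<bar>cos (pi * (a j - a i) * v k)\<bar>)"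
    unfolding norm_sum_Pow_cis[OF I] by (simp add: sum_distrib_left)
  finally show ?thesis .
qed

definition subset_point :: "nat \<Rightarrow> nat \<Rightarrow> real \<Rightarrow> nat set \<Rightarrow> real" where
  "subset_point b K y A = y + (\<Sum>k\<in>A. 1 / real b ^ (K + k))"

text \<open>An averaging argument for all pairs \<open>(r, h)\<close> at once. If every subset
  failed for some pair, the normalised second moments would add up to at least
  \<open>2 ^ n * e\<^sup>2\<close>; the choice of \<open>\<delta>\<close> leaves at most half of
  that. \<open>N0\<close> does not depend on the prefix \<open>y\<close> or the position
  \<open>K\<close>.\<close>

lemma exists_small_exponential_sums:
  assumes b: "b \<ge> 2" and fin: "finite Q"
    and Q: "\<And>r. r \<in> Q \<Longrightarrow> r \<ge> 2 \<and> (\<forall>h::nat. h \<ge> 1 \<longrightarrow> real h * log b r \<notin> \<int>)" and e: "e > 0"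
  shows "\<exists>N0. \<forall>K n y j0 N. (\<forall>r\<in>Q. N r \<ge> N0 \<and> real b ^ K \<le> real b * real r ^ j0 r
        \<and> (\<forall>j<N r. real r ^ (j0 r + j) < real b ^ (K + n)))
     \<longrightarrow> (\<exists>A\<subseteq>{1..n}. \<forall>r\<in>Q. \<forall>h\<in>{1..H}.
        norm (\<Sum>j<N r. cis (2 * pi * (real h * real r ^ (j0 r + j)) * subset_point b K y A)) \<le> e * real (N r))"
proof -
  define M where "M = real (card Q) * real H + 1"
  have M: "M \<ge> 1" by (simp add: M_def)
  define \<delta> where "\<delta> = e\<^sup>2 / (4 * M)"
  have \<delta>: "\<delta> > 0" using e M by (simp add: \<delta>_def)
  have "\<exists>C\<ge>0. \<forall>K n N j0. real b ^ K \<le> real b * real r ^ j0 \<longrightarrow> (\<forall>j<N. real r ^ (j0 + j) < real b ^ (K + n))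
     \<longrightarrow> (\<Sum>i<N. \<Sum>j<N. cosprod b K n (real h * real r ^ (j0 + j) - real h * real r ^ (j0 + i)))
        \<le> \<delta> * (real N)\<^sup>2 + C * real N" if "r \<in> Q" "h \<in> {1..H}" for r h
    using that Q[of r] by (intro cosprod_pair_sum_bound[OF b _ \<delta>]) auto
  then obtain C where C: "\<And>r h K n N j0. r \<in> Q \<Longrightarrow> h \<in> {1..H} \<Longrightarrow> real b ^ K \<le> real b * real r ^ j0
     \<Longrightarrow> (\<forall>j<N. real r ^ (j0 + j) < real b ^ (K + n))
     \<Longrightarrow> (\<Sum>i<N. \<Sum>j<N. cosprod b K n (real h * real r ^ (j0 + j) - real h * real r ^ (j0 + i)))
        \<le> \<delta> * (real N)\<^sup>2 + C r h * real N" and C0: "\<And>r h. r \<in> Q \<Longrightarrow> h \<in> {1..H} \<Longrightarrow> C r h \<ge> 0" by metis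
  define D where "D = (\<Sum>r\<in>Q. \<Sum>h\<in>{1..H}. C r h)"
  have CD: "C r h \<le> D" if "r \<in> Q" "h \<in> {1..H}" for r h
  proof -
    have "C r h \<le> (\<Sum>h\<in>{1..H}. C r h)" using that C0 by (intro member_le_sum) auto
    also have "\<dots> \<le> D" unfolding D_def using that C0 fin by (intro member_le_sum sum_nonneg) auto
    finally show ?thesis .
  qed
  \<comment> \<open>From this length on, the linear error term is absorbed into another
    \<open>\<delta>\<close> times the square of the length.\<close>
  define N0 where "N0 = nat \<lceil>D / \<delta>\<rceil> + 1"
  have "\<exists>A\<subseteq>{1..n}. \<forall>r\<in>Q. \<forall>h\<in>{1..H}.
        norm (\<Sum>j<N r. cis (2 * pi * (real h * real r ^ (j0 r + j)) * subset_point b K y A)) \<le> e * real (N r)"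
    if hyp: "\<forall>r\<in>Q. N r \<ge> N0 \<and> real b ^ K \<le> real b * real r ^ j0 r
        \<and> (\<forall>j<N r. real r ^ (j0 r + j) < real b ^ (K + n))" for K n y j0 N
  proof (rule ccontr)
    define S where "S = (\<lambda>A r h. norm (\<Sum>j<N r. cis (2 * pi * (real h * real r ^ (j0 r + j)) * subset_point b K y A)))"
    assume "\<not> (\<exists>A\<subseteq>{1..n}. \<forall>r\<in>Q. \<forall>h\<in>{1..H}.
        norm (\<Sum>j<N r. cis (2 * pi * (real h * real r ^ (j0 r + j)) * subset_point b K y A)) \<le> e * real (N r))"
    then have bad: "\<exists>r\<in>Q. \<exists>h\<in>{1..H}. S A r h > e * real (N r)" if "A \<subseteq> {1..n}" for A
      using that unfolding S_def by (meson not_le)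
    have Npos: "real (N r) > 0" "real (N r) \<ge> D / \<delta>" if "r \<in> Q" for r
    proof -
      have "N r \<ge> N0" using hyp that by blast
      then show "real (N r) > 0" "real (N r) \<ge> D / \<delta>" unfolding N0_def by linarith+
    qed
    have mom: "(\<Sum>A\<in>Pow {1..n}. (S A r h)\<^sup>2 / (real (N r))\<^sup>2) \<le> 2 ^ n * (2 * \<delta>)"
      if rh: "r \<in> Q" "h \<in> {1..H}" for r h
    proof -
      have "(\<Sum>A\<in>Pow {1..n}. (S A r h)\<^sup>2)
        \<le> 2 ^ n * (\<Sum>i<N r. \<Sum>j<N r. cosprod b K n (real h * real r ^ (j0 r + j) - real h * real r ^ (j0 r + i)))"
        using second_moment_bound[of "{1..n}" "{..<N r}" "\<lambda>j. real h * real r ^ (j0 r + j)" y "\<lambda>k. 1 / real b ^ (K + k)"]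
        by (simp add: S_def subset_point_def cosprod_def)
      also have "\<dots> \<le> 2 ^ n * (\<delta> * (real (N r))\<^sup>2 + C r h * real (N r))"
        using C[OF rh] hyp rh by (intro mult_left_mono) auto
      also have "\<dots> \<le> 2 ^ n * (\<delta> * (real (N r))\<^sup>2 + (\<delta> * real (N r)) * real (N r))"
      proof (intro mult_left_mono add_left_mono mult_right_mono)
        have "C r h \<le> D" using CD rh by blast
        also have "D \<le> \<delta> * real (N r)" using Npos(2)[OF rh(1)] \<delta> by (simp add: field_simps)
        finally show "C r h \<le> \<delta> * real (N r)" .
      qed auto
      also have "\<dots> = 2 ^ n * (2 * \<delta>) * (real (N r))\<^sup>2" by (simp add: power2_eq_square algebra_simps)
      finally show ?thesis using Npos(1)[OF rh(1)]
        by (simp add: sum_divide_distrib[symmetric] divide_le_eq)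
    qed
    have "2 ^ n * e\<^sup>2 = (\<Sum>A\<in>Pow {1..n}. e\<^sup>2)" by (simp add: card_Pow)
    also have "\<dots> \<le> (\<Sum>A\<in>Pow {1..n}. \<Sum>r\<in>Q. \<Sum>h\<in>{1..H}. (S A r h)\<^sup>2 / (real (N r))\<^sup>2)"
    proof (intro sum_mono)
      fix A assume "A \<in> Pow {1..n}"
      then obtain r h where rh: "r \<in> Q" "h \<in> {1..H}" "S A r h > e * real (N r)" using bad by blast
      have "e\<^sup>2 \<le> (S A r h)\<^sup>2 / (real (N r))\<^sup>2"
      proof -
        have "(e * real (N r))\<^sup>2 \<le> (S A r h)\<^sup>2" using rh e by (intro power_mono) auto
        then show ?thesis using Npos(1)[OF rh(1)] by (simp add: power_mult_distrib le_divide_eq)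
      qed
      also have "\<dots> \<le> (\<Sum>h\<in>{1..H}. (S A r h)\<^sup>2 / (real (N r))\<^sup>2)"
        using rh by (intro member_le_sum) auto
      also have "\<dots> \<le> (\<Sum>r\<in>Q. \<Sum>h\<in>{1..H}. (S A r h)\<^sup>2 / (real (N r))\<^sup>2)"
        using rh fin by (intro member_le_sum[of r Q] sum_nonneg) auto
      finally show "e\<^sup>2 \<le> (\<Sum>r\<in>Q. \<Sum>h\<in>{1..H}. (S A r h)\<^sup>2 / (real (N r))\<^sup>2)" .
    qed
    also have "\<dots> = (\<Sum>r\<in>Q. \<Sum>h\<in>{1..H}. \<Sum>A\<in>Pow {1..n}. (S A r h)\<^sup>2 / (real (N r))\<^sup>2)"
      by (subst sum.swap, intro sum.cong refl, subst sum.swap) simp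
    also have "\<dots> \<le> (\<Sum>r\<in>Q. \<Sum>h\<in>{1..H}. 2 ^ n * (2 * \<delta>))"
      by (intro sum_mono mom)
    also have "\<dots> = 2 ^ n * (2 * \<delta>) * (real (card Q) * real H)" by simp
    also have "\<dots> \<le> 2 ^ n * (2 * \<delta>) * M" using \<delta> by (intro mult_left_mono) (auto simp: M_def)
    also have "\<dots> = 2 ^ n * (e\<^sup>2 / 2)" using M by (simp add: \<delta>_def)
    finally show False using e by simp
  qed
  then show ?thesis by blast
qed

section \<open>Good blocks\<close>

definition ceillog :: "nat \<Rightarrow> nat \<Rightarrow> nat" where
  "ceillog r T = (LEAST j. T \<le> r ^ j)"

lemma ceillog_le_iff:
  assumes "r \<ge> 2"
  shows "ceillog r T \<le> j \<longleftrightarrow> T \<le> r ^ j"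
proof
  assume "T \<le> r ^ j"
  then show "ceillog r T \<le> j" unfolding ceillog_def by (rule Least_le)
next
  have "T < 2 ^ T" by (rule less_exp)
  also have "(2::nat) ^ T \<le> r ^ T" using assms by (rule power_mono) simp
  finally have "T \<le> r ^ T" by simp
  then have "T \<le> r ^ ceillog r T" unfolding ceillog_def by (rule LeastI)
  moreover assume "ceillog r T \<le> j"
  then have "r ^ ceillog r T \<le> r ^ j" using assms by (intro power_increasing) auto
  ultimately show "T \<le> r ^ j" by simp
qed

lemma less_ceillog_iff: "r \<ge> 2 \<Longrightarrow> j < ceillog r T \<longleftrightarrow> r ^ j < T"
  by (meson ceillog_le_iff not_le)

lemma le_power_ceillog: "r \<ge> 2 \<Longrightarrow> T \<le> r ^ ceillog r T"
  using ceillog_le_iff by blast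

lemma power_ceillog_le:
  assumes "r \<ge> 2" "T \<ge> 1"
  shows "r ^ ceillog r T \<le> r * T"
proof (cases "ceillog r T")
  case 0
  then show ?thesis using assms by simp
next
  case (Suc j)
  then have "r ^ j < T" using less_ceillog_iff[OF assms(1), of j T] by simp
  then show ?thesis by (simp add: Suc)
qed

lemma ceillog_add_le:
  assumes "r \<ge> 2" "T \<ge> 1" "T * r ^ M \<le> T'"
  shows "ceillog r T + M \<le> ceillog r T'"
proof -
  have T': "T * r ^ M \<le> r ^ ceillog r T'" using le_power_ceillog[OF assms(1)] assms(3) order_trans by blast
  moreover have "1 * r ^ M \<le> T * r ^ M" using assms(2) by (rule mult_right_mono) simp
  ultimately have "r ^ M \<le> r ^ ceillog r T'" by linarith
  then have M: "M \<le> ceillog r T'" using assms(1) by (simp add: power_increasing_iff)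
  then have "r ^ ceillog r T' = r ^ (ceillog r T' - M) * r ^ M" by (simp flip: power_add)
  then have "T \<le> r ^ (ceillog r T' - M)" using T' assms(1) by simp
  then have "ceillog r T \<le> ceillog r T' - M" using ceillog_le_iff[OF assms(1)] by blast
  then show ?thesis using M by simp
qed

text \<open>The exponents whose orbit points are out of reach at precision \<open>1 / T\<close> but
  come into reach at precision \<open>1 / T'\<close>. Successive windows are adjacent intervals of
  exponents.\<close>

definition window :: "nat \<Rightarrow> nat \<Rightarrow> nat \<Rightarrow> nat set" where
  "window r T T' = {j. T \<le> r ^ j \<and> r ^ j < T'}"

lemma window_eq: "r \<ge> 2 \<Longrightarrow> window r T T' = {ceillog r T..<ceillog r T'}"
  by (auto simp: window_def ceillog_le_iff less_ceillog_iff)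

lemma frac_of_nat_divide:
  assumes "n > 0"
  shows "frac (real a / real n) = real (a mod n) / real n"
proof -
  have "real a = real n * real (a div n) + real (a mod n)"
    by (metis mult_div_mod_eq of_nat_add of_nat_mult)
  then have "real a / real n = real (a div n) + real (a mod n) / real n"
    using assms by (simp add: field_simps)
  moreover have "real (a mod n) / real n < 1" using assms by simp
  ultimately show ?thesis by (simp add: frac_unique_iff)
qed

text \<open>One trapezoidal majorant serves every cell: translating the cell multiplies each
  exponential sum by a unimodular factor, so \<open>H\<close> and \<open>e\<close> depend on
  \<open>m\<close> only. The permitted excess \<open>1 / m\<^sup>2\<close> equals
  \<open>4 * \<eta>\<close>, half for the widened support and half for the two errors in the
  sum.\<close>

lemma cell_bound:
  assumes m: "m \<ge> (1::nat)"
  shows "\<exists>(H::nat) e::real. e > 0 \<and> (\<forall>(J::nat set) (z::nat \<Rightarrow> real) u. finite J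
      \<longrightarrow> (\<forall>h\<in>{1..H}. norm (\<Sum>j\<in>J. cis (2 * pi * real h * z j)) \<le> e * real (card J))
      \<longrightarrow> m\<^sup>2 * card {j\<in>J. real u / real m \<le> frac (z j) \<and> frac (z j) < real (u + 1) / real m} \<le> (m + 1) * card J)"
\<comment> \<open>For \<open>m = 1\<close> the bound is trivial, while the widened cell would be
  longer than the circle.\<close>
proof (cases "m = 1")
  case True
  have "m\<^sup>2 * card {j\<in>J. real u / real m \<le> frac (z j) \<and> frac (z j) < real (u + 1) / real m} \<le> (m + 1) * card J"
    if "finite J" for J :: "nat set" and z :: "nat \<Rightarrow> real" and u
    using card_mono[OF that, of "{j\<in>J. real u / real m \<le> frac (z j) \<and> frac (z j) < real (u + 1) / real m}"] True
    by simp
  then show ?thesis by (intro exI[of _ 0] exI[of _ 1]) auto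
next
  case False
  then have m2: "real m \<ge> 2" using m by linarith
  define \<eta> where "\<eta> = 1 / (4 * (real m)\<^sup>2)"
  have \<eta>: "\<eta> > 0" using m2 by (simp add: \<eta>_def)
  define w where "w = 1 / real m + 2 * \<eta>"
  have w1: "w \<le> 1"
  proof -
    have "2 * \<eta> \<le> 1 / real m" using m2 by (simp add: \<eta>_def field_simps power2_eq_square)
    moreover have "1 / real m \<le> 1 / 2" using m2 by (simp add: field_simps)
    ultimately show ?thesis by (simp add: w_def)
  qed
  define f where "f = (\<lambda>t::real. max 0 (min 1 (min (t / \<eta>) ((w - t) / \<eta>))))"
  have cf: "continuous_on {0..1} f" unfolding f_def using \<eta> by (intro continuous_intros) auto
  have f0: "f 0 = f 1" 
  proof -
    have "(w - 1) / \<eta> \<le> 0" using w1 \<eta> by (simp add: divide_nonpos_pos)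
    then have "f 1 = 0" unfolding f_def by linarith
    moreover have "f 0 = 0" by (simp add: f_def)
    ultimately show ?thesis by simp
  qed
  have fint: "integral {0..1} f \<le> w"
  proof -
    have w0: "w \<ge> 0" using \<eta> by (simp add: w_def)
    have "((\<lambda>t. if t \<in> {0..w} then 1 else 0 :: real) has_integral w) {0..1}"
    proof -
      have "((\<lambda>t. 1::real) has_integral w) {0..w}" using has_integral_const_real[of "1::real" 0 w] w0 by simp
      then show ?thesis by (subst has_integral_restrict) (use w1 in auto)
    qed
    moreover have "(f has_integral integral {0..1} f) {0..1}"
      using integrable_continuous_real[OF cf] by (rule integrable_integral)
    moreover have "f t \<le> (if t \<in> {0..w} then 1 else 0)" if "t \<in> {0..1}" for t
    proof (cases "t \<le> w")
      case True
      then show ?thesis using that by (simp add: f_def)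
    next
      case False
      then have "(w - t) / \<eta> \<le> 0" using \<eta> by (simp add: divide_nonpos_pos)
      then have "f t = 0" unfolding f_def by linarith
      then show ?thesis by simp
    qed
    ultimately show ?thesis using has_integral_le by blast
  qed
  obtain H C where HC: "C \<ge> 0" "\<And>(J::nat set) x. finite J \<Longrightarrow>
     \<bar>(\<Sum>j\<in>J. f (frac (x j))) - real (card J) * integral {0..1} f\<bar>
       \<le> \<eta> * real (card J) + C * (\<Sum>h=1..H. norm (\<Sum>j\<in>J. cis (2 * pi * real h * x j)))"
    using weyl_bound[OF cf f0 \<eta>] by blast
  define e where "e = \<eta> / ((C + 1) * (real H + 1))"
  have e: "e > 0" using \<eta> HC(1) by (simp add: e_def)
  have eC: "C * (real H * e) \<le> \<eta>"
  proof -
    have "C * real H * \<eta> \<le> (C + 1) * (real H + 1) * \<eta>"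
      using HC(1) \<eta> by (intro mult_right_mono mult_mono) auto
    moreover have "(C + 1) * (real H + 1) > 0" using HC(1) by simp
    ultimately have "C * real H * \<eta> / ((C + 1) * (real H + 1)) \<le> \<eta>"
      by (simp only: pos_divide_le_eq mult.commute)
    then show ?thesis by (simp only: e_def times_divide_eq_right mult.assoc)
  qed
  have "m\<^sup>2 * card {j\<in>J. real u / real m \<le> frac (z j) \<and> frac (z j) < real (u + 1) / real m} \<le> (m + 1) * card J"
    if J: "finite J" and small: "\<And>h. h \<in> {1..H} \<Longrightarrow> norm (\<Sum>j\<in>J. cis (2 * pi * real h * z j)) \<le> e * real (card J)"
    for J :: "nat set" and z :: "nat \<Rightarrow> real" and u
  proof -
    \<comment> \<open>The translation takes the cell to the interval from \<open>\<eta>\<close> to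
      \<open>1 / m + \<eta>\<close>, where the trapezoid equals 1.\<close>
    define x where "x = (\<lambda>j. z j + (\<eta> - real u / real m))"
    let ?S = "{j\<in>J. real u / real m \<le> frac (z j) \<and> frac (z j) < real (u + 1) / real m}"
    have f1: "f (frac (x j)) = 1" if "j \<in> ?S" for j
    proof -
      let ?y = "frac (z j) + (\<eta> - real u / real m)"
      have y: "\<eta> \<le> ?y" "?y < 1 / real m + \<eta>" using that by (auto simp: add_divide_distrib)
      then have "0 \<le> ?y" "?y < 1" using \<eta> w1 by (auto simp: w_def)
      moreover have "x j - ?y \<in> \<int>"
      proof -
        have "x j - ?y = of_int \<lfloor>z j\<rfloor>" by (simp add: x_def frac_def)
        then show ?thesis by (simp only: Ints_of_int)
      qed
      ultimately have "frac (x j) = ?y" by (simp only: frac_unique_iff)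
      moreover have "f ?y = 1"
      proof -
        have "?y / \<eta> \<ge> 1" "(w - ?y) / \<eta> \<ge> 1" using y \<eta> by (auto simp: w_def le_divide_eq)
        then show ?thesis by (simp add: f_def min_def max_def)
      qed
      ultimately show ?thesis by simp
    qed
    have fpos: "f t \<ge> 0" for t by (simp add: f_def)
    have "norm (\<Sum>j\<in>J. cis (2 * pi * real h * x j)) = norm (\<Sum>j\<in>J. cis (2 * pi * real h * z j))" for h
    proof -
      have "(\<Sum>j\<in>J. cis (2 * pi * real h * x j)) = cis (2 * pi * real h * (\<eta> - real u / real m)) * (\<Sum>j\<in>J. cis (2 * pi * real h * z j))"
        unfolding sum_distrib_left cis_mult by (simp add: x_def ring_distribs add_ac)
      then show ?thesis by (simp add: norm_mult)
    qed
    then have "(\<Sum>h=1..H. norm (\<Sum>j\<in>J. cis (2 * pi * real h * x j))) \<le> (\<Sum>h=1..H. e * real (card J))"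
      using small by (intro sum_mono) auto
    then have "C * (\<Sum>h=1..H. norm (\<Sum>j\<in>J. cis (2 * pi * real h * x j))) \<le> C * (real H * e * real (card J))"
      using HC(1) by (intro mult_left_mono) auto
    also have "\<dots> = C * (real H * e) * real (card J)" by simp
    also have "\<dots> \<le> \<eta> * real (card J)" using eC by (rule mult_right_mono) simp
    finally have CS: "C * (\<Sum>h=1..H. norm (\<Sum>j\<in>J. cis (2 * pi * real h * x j))) \<le> \<eta> * real (card J)" .
    have "real (card ?S) = (\<Sum>j\<in>?S. f (frac (x j)))" using f1 by simp
    also have "\<dots> \<le> (\<Sum>j\<in>J. f (frac (x j)))" using J fpos by (intro sum_mono2) auto
    also have "\<dots> \<le> real (card J) * integral {0..1} f + \<eta> * real (card J) + \<eta> * real (card J)"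
      using HC(2)[OF J, of x] CS by linarith
    also have "real (card J) * integral {0..1} f \<le> real (card J) * w" using fint by (rule mult_left_mono) simp
    finally have "real (card ?S) \<le> real (card J) * (w + 2 * \<eta>)" by (simp add: algebra_simps)
    also have "w + 2 * \<eta> = (real m + 1) / (real m)\<^sup>2"
      using m2 by (simp add: w_def \<eta>_def field_simps power2_eq_square)
    finally have "(real m)\<^sup>2 * real (card ?S) \<le> (real m + 1) * real (card J)"
      using m2 by (simp add: field_simps)
    then have "real (m\<^sup>2 * card ?S) \<le> real ((m + 1) * card J)"
      by (simp only: of_nat_mult of_nat_power of_nat_add of_nat_1)
    then show ?thesis unfolding of_nat_le_iff .
  qed
  then show ?thesis using e by blast
qed

text \<open>Multiplication by \<open>b ^ k\<close> makes \<open>Y\<close> and the first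
  \<open>k - K\<close> digits vanish modulo \<open>b ^ (K + n)\<close>. The rest \<open>S\<close>
  has digits 0 and 1 only, so \<open>S * (b - 1)\<close> stays below the modulus, and adding
  \<open>S\<close> once more gives the factor 2.\<close>

lemma digit_tail_bound:
  fixes b n K k Y :: nat
  assumes b: "b \<ge> 2" and A: "A \<subseteq> {1..n}" and k: "K \<le> k" "k < K + n"
  shows "(b ^ k * (Y * b ^ n + (\<Sum>i\<in>A. b ^ (n - i))) mod b ^ (K + n)) * b < 2 * b ^ (K + n)"
proof -
  define S where "S = (\<Sum>i\<in>A \<inter> {k - K<..}. b ^ (k + n - i))"
  have fin: "finite A" using A finite_subset by blast
  have "b ^ k * (Y * b ^ n + (\<Sum>i\<in>A. b ^ (n - i))) = Y * b ^ (k + n) + (\<Sum>i\<in>A. b ^ (k + n - i))"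
  proof -
    have "b ^ k * b ^ (n - i) = b ^ (k + n - i)" if "i \<in> A" for i
    proof -
      have "k + (n - i) = k + n - i" using that A by auto
      then show ?thesis by (metis power_add)
    qed
    then have "b ^ k * (\<Sum>i\<in>A. b ^ (n - i)) = (\<Sum>i\<in>A. b ^ (k + n - i))"
      unfolding sum_distrib_left by (rule sum.cong[OF refl])
    then show ?thesis unfolding distrib_left by (simp add: power_add)
  qed
  also have "(\<Sum>i\<in>A. b ^ (k + n - i)) = (\<Sum>i\<in>A \<inter> {..k - K}. b ^ (k + n - i)) + S"
  proof -
    have "A = (A \<inter> {..k - K}) \<union> (A \<inter> {k - K<..})" by auto
    then have "(\<Sum>i\<in>A. b ^ (k + n - i)) = (\<Sum>i\<in>(A \<inter> {..k - K}) \<union> (A \<inter> {k - K<..}). b ^ (k + n - i))" by simp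
    also have "\<dots> = (\<Sum>i\<in>A \<inter> {..k - K}. b ^ (k + n - i)) + S"
      unfolding S_def using fin by (intro sum.union_disjoint) auto
    finally show ?thesis .
  qed
  finally have eq: "b ^ k * (Y * b ^ n + (\<Sum>i\<in>A. b ^ (n - i)))
     = (Y * b ^ (k + n) + (\<Sum>i\<in>A \<inter> {..k - K}. b ^ (k + n - i))) + S" by simp
  have "b ^ (K + n) dvd (Y * b ^ (k + n) + (\<Sum>i\<in>A \<inter> {..k - K}. b ^ (k + n - i)))"
    using k by (intro dvd_add dvd_mult dvd_sum le_imp_power_dvd) auto
  then have "b ^ k * (Y * b ^ n + (\<Sum>i\<in>A. b ^ (n - i))) mod b ^ (K + n) = S mod b ^ (K + n)"
    unfolding eq by (elim dvdE) simp
  then have le: "b ^ k * (Y * b ^ n + (\<Sum>i\<in>A. b ^ (n - i))) mod b ^ (K + n) \<le> S" by simp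
  have Sb: "S * (b - 1) < b ^ (K + n)"
  proof -
    have inj: "inj_on (\<lambda>i. k + n - i) (A \<inter> {k - K<..})"
    proof (rule inj_onI)
      fix i j assume "i \<in> A \<inter> {k - K<..}" "j \<in> A \<inter> {k - K<..}" "k + n - i = k + n - j"
      moreover have "i \<le> n" "j \<le> n" using calculation A by auto
      ultimately show "i = j" by linarith
    qed
    have "S = (\<Sum>e\<in>(\<lambda>i. k + n - i) ` (A \<inter> {k - K<..}). b ^ e)"
      unfolding S_def by (subst sum.reindex[OF inj]) simp
    also have "\<dots> \<le> (\<Sum>e<K + n. b ^ e)"
      using k A by (intro sum_mono2) auto
    finally have "S * (b - 1) \<le> (\<Sum>e<K + n. b ^ e) * (b - 1)" by (rule mult_right_mono) simp
    also have "\<dots> < b ^ (K + n)"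
    proof -
      have "(\<Sum>e<M. b ^ e) * (b - 1) < b ^ M" for M
      proof (induction M)
        case (Suc M)
        have "(\<Sum>e<Suc M. b ^ e) * (b - 1) = (\<Sum>e<M. b ^ e) * (b - 1) + b ^ M * (b - 1)"
          by (simp add: add_mult_distrib)
        also have "\<dots> < b ^ M + b ^ M * (b - 1)" using Suc by simp
        also have "\<dots> = b ^ Suc M" using b by (cases b) auto
        finally show ?case .
      qed simp
      then show ?thesis .
    qed
    finally show ?thesis .
  qed
  have "S \<le> S * (b - 1)" using b by (cases b) auto
  moreover have "S * b = S * (b - 1) + S" using b by (cases b) auto
  ultimately have "S * b < 2 * b ^ (K + n)" using Sb by linarith
  then show ?thesis using le by (meson le_less_trans mult_right_mono zero_le)
qed

text \<open>\<open>T\<close> need not be a power of \<open>b\<close>, because earlier steps may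
  belong to other levels. So \<open>X / T\<close> is first rounded up to denominator
  \<open>b ^ K\<close>. The rounding and the new digits each move the value by at most
  \<open>1 / T\<close>, whence the term \<open>2 * T'\<close>. \<open>B\<close> is fixed before
  \<open>T\<close> and \<open>X\<close>.\<close>

lemma exists_good_block:
  fixes b m D :: nat and Q :: "nat set"
  assumes b: "b \<ge> 2" and m: "m \<ge> 1" and fin: "finite Q"
    and Q: "\<And>r. r \<in> Q \<Longrightarrow> r \<ge> 2 \<and> (\<forall>h::nat. h \<ge> 1 \<longrightarrow> real h * log b r \<notin> \<int>)"
  shows "\<exists>B. \<forall>T X. T \<ge> 1 \<longrightarrow> (\<exists>T' X'. T * D \<le> T' \<and> T' \<le> B * T \<and> X * T' \<le> X' * T \<and> X' * T \<le> X * T' + 2 * T'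
     \<and> (\<forall>k. T \<le> b ^ k \<and> b ^ k < T' \<longrightarrow> (b ^ k * X' mod T') * b < 2 * T')
     \<and> (\<forall>r\<in>Q. \<forall>u<m. m\<^sup>2 * card {j\<in>window r T T'. u * T' \<le> m * (r ^ j * X' mod T') \<and> m * (r ^ j * X' mod T') < (u + 1) * T'}
           \<le> (m + 1) * card (window r T T')))"
proof -
  obtain H :: nat and e :: real where e: "e > 0"
    and cell: "\<And>(J::nat set) (z::nat \<Rightarrow> real) u. finite J \<Longrightarrow> (\<forall>h\<in>{1..H}. norm (\<Sum>j\<in>J. cis (2 * pi * real h * z j)) \<le> e * real (card J))
      \<Longrightarrow> m\<^sup>2 * card {j\<in>J. real u / real m \<le> frac (z j) \<and> frac (z j) < real (u + 1) / real m} \<le> (m + 1) * card J"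
    using cell_bound[OF m] by blast
  obtain N0 where "\<forall>K n y j0 N. (\<forall>r\<in>Q. N r \<ge> N0 \<and> real b ^ K \<le> real b * real r ^ j0 r
        \<and> (\<forall>j<N r. real r ^ (j0 r + j) < real b ^ (K + n)))
     \<longrightarrow> (\<exists>A\<subseteq>{1..n}. \<forall>r\<in>Q. \<forall>h\<in>{1..H}.
        norm (\<Sum>j<N r. cis (2 * pi * (real h * real r ^ (j0 r + j)) * subset_point b K y A)) \<le> e * real (N r))"
    by (rule exE[OF exists_small_exponential_sums[OF b fin Q e, of H]])
  note N0 = this[rule_format]
  \<comment> \<open>This makes \<open>b ^ n\<close> at least \<open>D\<close> and at least every
    \<open>r ^ N0\<close>, so each window has at least \<open>N0\<close> elements.\<close>
  define n where "n = D + (\<Sum>r\<in>Q. r * N0)"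
  have bn: "2 ^ n \<le> b ^ n" using b by (rule power_mono) simp
  have nD: "D \<le> b ^ n"
  proof -
    have "D \<le> n" by (simp add: n_def)
    also have "n < 2 ^ n" by (rule less_exp)
    finally show ?thesis using bn by linarith
  qed
  have nr: "r ^ N0 \<le> b ^ n" if "r \<in> Q" for r
  proof -
    have "r \<le> 2 ^ r" using less_exp[of r] by simp
    then have "r ^ N0 \<le> (2 ^ r) ^ N0" by (rule power_mono) simp
    also have "\<dots> = 2 ^ (r * N0)" by (simp add: power_mult)
    also have "\<dots> \<le> 2 ^ n"
    proof (rule power_increasing)
      have "r * N0 \<le> (\<Sum>r\<in>Q. r * N0)" using fin that by (intro member_le_sum) auto
      then show "r * N0 \<le> n" by (simp add: n_def)
    qed simp
    finally show ?thesis using bn by linarith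
  qed
  show ?thesis
  proof (rule exI[of _ "b ^ (n + 1)"], intro allI impI)
    fix T X :: nat assume T: "T \<ge> 1"
    define K where "K = ceillog b T"
    define T' where "T' = b ^ (K + n)"
    have TK: "T \<le> b ^ K" unfolding K_def by (rule le_power_ceillog[OF b])
    have KT: "b ^ K \<le> b * T" unfolding K_def by (rule power_ceillog_le[OF b T])
    have T'0: "T' > 0" using b by (simp add: T'_def)
    have TT': "T * b ^ n \<le> T'" using TK by (simp add: T'_def power_add)
    \<comment> \<open>Division rounded upwards, so that the approximations never decrease.\<close>
    define Y where "Y = (X * b ^ K + (T - 1)) div T"
    have Y1: "X * b ^ K \<le> Y * T" and Y2: "Y * T \<le> X * b ^ K + T"
    proof -
      have "Y * T + (X * b ^ K + (T - 1)) mod T = X * b ^ K + (T - 1)"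
        unfolding Y_def by (rule div_mult_mod_eq)
      moreover have "(X * b ^ K + (T - 1)) mod T < T" using T by simp
      ultimately show "X * b ^ K \<le> Y * T" "Y * T \<le> X * b ^ K + T" using T by linarith+
    qed
    define N where "N = (\<lambda>r. ceillog r T' - ceillog r T)"
    have hyp: "\<forall>r\<in>Q. N r \<ge> N0 \<and> real b ^ K \<le> real b * real r ^ ceillog r T
        \<and> (\<forall>j<N r. real r ^ (ceillog r T + j) < real b ^ (K + n))"
    proof (intro ballI conjI allI impI)
      fix r assume r: "r \<in> Q"
      then have r2: "r \<ge> 2" using Q by blast
      have "T * r ^ N0 \<le> T'" using nr[OF r] TT' by (meson mult_le_mono2 order_trans)
      then show "N r \<ge> N0" using ceillog_add_le[OF r2 T, of N0 T'] by (simp add: N_def)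
      have "b ^ K \<le> b * r ^ ceillog r T"
        using KT le_power_ceillog[OF r2, of T] by (meson mult_le_mono2 order_trans)
      then show "real b ^ K \<le> real b * real r ^ ceillog r T"
        by (metis of_nat_le_iff of_nat_mult of_nat_power)
      fix j assume "j < N r"
      then have "ceillog r T + j < ceillog r T'" by (simp add: N_def)
      then have "r ^ (ceillog r T + j) < b ^ (K + n)" using less_ceillog_iff[OF r2] by (simp add: T'_def)
      then show "real r ^ (ceillog r T + j) < real b ^ (K + n)"
        by (metis of_nat_less_iff of_nat_power)
    qed
    obtain A where A: "A \<subseteq> {1..n}" and small: "\<And>r h. r \<in> Q \<Longrightarrow> h \<in> {1..H} \<Longrightarrow>
        norm (\<Sum>j<N r. cis (2 * pi * (real h * real r ^ (ceillog r T + j)) * subset_point b K (real Y / real b ^ K) A)) \<le> e * real (N r)"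
      using N0[of N K "\<lambda>r. ceillog r T" n "real Y / real b ^ K"] hyp by blast
    define W where "W = (\<Sum>i\<in>A. b ^ (n - i))"
    define X' where "X' = Y * b ^ n + W"
    have sp: "subset_point b K (real Y / real b ^ K) A = real X' / real T'"
    proof -
      have "1 / real b ^ (K + i) = real (b ^ (n - i)) / real T'" if "i \<in> A" for i
      proof -
        have "K + i + (n - i) = K + n" using that A by auto
        then have "real T' = real b ^ (K + i) * real b ^ (n - i)"
          unfolding T'_def by (metis of_nat_power power_add)
        then show ?thesis using b by simp
      qed
      then have "(\<Sum>i\<in>A. 1 / real b ^ (K + i)) = real W / real T'"
        by (simp add: W_def sum_divide_distrib)
      moreover have "real Y / real b ^ K = real (Y * b ^ n) / real T'"
        using b by (simp add: T'_def power_add)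
      ultimately show ?thesis by (simp add: subset_point_def X'_def add_divide_distrib)
    qed
    have Wb: "W \<le> b ^ n"
    proof (cases "n = 0")
      case True
      then have "A = {}" using A by auto
      then show ?thesis by (simp add: W_def)
    next
      case False
      have "W \<le> (\<Sum>e<n. b ^ e)"
      proof -
        have inj: "inj_on (\<lambda>i. n - i) A" 
          using A by (intro inj_onI) (metis atLeastAtMost_iff diff_diff_cancel subsetD)
        have "W = (\<Sum>e\<in>(\<lambda>i. n - i) ` A. b ^ e)" unfolding W_def by (subst sum.reindex[OF inj]) simp
        also have "\<dots> \<le> (\<Sum>e<n. b ^ e)" using A by (intro sum_mono2) auto
        finally show ?thesis .
      qed
      moreover have "(\<Sum>e<M. b ^ e) \<le> b ^ M" for M
      proof (induction M)
        case (Suc M)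
        have "b ^ M * 2 \<le> b ^ M * b" using b by (rule mult_le_mono2)
        then show ?case using Suc unfolding sum.lessThan_Suc power_Suc2 by linarith
      qed simp
      ultimately show ?thesis using order_trans by blast
    qed
    have XT: "X * T' = X * b ^ K * b ^ n" by (simp add: T'_def power_add)
    have XT': "X' * T = Y * T * b ^ n + W * T" by (simp add: X'_def algebra_simps)
    have c1: "X * T' \<le> X' * T"
    proof -
      have "X * b ^ K * b ^ n \<le> Y * T * b ^ n" using Y1 by (rule mult_le_mono1)
      then show ?thesis unfolding XT XT' by linarith
    qed
    have c2: "X' * T \<le> X * T' + 2 * T'"
    proof -
      have "Y * T * b ^ n \<le> (X * b ^ K + T) * b ^ n" using Y2 by (rule mult_le_mono1)
      moreover have "W * T \<le> b ^ n * T" using Wb by (rule mult_le_mono1)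
      ultimately have "X' * T \<le> X * T' + 2 * (T * b ^ n)"
        unfolding XT XT' by (simp only: add_mult_distrib mult.commute[of "b ^ n" T])
      then show ?thesis using TT' by linarith
    qed
    have c3: "(b ^ k * X' mod T') * b < 2 * T'" if "T \<le> b ^ k" "b ^ k < T'" for k
    proof -
      have "K \<le> k" using that(1) ceillog_le_iff[OF b] by (simp add: K_def)
      moreover have "k < K + n" using that(2) b by (simp add: T'_def power_strict_increasing_iff)
      ultimately show ?thesis unfolding X'_def T'_def W_def by (rule digit_tail_bound[OF b A])
    qed
    have c4: "m\<^sup>2 * card {j\<in>window r T T'. u * T' \<le> m * (r ^ j * X' mod T') \<and> m * (r ^ j * X' mod T') < (u + 1) * T'}
           \<le> (m + 1) * card (window r T T')" if r: "r \<in> Q" for r u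
    proof -
      have r2: "r \<ge> 2" using Q r by blast
      have le: "ceillog r T \<le> ceillog r T'"
      proof -
        have "T * 1 \<le> T * b ^ n" using b by (intro mult_le_mono2) simp
        then have "T * r ^ 0 \<le> T'" unfolding power_0 using TT' by (rule order_trans)
        then show ?thesis using ceillog_add_le[OF r2 T, of 0 T'] by simp
      qed
      have w: "window r T T' = {ceillog r T..<ceillog r T + N r}"
        using le by (simp add: window_eq[OF r2] N_def)
      have cw: "card (window r T T') = N r" by (simp add: w)
      define z where "z = (\<lambda>j. real r ^ j * (real X' / real T'))"
      have fz: "frac (z j) = real (r ^ j * X' mod T') / real T'" for j
        using frac_of_nat_divide[OF T'0, of "r ^ j * X'"] by (simp add: z_def)
      have "u * T' \<le> m * a \<longleftrightarrow> real u / real m \<le> real a / real T'" for a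
      proof -
        have "u * T' \<le> m * a \<longleftrightarrow> real (u * T') \<le> real (m * a)" by (simp only: of_nat_le_iff)
        then show ?thesis using T'0 m by (simp add: field_simps)
      qed
      moreover have "m * a < (u + 1) * T' \<longleftrightarrow> real a / real T' < real (u + 1) / real m" for a
      proof -
        have "m * a < (u + 1) * T' \<longleftrightarrow> real (m * a) < real ((u + 1) * T')" by (simp only: of_nat_less_iff)
        then show ?thesis using T'0 m by (simp add: field_simps)
      qed
      ultimately have "{j\<in>window r T T'. u * T' \<le> m * (r ^ j * X' mod T') \<and> m * (r ^ j * X' mod T') < (u + 1) * T'}
        = {j\<in>window r T T'. real u / real m \<le> frac (z j) \<and> frac (z j) < real (u + 1) / real m}"
        unfolding fz by blast
      moreover have "m\<^sup>2 * card {j\<in>window r T T'. real u / real m \<le> frac (z j) \<and> frac (z j) < real (u + 1) / real m}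
        \<le> (m + 1) * card (window r T T')"
      proof (rule cell)
        show "finite (window r T T')" by (simp add: w)
        show "\<forall>h\<in>{1..H}. norm (\<Sum>j\<in>window r T T'. cis (2 * pi * real h * z j)) \<le> e * real (card (window r T T'))"
        proof
          fix h assume h: "h \<in> {1..H}"
          have "(\<Sum>j\<in>window r T T'. cis (2 * pi * real h * z j)) = (\<Sum>j<N r. cis (2 * pi * real h * z (ceillog r T + j)))"
            unfolding w using sum.shift_bounds_nat_ivl[of "\<lambda>j. cis (2 * pi * real h * z j)" 0 "ceillog r T" "N r"]
            by (simp add: add.commute atLeast0LessThan)
          then show "norm (\<Sum>j\<in>window r T T'. cis (2 * pi * real h * z j)) \<le> e * real (card (window r T T'))"
            using small[OF r h] unfolding sp cw by (simp add: z_def mult_ac)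
        qed
      qed
      ultimately show ?thesis by simp
    qed
    have c0: "T * D \<le> T'" using nD TT' by (meson mult_le_mono2 order_trans)
    have cB: "T' \<le> b ^ (n + 1) * T" 
    proof -
      have "T' = b ^ K * b ^ n" "b ^ (n + 1) * T = b * T * b ^ n" by (simp_all add: T'_def power_add)
      then show ?thesis using mult_le_mono1[OF KT, of "b ^ n"] by simp
    qed
    show "\<exists>T' X'. T * D \<le> T' \<and> T' \<le> b ^ (n + 1) * T \<and> X * T' \<le> X' * T \<and> X' * T \<le> X * T' + 2 * T'
     \<and> (\<forall>k. T \<le> b ^ k \<and> b ^ k < T' \<longrightarrow> (b ^ k * X' mod T') * b < 2 * T')
     \<and> (\<forall>r\<in>Q. \<forall>u<m. m\<^sup>2 * card {j\<in>window r T T'. u * T' \<le> m * (r ^ j * X' mod T') \<and> m * (r ^ j * X' mod T') < (u + 1) * T'}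
           \<le> (m + 1) * card (window r T T'))"
      using c0 cB c1 c2 c3 c4 by blast
  qed
qed

section \<open>Closure properties of computability relative to an oracle\<close>

text \<open>
  Arguments are read from an infinite environment, and the program has to accept every sufficiently
  long initial segment of it. This makes weakening and substitution free of arity bookkeeping.
\<close>

definition rcomp :: "nat set \<Rightarrow> ((nat \<Rightarrow> nat) \<Rightarrow> nat) \<Rightarrow> bool" where
  "rcomp R f \<longleftrightarrow> (\<exists>p k. \<forall>e n. k \<le> n \<longrightarrow> eval R p (map e [0..<n]) (f e))"

lemma rcomp_var: "rcomp R (\<lambda>e. e i)"
proof -
  have "eval R (Proj i) (map e [0..<n]) (e i)" if "Suc i \<le> n" for e n
    using eval_Proj[of i "map e [0..<n]" R] that by simp
  then show ?thesis unfolding rcomp_def by blast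
qed

lemma rcomp_zero: "rcomp R (\<lambda>e. 0)"
  unfolding rcomp_def using eval_Zero by blast

lemma rcomp_Suc:
  assumes "rcomp R f"
  shows "rcomp R (\<lambda>e. Suc (f e))"
proof -
  obtain p k where p: "\<And>e n. k \<le> n \<Longrightarrow> eval R p (map e [0..<n]) (f e)"
    using assms unfolding rcomp_def by blast
  have "eval R (Comp Succ [p]) (map e [0..<n]) (Suc (f e))" if "k \<le> n" for e n
    by (rule eval_Comp[where ys = "[f e]"]) (use p[OF that] eval_Succ in auto)
  then show ?thesis unfolding rcomp_def by blast
qed

lemma rcomp_const: "rcomp R (\<lambda>e. c)"
  by (induction c) (auto intro: rcomp_zero rcomp_Suc)

lemma rcomp_oracle:
  assumes "rcomp R f"
  shows "rcomp R (\<lambda>e. if f e \<in> R then 1 else 0)"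
proof -
  obtain p k where p: "\<And>e n. k \<le> n \<Longrightarrow> eval R p (map e [0..<n]) (f e)"
    using assms unfolding rcomp_def by blast
  have "eval R (Comp Oracle [p]) (map e [0..<n]) (if f e \<in> R then 1 else 0)" if "k \<le> n" for e n
    by (rule eval_Comp[where ys = "[f e]"]) (use p[OF that] eval_Oracle in auto)
  then show ?thesis unfolding rcomp_def by blast
qed

text \<open>Infinitely many variables are substituted, but a program that accepts length
  \<open>k\<close> needs only the first \<open>k\<close> of them, so a finite composition
  suffices.\<close>

lemma rcomp_subst:
  assumes "rcomp R f" "\<And>i. rcomp R (s i)"
  shows "rcomp R (\<lambda>e. f (\<lambda>i. s i e))"
proof -
  obtain p k where p: "\<And>e n. k \<le> n \<Longrightarrow> eval R p (map e [0..<n]) (f e)"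
    using assms(1) unfolding rcomp_def by blast
  obtain q l where q: "\<And>i e n. l i \<le> n \<Longrightarrow> eval R (q i) (map e [0..<n]) (s i e)"
    using assms(2) unfolding rcomp_def by metis
  have "eval R (Comp p (map q [0..<k])) (map e [0..<n]) (f (\<lambda>i. s i e))" if n: "(\<Sum>i<k. l i) \<le> n" for e n
  proof (rule eval_Comp)
    have "l i \<le> n" if "i < k" for i
      using member_le_sum[of i "{..<k}" l] that n by auto
    then show "list_all2 (\<lambda>g y. eval R g (map e [0..<n]) y) (map q [0..<k]) (map (\<lambda>i. s i e) [0..<k])"
      using q by (auto simp: list_all2_conv_all_nth)
    show "eval R p (map (\<lambda>i. s i e) [0..<k]) (f (\<lambda>i. s i e))" by (rule p) simp
  qed
  then show ?thesis unfolding rcomp_def by blast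
qed

lemma rcomp_comp1: "rcomp R (\<lambda>e. F (e 0)) \<Longrightarrow> rcomp R f \<Longrightarrow> rcomp R (\<lambda>e. F (f e))"
  using rcomp_subst[of R "\<lambda>e. F (e 0)" "\<lambda>i. f"] by simp

lemma rcomp_comp2:
  assumes "rcomp R (\<lambda>e. F (e 0) (e (Suc 0)))" "rcomp R f" "rcomp R g"
  shows "rcomp R (\<lambda>e. F (f e) (g e))"
proof -
  have "rcomp R (\<lambda>e. (\<lambda>e. F (e 0) (e (Suc 0))) (\<lambda>i. (if i = 0 then f else g) e))"
    by (rule rcomp_subst[OF assms(1)]) (use assms in auto)
  then show ?thesis by simp
qed

text \<open>Binding follows de Bruijn indices: the counter is variable 0, the accumulator variable
  1, and the outer environment starts at 2. The outer environment is cut to \<open>K\<close>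
  entries, because a program lists its projections explicitly.\<close>

lemma rcomp_rec:
  assumes N: "rcomp R N" and f: "rcomp R f"
    and g: "rcomp R (\<lambda>e. g (e 0) (e (Suc 0)) (\<lambda>i. e (Suc (Suc i))))"
  shows "rcomp R (\<lambda>e. rec_nat (f e) (\<lambda>i y. g i y e) (N e))"
proof -
  obtain pN kN where pN: "\<And>e n. kN \<le> n \<Longrightarrow> eval R pN (map e [0..<n]) (N e)"
    using N unfolding rcomp_def by blast
  obtain pf kf where pf: "\<And>e n. kf \<le> n \<Longrightarrow> eval R pf (map e [0..<n]) (f e)"
    using f unfolding rcomp_def by blast
  obtain pg kg where pg: "\<And>e n. kg \<le> n \<Longrightarrow> eval R pg (map e [0..<n]) (g (e 0) (e (Suc 0)) (\<lambda>i. e (Suc (Suc i))))"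
    using g unfolding rcomp_def by blast
  define K where "K = max kf kg"
  have "eval R (Comp (PrimRec pf pg) (pN # map Proj [0..<K])) (map e [0..<n]) (rec_nat (f e) (\<lambda>i y. g i y e) (N e))"
    if n: "max kN K \<le> n" for e n
  proof (rule eval_Comp)
    have "eval R (Proj i) (map e [0..<n]) (e i)" if "i < K" for i
      using eval_Proj[of i "map e [0..<n]" R] that n by simp
    then have "list_all2 (\<lambda>g y. eval R g (map e [0..<n]) y) (map Proj [0..<K]) (map e [0..<K])"
      by (simp add: list_all2_conv_all_nth)
    then show "list_all2 (\<lambda>g y. eval R g (map e [0..<n]) y) (pN # map Proj [0..<K]) (N e # map e [0..<K])"
      using pN[of n e] n by simp
    show "eval R (PrimRec pf pg) (N e # map e [0..<K]) (rec_nat (f e) (\<lambda>i y. g i y e) (N e))"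
    proof -
      have "eval R (PrimRec pf pg) (m # map e [0..<K]) (rec_nat (f e) (\<lambda>i y. g i y e) m)" for m
      proof (induction m)
        case 0
        then show ?case using eval_PrimRec_0[OF pf[of K e]] by (simp add: K_def)
      next
        case (Suc m)
        let ?y = "rec_nat (f e) (\<lambda>i y. g i y e) m"
        define e' where "e' = (\<lambda>i. case i of 0 \<Rightarrow> m | Suc j \<Rightarrow> (case j of 0 \<Rightarrow> ?y | Suc l \<Rightarrow> e l))"
        have "map e' [0..<Suc (Suc K)] = m # ?y # map e [0..<K]"
        proof -
          have u: "[0..<Suc j] = 0 # map Suc [0..<j]" for j
            by (simp add: map_Suc_upt upt_conv_Cons del: upt_Suc)
          show ?thesis unfolding u by (simp add: e'_def o_def)
        qed
        then have "eval R pg (m # ?y # map e [0..<K]) (g m ?y e)"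
          using pg[of "Suc (Suc K)" e'] by (simp add: e'_def K_def)
        then show ?case using eval_PrimRec_Suc[OF Suc] by simp
      qed
      then show ?thesis .
    qed
  qed
  then show ?thesis unfolding rcomp_def by blast
qed

lemma rcomp_add:
  assumes "rcomp R f" "rcomp R g"
  shows "rcomp R (\<lambda>e. f e + g e)"
proof -
  have "rec_nat a (\<lambda>i y. Suc y) b = a + b" for a b :: nat by (induction b) auto
  moreover have "rcomp R (\<lambda>e. rec_nat (f e) (\<lambda>i y. Suc y) (g e))"
    by (intro rcomp_rec assms rcomp_Suc rcomp_var)
  ultimately show ?thesis by simp
qed

lemma rcomp_mult:
  assumes "rcomp R f" "rcomp R g"
  shows "rcomp R (\<lambda>e. f e * g e)"
proof (rule rcomp_comp2[OF _ assms])
  have "rec_nat 0 (\<lambda>i y. y + a) b = a * b" for a b :: nat by (induction b) auto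
  moreover have "rcomp R (\<lambda>e. rec_nat 0 (\<lambda>i y. y + e 0) (e (Suc 0)))"
    by (intro rcomp_rec rcomp_zero rcomp_add rcomp_var)
  ultimately show "rcomp R (\<lambda>e. e 0 * e (Suc 0))" by simp
qed

lemma rcomp_power:
  assumes "rcomp R f" "rcomp R g"
  shows "rcomp R (\<lambda>e. f e ^ g e)"
proof (rule rcomp_comp2[OF _ assms])
  have "rec_nat 1 (\<lambda>i y. y * a) b = a ^ b" for a b :: nat by (induction b) auto
  moreover have "rcomp R (\<lambda>e. rec_nat 1 (\<lambda>i y. y * e 0) (e (Suc 0)))"
    by (intro rcomp_rec rcomp_const rcomp_mult rcomp_var)
  ultimately show "rcomp R (\<lambda>e. e 0 ^ e (Suc 0))" by simp
qed

lemma rcomp_diff: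
  assumes "rcomp R f" "rcomp R g"
  shows "rcomp R (\<lambda>e. f e - g e)"
proof (rule rcomp_comp2[OF _ assms])
  have "rec_nat 0 (\<lambda>i y. i) b = b - 1" for b :: nat by (cases b) auto
  moreover have "rcomp R (\<lambda>e. rec_nat 0 (\<lambda>i y. i) (e 0))"
    by (intro rcomp_rec rcomp_zero rcomp_var)
  ultimately have pred: "rcomp R (\<lambda>e. e 0 - 1)" by simp
  have "rec_nat a (\<lambda>i y. y - 1) b = a - b" for a b :: nat by (induction b) auto
  moreover have "rcomp R (\<lambda>e. rec_nat (e 0) (\<lambda>i y. y - 1) (e (Suc 0)))"
    by (intro rcomp_rec rcomp_var rcomp_comp1[OF pred])
  ultimately show "rcomp R (\<lambda>e. e 0 - e (Suc 0))" by simp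
qed

lemma rcomp_fact:
  assumes "rcomp R f"
  shows "rcomp R (\<lambda>e. fact (f e))"
proof (rule rcomp_comp1[OF _ assms])
  have "rec_nat 1 (\<lambda>i y. y * Suc i) b = fact b" for b :: nat by (induction b) auto
  moreover have "rcomp R (\<lambda>e. rec_nat 1 (\<lambda>i y. y * Suc i) (e 0))"
    by (intro rcomp_rec rcomp_const rcomp_mult rcomp_Suc rcomp_var)
  ultimately show "rcomp R (\<lambda>e. fact (e 0))" by simp
qed

text \<open>Weakening past the accumulator: the body of a bounded sum sees the counter and the outer
  variables, while \<open>rcomp_rec\<close> also binds the running total.\<close>

lemma rcomp_skip: "rcomp R (\<lambda>e. case i of 0 \<Rightarrow> e 0 | Suc j \<Rightarrow> e (Suc (Suc j)))"
  by (cases i) (simp_all add: rcomp_var)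

lemma rcomp_sum:
  assumes B: "rcomp R B" and f: "rcomp R (\<lambda>e. f (e 0) (\<lambda>i. e (Suc i)))"
  shows "rcomp R (\<lambda>e. \<Sum>j<B e. f j e)"
proof -
  have "rcomp R (\<lambda>e. (\<lambda>e. f (e 0) (\<lambda>i. e (Suc i))) (\<lambda>i. (\<lambda>e. case i of 0 \<Rightarrow> e 0 | Suc j \<Rightarrow> e (Suc (Suc j))) e))"
    by (rule rcomp_subst[OF f]) (rule rcomp_skip)
  then have f': "rcomp R (\<lambda>e. f (e 0) (\<lambda>i. e (Suc (Suc i))))" by simp
  have "rcomp R (\<lambda>e. rec_nat 0 (\<lambda>i y. y + f i e) (B e))"
    by (intro rcomp_rec B rcomp_zero rcomp_add f') (rule rcomp_var)
  moreover have "rec_nat 0 (\<lambda>i y. y + f i e) n = (\<Sum>j<n. f j e)" for e n by (induction n) auto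
  ultimately show ?thesis by simp
qed

section \<open>Decidable predicates and bounded search\<close>

definition rdec :: "nat set \<Rightarrow> ((nat \<Rightarrow> nat) \<Rightarrow> bool) \<Rightarrow> bool" where
  "rdec R P \<longleftrightarrow> rcomp R (\<lambda>e. if P e then 1 else 0)"

lemma rdec_oracle: "rcomp R f \<Longrightarrow> rdec R (\<lambda>e. f e \<in> R)"
  unfolding rdec_def by (rule rcomp_oracle)

lemma rdec_less:
  assumes "rcomp R f" "rcomp R g"
  shows "rdec R (\<lambda>e. f e < g e)"
proof -
  have "(if a < b then 1 else 0) = 1 - (1 - (b - a))" for a b :: nat by auto
  then show ?thesis unfolding rdec_def
    by (simp only:) (intro rcomp_diff rcomp_const assms)
qed

lemma rdec_not:
  assumes "rdec R P"
  shows "rdec R (\<lambda>e. \<not> P e)"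
proof -
  have "(if \<not> P e then 1 else 0 :: nat) = 1 - (if P e then 1 else 0)" for e by simp
  then show ?thesis unfolding rdec_def
    by (simp only:) (intro rcomp_diff rcomp_const assms[unfolded rdec_def])
qed

lemma rdec_conj:
  assumes "rdec R P" "rdec R Q"
  shows "rdec R (\<lambda>e. P e \<and> Q e)"
proof -
  have "(if P e \<and> Q e then 1 else 0 :: nat) = (if P e then 1 else 0) * (if Q e then 1 else 0)" for e by simp
  then show ?thesis unfolding rdec_def
    by (simp only:) (intro rcomp_mult assms[unfolded rdec_def])
qed

lemma rdec_disj:
  assumes "rdec R P" "rdec R Q"
  shows "rdec R (\<lambda>e. P e \<or> Q e)"
proof -
  have "rdec R (\<lambda>e. \<not> (\<not> P e \<and> \<not> Q e))" by (intro rdec_not rdec_conj assms)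
  then show ?thesis by simp
qed

lemma rdec_imp:
  assumes "rdec R P" "rdec R Q"
  shows "rdec R (\<lambda>e. P e \<longrightarrow> Q e)"
  unfolding imp_conv_disj by (intro rdec_disj rdec_not assms)

lemma rdec_le:
  assumes "rcomp R f" "rcomp R g"
  shows "rdec R (\<lambda>e. f e \<le> g e)"
  unfolding not_less[symmetric] by (intro rdec_not rdec_less assms)

lemma rdec_eq:
  assumes "rcomp R f" "rcomp R g"
  shows "rdec R (\<lambda>e. f e = g e)"
  unfolding eq_iff by (intro rdec_conj rdec_le assms)

lemma rcomp_if:
  assumes "rdec R P" "rcomp R f" "rcomp R g"
  shows "rcomp R (\<lambda>e. if P e then f e else g e)"
proof -
  have "(if P e then f e else g e) = (if P e then 1 else 0) * f e + (1 - (if P e then 1 else 0)) * g e" for e by simp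
  moreover have "rcomp R (\<lambda>e. (if P e then 1 else 0) * f e + (1 - (if P e then 1 else 0)) * g e)"
    by (intro rcomp_add rcomp_mult rcomp_diff rcomp_const assms assms(1)[unfolded rdec_def])
  ultimately show ?thesis by simp
qed

lemma rcomp_card:
  assumes "rcomp R B" "rdec R (\<lambda>e. P (e 0) (\<lambda>i. e (Suc i)))"
  shows "rcomp R (\<lambda>e. card {j. j < B e \<and> P j e})"
proof -
  have "card {j. j < n \<and> P j e} = (\<Sum>j<n. if P j e then 1 else 0)" for n e
    by (simp add: sum.If_cases lessThan_def Collect_conj_eq)
  then show ?thesis
    using rcomp_sum[OF assms(1), of "\<lambda>j e. if P j e then 1 else 0"] assms(2) unfolding rdec_def by simp
qed

lemma rdec_bex:
  assumes "rcomp R B" "rdec R (\<lambda>e. P (e 0) (\<lambda>i. e (Suc i)))"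
  shows "rdec R (\<lambda>e. \<exists>j<B e. P j e)"
proof -
  have "(\<exists>j<n. P j e) \<longleftrightarrow> 0 < card {j. j < n \<and> P j e}" for n e
    by (auto simp: card_gt_0_iff)
  moreover have "rdec R (\<lambda>e. 0 < card {j. j < B e \<and> P j e})"
    by (intro rdec_less rcomp_zero rcomp_card assms)
  ultimately show ?thesis by (simp only:)
qed

lemma rdec_ball:
  assumes "rcomp R B" "rdec R (\<lambda>e. P (e 0) (\<lambda>i. e (Suc i)))"
  shows "rdec R (\<lambda>e. \<forall>j<B e. P j e)"
proof -
  have "rdec R (\<lambda>e. \<not> (\<exists>j<B e. \<not> P j e))"
    by (intro rdec_not rdec_bex assms)
  then show ?thesis by simp
qed

text \<open>The least \<open>j < B\<close> with \<open>P j\<close>, and \<open>B\<close> if there is none.\<close>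

definition first_below :: "nat \<Rightarrow> (nat \<Rightarrow> bool) \<Rightarrow> nat" where
  "first_below B P = card {i. i < B \<and> (\<forall>j<Suc i. \<not> P j)}"

lemma first_below:
  assumes "\<exists>j<B. P j"
  shows "P (first_below B P)" "first_below B P < B"
proof -
  have ex: "\<exists>j. P j" using assms by blast
  define l where "l = (LEAST j. P j)"
  have l: "P l" unfolding l_def using ex by (rule LeastI_ex)
  have min: "\<not> P j" if "j < l" for j using that unfolding l_def by (rule not_less_Least)
  have lB: "l < B" using assms Least_le[of P] unfolding l_def by (meson le_less_trans)
  have "{i. i < B \<and> (\<forall>j<Suc i. \<not> P j)} = {..<l}"
  proof (intro set_eqI iffI)
    fix i assume "i \<in> {i. i < B \<and> (\<forall>j<Suc i. \<not> P j)}"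
    then have "\<not> l < Suc i" using l by auto
    then show "i \<in> {..<l}" by simp
  next
    fix i assume "i \<in> {..<l}"
    then show "i \<in> {i. i < B \<and> (\<forall>j<Suc i. \<not> P j)}" using min lB by (auto simp: less_Suc_eq_le)
  qed
  then have "first_below B P = l" by (simp add: first_below_def)
  then show "P (first_below B P)" "first_below B P < B" using l lB by auto
qed

text \<open>Counting the failures before the first success reduces the search to
  \<open>rcomp_card\<close>, hence to primitive recursion: no \<open>Mu\<close> occurs and totality
  is automatic.\<close>

lemma rcomp_first_below:
  assumes "rcomp R B" "rdec R (\<lambda>e. P (e 0) (\<lambda>i. e (Suc i)))"
  shows "rcomp R (\<lambda>e. first_below (B e) (\<lambda>j. P j e))"
  unfolding first_below_def
proof (rule rcomp_card[OF assms(1)], rule rdec_ball)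
  show "rcomp R (\<lambda>e. Suc (e 0))" by (intro rcomp_Suc rcomp_var)
  have "rdec R (\<lambda>e. P (e 0) (\<lambda>i. e (Suc (Suc i))))"
  proof -
    have "rcomp R (\<lambda>e. (\<lambda>e. if P (e 0) (\<lambda>i. e (Suc i)) then 1 else 0) (\<lambda>i. (\<lambda>e. case i of 0 \<Rightarrow> e 0 | Suc j \<Rightarrow> e (Suc (Suc j))) e))"
      by (rule rcomp_subst[OF assms(2)[unfolded rdec_def]]) (rule rcomp_skip)
    then show ?thesis by (simp add: rdec_def)
  qed
  then show "rdec R (\<lambda>e. \<not> P (e 0) (\<lambda>i. e (Suc (Suc i))))" by (rule rdec_not)
qed

lemma rcomp_mod:
  assumes "rcomp R f" "rcomp R g"
  shows "rcomp R (\<lambda>e. f e mod g e)"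
proof (rule rcomp_comp2[OF _ assms])
  \<comment> \<open>The cardinality is the quotient. For \<open>b = 0\<close> the product vanishes,
    in agreement with \<open>a mod 0 = a\<close>.\<close>
  have "a mod b = a - b * card {q. q < a \<and> Suc q * b \<le> a}" for a b :: nat
  proof (cases "b = 0")
    case False
    have "{q. q < a \<and> Suc q * b \<le> a} = {..<a div b}"
    proof (intro set_eqI iffI)
      fix q assume "q \<in> {..<a div b}"
      then have "Suc q \<le> a div b" by simp
      then have *: "Suc q * b \<le> a" using False by (simp add: less_eq_div_iff_mult_less_eq)
      have "Suc q * 1 \<le> Suc q * b" using False by (intro mult_le_mono2) simp
      then show "q \<in> {q. q < a \<and> Suc q * b \<le> a}" using * by auto
    next
      fix q assume "q \<in> {q. q < a \<and> Suc q * b \<le> a}"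
      then have "Suc q \<le> a div b" using False by (simp add: less_eq_div_iff_mult_less_eq)
      then show "q \<in> {..<a div b}" by simp
    qed
    then show ?thesis by (simp add: minus_mult_div_eq_mod)
  qed simp
  moreover have "rcomp R (\<lambda>e. e 0 - e (Suc 0) * card {q. q < e 0 \<and> Suc q * e (Suc 0) \<le> e 0})"
    by (intro rcomp_diff rcomp_mult rcomp_card rdec_le rcomp_Suc rcomp_var)
  ultimately show "rcomp R (\<lambda>e. e 0 mod e (Suc 0))" by (simp only:)
qed

lemma rcomp_prod_encode:
  assumes "rcomp R f" "rcomp R g"
  shows "rcomp R (\<lambda>e. prod_encode (f e, g e))"
proof (rule rcomp_comp2[OF _ assms, of "\<lambda>a b. prod_encode (a, b)"])
  have "triangle n = (\<Sum>i<Suc n. i)" for n by (induction n) auto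
  then have "prod_encode (a, b) = (\<Sum>i<Suc (a + b). i) + a" for a b by (simp add: prod_encode_def)
  moreover have "rcomp R (\<lambda>e. (\<Sum>i<Suc (e 0 + e (Suc 0)). i) + e 0)"
    by (intro rcomp_add rcomp_sum rcomp_Suc rcomp_var)
  ultimately show "rcomp R (\<lambda>e. prod_encode (e 0, e (Suc 0)))" by (simp only:)
qed

lemma rcomp_fst_prod_decode:
  assumes "rcomp R f"
  shows "rcomp R (\<lambda>e. fst (prod_decode (f e)))"
proof (rule rcomp_comp1[OF _ assms, of "\<lambda>c. fst (prod_decode c)"])
  have "fst (prod_decode c) = first_below (Suc c) (\<lambda>a. \<exists>b<Suc c. prod_encode (a, b) = c)" for c
  proof -
    obtain a b where ab: "prod_decode c = (a, b)" by fastforce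
    then have c: "prod_encode (a, b) = c" by (metis prod_decode_inverse)
    have "\<exists>a<Suc c. \<exists>b<Suc c. prod_encode (a, b) = c"
      using c le_prod_encode_1[of a b] le_prod_encode_2[of b a] by (auto simp: less_Suc_eq_le)
    from first_below(1)[OF this] obtain b'
      where "prod_encode (first_below (Suc c) (\<lambda>a. \<exists>b<Suc c. prod_encode (a, b) = c), b') = c" by blast
    from arg_cong[OF this, of "\<lambda>c. fst (prod_decode c)"] show ?thesis by simp
  qed
  moreover have "rcomp R (\<lambda>e. first_below (Suc (e 0)) (\<lambda>a. \<exists>b<Suc (e 0). prod_encode (a, b) = e 0))"
    by (intro rcomp_first_below rdec_bex rdec_eq rcomp_prod_encode rcomp_Suc rcomp_var)
  ultimately show "rcomp R (\<lambda>e. fst (prod_decode (e 0)))" by (simp only:)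
qed

lemma rcomp_snd_prod_decode:
  assumes "rcomp R f"
  shows "rcomp R (\<lambda>e. snd (prod_decode (f e)))"
proof (rule rcomp_comp1[OF _ assms, of "\<lambda>c. snd (prod_decode c)"])
  have "snd (prod_decode c) = first_below (Suc c) (\<lambda>b. prod_encode (fst (prod_decode c), b) = c)" for c
  proof -
    obtain a b where ab: "prod_decode c = (a, b)" by fastforce
    then have c: "prod_encode (a, b) = c" by (metis prod_decode_inverse)
    have "\<exists>b<Suc c. prod_encode (fst (prod_decode c), b) = c"
      using c ab le_prod_encode_2[of b a] by (auto simp: less_Suc_eq_le)
    from arg_cong[OF first_below(1)[OF this], of "\<lambda>c. snd (prod_decode c)"] show ?thesis by simp
  qed
  moreover have "rcomp R (\<lambda>e. first_below (Suc (e 0)) (\<lambda>b. prod_encode (fst (prod_decode (e 0)), b) = e 0))"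
    by (intro rcomp_first_below rdec_eq rcomp_prod_encode rcomp_fst_prod_decode rcomp_Suc rcomp_var)
  ultimately show "rcomp R (\<lambda>e. snd (prod_decode (e 0)))" by (simp only:)
qed

lemma rcomp_imp_computable_in:
  assumes "rcomp R (\<lambda>e. f (e 0))"
  shows "computable_in R f"
proof -
  obtain p k where p: "\<And>e n. k \<le> n \<Longrightarrow> eval R p (map e [0..<n]) (f (e 0))"
    using assms unfolding rcomp_def by blast
  have "eval R (Comp p (replicate k (Proj 0))) [n] (f n)" for n
  proof (rule eval_Comp)
    show "list_all2 (\<lambda>g y. eval R g [n] y) (replicate k (Proj 0)) (replicate k n)"
      using eval_Proj[of 0 "[n]" R] by (simp add: list_all2_conv_all_nth)
    have "map (\<lambda>_. n) [0..<k] = replicate k n" by (simp add: map_replicate_const)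
    then show "eval R p (replicate k n) (f n)" using p[of k "\<lambda>_. n"] by simp
  qed
  then show ?thesis unfolding computable_in_def by blast
qed

lemmas rcomp_intros = rcomp_var rcomp_const rcomp_Suc rcomp_add rcomp_mult rcomp_power rcomp_diff rcomp_fact
  rcomp_if rcomp_card rcomp_first_below rcomp_mod rcomp_prod_encode rcomp_fst_prod_decode rcomp_snd_prod_decode
  rdec_oracle rdec_less rdec_le rdec_eq rdec_not rdec_conj rdec_disj rdec_imp rdec_bex rdec_ball

section \<open>The construction\<close>

text \<open>
  Every base outside \<open>R\<close> is the level base of infinitely many levels; the other levels use a number
  coprime to all bases up to \<open>m\<close>.
\<close>

definition level_base :: "nat set \<Rightarrow> nat \<Rightarrow> nat" where
  "level_base R m = (if 2 \<le> fst (prod_decode m) \<and> fst (prod_decode m) \<notin> R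
     then fst (prod_decode m) else fact m + 1)"

text \<open>The exponent 8 serves the tightest case \<open>s = 2\<close>, where the frequency of 0
  must stay clearly above 1/2. A digit 0 or 1 in base \<open>s ^ 8\<close> is seven zeros in base
  \<open>s\<close> and one free digit; the influence of the tail costs one more zero, which leaves
  six out of eight.\<close>

definition block_base :: "nat set \<Rightarrow> nat \<Rightarrow> nat" where
  "block_base R m = level_base R m ^ 8"

text \<open>
  The step from \<open>X / T\<close> to \<open>X' / T'\<close>: the first two conditions make it short relative to \<open>log T\<close> but long
  relative to \<open>m\<close>; the last two say that the new block has only small digits in the block base and
  that no cell of length \<open>1 / m\<close> is overpopulated by an orbit. Upper bounds for the cells suffice,
  because the lower bounds follow by complementation.
\<close>

definition good_step :: "nat set \<Rightarrow> nat \<Rightarrow> nat \<Rightarrow> nat \<Rightarrow> nat \<Rightarrow> nat \<Rightarrow> bool" where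
  "good_step R m T X T' X' \<longleftrightarrow>
     T' ^ m \<le> T ^ Suc m \<and> T * (block_base R m * Suc m) ^ (m * m) \<le> T' \<and>
     X * T' \<le> X' * T \<and> X' * T \<le> X * T' + 2 * T' \<and>
     (\<forall>k<T'. T \<le> block_base R m ^ k \<and> block_base R m ^ k < T' \<longrightarrow>
        (block_base R m ^ k * X' mod T') * block_base R m < 2 * T') \<and>
     (\<forall>r<Suc m. r \<in> R \<longrightarrow> (\<forall>u<m.
        m * m * card {j. j < T' \<and> ((T \<le> r ^ j \<and> r ^ j < T') \<and> u * T' \<le> m * (r ^ j * X' mod T') \<and>
             m * (r ^ j * X' mod T') < Suc u * T')}
          \<le> Suc m * card {j. j < T' \<and> (T \<le> r ^ j \<and> r ^ j < T')}))"

text \<open>The bounds are those that \<open>good_step\<close> itself enforces for positive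
  \<open>m\<close> and \<open>T\<close>: \<open>T' \<le> T' ^ m \<le> T ^ Suc m\<close>, and the
  error condition limits \<open>X'\<close>.\<close>

definition feasible :: "nat set \<Rightarrow> nat \<Rightarrow> nat \<Rightarrow> nat \<Rightarrow> bool" where
  "feasible R m T X \<longleftrightarrow> (\<exists>T'<Suc (T ^ Suc m). \<exists>X'<Suc ((X + 2) * T'). good_step R m T X T' X')"

definition top_level :: "nat set \<Rightarrow> nat \<Rightarrow> nat \<Rightarrow> nat \<Rightarrow> nat" where
  "top_level R k T X = rec_nat 0 (\<lambda>i y. if feasible R (Suc i) T X then Suc i else y) k"

text \<open>Level 0 is the fallback when nothing is feasible: the value \<open>X / T\<close> stays
  while \<open>T\<close> doubles, so denominators keep growing until a block counts as
  short.\<close>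

definition next_den :: "nat set \<Rightarrow> nat \<Rightarrow> nat \<Rightarrow> nat \<Rightarrow> nat" where
  "next_den R m T X = (if m = 0 then 2 * T else
     first_below (Suc (T ^ Suc m)) (\<lambda>T'. \<exists>X'<Suc ((X + 2) * T'). good_step R m T X T' X'))"

definition next_num :: "nat set \<Rightarrow> nat \<Rightarrow> nat \<Rightarrow> nat \<Rightarrow> nat" where
  "next_num R m T X = (if m = 0 then 2 * X else
     first_below (Suc ((X + 2) * next_den R m T X)) (\<lambda>X'. good_step R m T X (next_den R m T X) X'))"

text \<open>
  A state consists of the highest allowed level \<open>k\<close>, the denominator \<open>Q\<close> at which the current uninterrupted
  run of steps of level \<open>k\<close> began, and the current approximation \<open>X / T\<close>.
\<close>

definition enc :: "nat \<Rightarrow> nat \<Rightarrow> nat \<Rightarrow> nat \<Rightarrow> nat" where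
  "enc k Q T X = prod_encode (prod_encode (k, Q), prod_encode (T, X))"

definition dec_level :: "nat \<Rightarrow> nat" where "dec_level s = fst (prod_decode (fst (prod_decode s)))"
definition dec_start :: "nat \<Rightarrow> nat" where "dec_start s = snd (prod_decode (fst (prod_decode s)))"
definition dec_den :: "nat \<Rightarrow> nat" where "dec_den s = fst (prod_decode (snd (prod_decode s)))"
definition dec_num :: "nat \<Rightarrow> nat" where "dec_num s = snd (prod_decode (snd (prod_decode s)))"

lemma dec_enc [simp]:
  "dec_level (enc k Q T X) = k" "dec_start (enc k Q T X) = Q"
  "dec_den (enc k Q T X) = T" "dec_num (enc k Q T X) = X"
  by (simp_all add: enc_def dec_level_def dec_start_def dec_den_def dec_num_def)

definition used_level :: "nat set \<Rightarrow> nat \<Rightarrow> nat" where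
  "used_level R s = top_level R (dec_level s) (dec_den s) (dec_num s)"

definition new_den :: "nat set \<Rightarrow> nat \<Rightarrow> nat" where
  "new_den R s = next_den R (used_level R s) (dec_den s) (dec_num s)"

definition new_num :: "nat set \<Rightarrow> nat \<Rightarrow> nat" where
  "new_num R s = next_num R (used_level R s) (dec_den s) (dec_num s)"

text \<open>The threshold \<open>Q ^ Suc k\<close> says that the current run has multiplied the
  logarithm of the denominator by \<open>k + 1\<close>, so that what preceded the run is a small
  share. A step below level \<open>k\<close> restarts the run.\<close>

definition advance :: "nat set \<Rightarrow> nat \<Rightarrow> nat" where
  "advance R s = (if used_level R s = dec_level s \<and> dec_start s ^ Suc (dec_level s) \<le> new_den R s
     then enc (Suc (dec_level s)) (new_den R s) (new_den R s) (new_num R s)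
     else enc (dec_level s) (if used_level R s = dec_level s then dec_start s else new_den R s)
       (new_den R s) (new_num R s))"

text \<open>With initial denominator 4 and doubling, \<open>den n \<ge> 2 ^ (n + 2)\<close>, which
  turns the error bound \<open>4 / den n\<close> into exactly the rate required of a computable
  real.\<close>

definition state :: "nat set \<Rightarrow> nat \<Rightarrow> nat" where
  "state R n = rec_nat (enc 0 4 4 0) (\<lambda>i s. advance R s) n"

section \<open>The construction is computable from the oracle\<close>

text \<open>Every bounded quantifier in an unfolded definition shifts the environment of its
  arguments. Variables remain variables under such shifts, so each definition is treated for
  variables first and arbitrary functions are substituted afterwards.\<close>

lemma rcomp_comp3:
  assumes "rcomp R (\<lambda>e. F (e 0) (e (Suc 0)) (e (Suc (Suc 0))))" "rcomp R f" "rcomp R g" "rcomp R h"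
  shows "rcomp R (\<lambda>e. F (f e) (g e) (h e))"
proof -
  have "rcomp R (\<lambda>e. (\<lambda>e. F (e 0) (e (Suc 0)) (e (Suc (Suc 0))))
      (\<lambda>i. (if i = 0 then f else if i = Suc 0 then g else h) e))"
    by (rule rcomp_subst[OF assms(1)]) (use assms in auto)
  then show ?thesis by simp
qed

lemma rcomp_comp5:
  assumes "rcomp R (\<lambda>e. F (e 0) (e (Suc 0)) (e (Suc (Suc 0))) (e (Suc (Suc (Suc 0)))) (e (Suc (Suc (Suc (Suc 0))))))"
    "rcomp R f" "rcomp R g" "rcomp R h" "rcomp R f'" "rcomp R g'"
  shows "rcomp R (\<lambda>e. F (f e) (g e) (h e) (f' e) (g' e))"
proof -
  have "rcomp R (\<lambda>e. (\<lambda>e. F (e 0) (e (Suc 0)) (e (Suc (Suc 0))) (e (Suc (Suc (Suc 0)))) (e (Suc (Suc (Suc (Suc 0))))))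
      (\<lambda>i. (if i = 0 then f else if i = Suc 0 then g else if i = Suc (Suc 0) then h else if i = Suc (Suc (Suc 0)) then f' else g') e))"
    by (rule rcomp_subst[OF assms(1)]) (use assms in auto)
  then show ?thesis by simp
qed

lemma rcomp_level_base:
  assumes "rcomp R f"
  shows "rcomp R (\<lambda>e. level_base R (f e))"
  unfolding level_base_def by (intro rcomp_intros assms)

lemma rcomp_block_base:
  assumes "rcomp R f"
  shows "rcomp R (\<lambda>e. block_base R (f e))"
  unfolding block_base_def by (intro rcomp_power rcomp_const rcomp_level_base assms)

lemma rdec_good_step:
  assumes "rcomp R m" "rcomp R T" "rcomp R X" "rcomp R T'" "rcomp R X'"
  shows "rdec R (\<lambda>e. good_step R (m e) (T e) (X e) (T' e) (X' e))"
proof -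
  have "rdec R (\<lambda>e. good_step R (e 0) (e (Suc 0)) (e (Suc (Suc 0))) (e (Suc (Suc (Suc 0)))) (e (Suc (Suc (Suc (Suc 0))))))"
    unfolding good_step_def by (intro rcomp_intros rcomp_block_base)
  then show ?thesis unfolding rdec_def
    by (rule rcomp_comp5[where F = "\<lambda>m T X T' X'. if good_step R m T X T' X' then 1 else 0", OF _ assms])
qed

lemma
  shows rdec_feasible_vars: "rdec R (\<lambda>e. feasible R (e 0) (e (Suc 0)) (e (Suc (Suc 0))))"
    and rcomp_next_den_vars: "rcomp R (\<lambda>e. next_den R (e 0) (e (Suc 0)) (e (Suc (Suc 0))))"
  unfolding feasible_def next_den_def by (intro rcomp_intros rdec_good_step)+

lemma rdec_feasible:
  assumes "rcomp R m" "rcomp R T" "rcomp R X"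
  shows "rdec R (\<lambda>e. feasible R (m e) (T e) (X e))"
  using rdec_feasible_vars unfolding rdec_def
  by (rule rcomp_comp3[where F = "\<lambda>m T X. if feasible R m T X then 1 else 0", OF _ assms])

lemma rcomp_next_den:
  assumes "rcomp R m" "rcomp R T" "rcomp R X"
  shows "rcomp R (\<lambda>e. next_den R (m e) (T e) (X e))"
  by (rule rcomp_comp3[OF rcomp_next_den_vars assms])

lemma rcomp_next_num:
  assumes "rcomp R m" "rcomp R T" "rcomp R X"
  shows "rcomp R (\<lambda>e. next_num R (m e) (T e) (X e))"
proof (rule rcomp_comp3[OF _ assms])
  show "rcomp R (\<lambda>e. next_num R (e 0) (e (Suc 0)) (e (Suc (Suc 0))))"
    unfolding next_num_def by (intro rcomp_intros rdec_good_step rcomp_next_den)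
qed

lemma rcomp_top_level:
  assumes "rcomp R m" "rcomp R T" "rcomp R X"
  shows "rcomp R (\<lambda>e. top_level R (m e) (T e) (X e))"
proof (rule rcomp_comp3[OF _ assms])
  show "rcomp R (\<lambda>e. top_level R (e 0) (e (Suc 0)) (e (Suc (Suc 0))))"
    unfolding top_level_def by (intro rcomp_rec rcomp_intros rdec_feasible)
qed

lemma rcomp_state: "rcomp R (\<lambda>e. state R (e 0))"
  unfolding state_def advance_def new_den_def new_num_def used_level_def dec_level_def dec_start_def dec_den_def dec_num_def enc_def
  by (intro rcomp_rec rcomp_intros rcomp_top_level rcomp_next_den rcomp_next_num)

lemma computable_in_state:
  "computable_in R (\<lambda>n. dec_num (state R n))" "computable_in R (\<lambda>n. dec_den (state R n) - 1)"
  unfolding dec_num_def dec_den_def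
  by (rule rcomp_imp_computable_in, intro rcomp_intros rcomp_state)+

section \<open>Correctness\<close>

locale dependence_closed =
  fixes R :: "nat set"
  assumes R_bases: "R \<subseteq> bases" and closed: "closed_mult_dependent R"
begin

abbreviation lvl :: "nat \<Rightarrow> nat" where "lvl n \<equiv> dec_level (state R n)"
abbreviation start :: "nat \<Rightarrow> nat" where "start n \<equiv> dec_start (state R n)"
abbreviation den :: "nat \<Rightarrow> nat" where "den n \<equiv> dec_den (state R n)"
abbreviation num :: "nat \<Rightarrow> nat" where "num n \<equiv> dec_num (state R n)"
abbreviation used :: "nat \<Rightarrow> nat" where "used n \<equiv> used_level R (state R n)"

lemma level_base_ge: "level_base R m \<ge> 2"
  by (simp add: level_base_def fact_ge_1)

lemma block_base_ge: "block_base R m \<ge> 2"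
proof -
  have "(2::nat) ^ 8 \<le> level_base R m ^ 8" using level_base_ge by (rule power_mono) simp
  then show ?thesis by (simp add: block_base_def)
qed

text \<open>If the level base is some \<open>s\<close> outside \<open>R\<close>, equality would make
  \<open>s\<close> a rational power of \<open>r\<close>, and closure would put \<open>s\<close> into
  \<open>R\<close>. Otherwise it is \<open>fact m + 1\<close>, which is coprime to every
  \<open>r \<le> m\<close>.\<close>

lemma level_base_power_neq:
  assumes r: "r \<in> R" "r \<le> m" and h: "h \<ge> 1" and p: "p \<ge> 1"
  shows "r ^ h \<noteq> level_base R m ^ p"
proof
  assume eq: "r ^ h = level_base R m ^ p"
  have r2: "r \<ge> 2" using r R_bases by (auto simp: bases_def)
  show False
  proof (cases "2 \<le> fst (prod_decode m) \<and> fst (prod_decode m) \<notin> R")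
    case True
    define s where "s = fst (prod_decode m)"
    have s: "level_base R m = s" "s \<ge> 2" "s \<notin> R" using True by (auto simp: level_base_def s_def)
    have "real r powr (real h / real p) = (real r powr real h) powr (1 / real p)"
      by (simp add: powr_powr)
    also have "real r powr real h = real s powr real p"
      using eq r2 s by (simp add: powr_realpow flip: of_nat_power)
    also have "(real s powr real p) powr (1 / real p) = real s"
      using p s by (simp add: powr_powr)
    finally have "real s = real r powr of_rat (of_nat h / of_nat p)" by (simp add: of_rat_divide)
    then have "mult_dependent r s" unfolding mult_dependent_def by blast
    then show False using closed r(1) s unfolding closed_mult_dependent_def bases_def by auto
  next
    case False
    then have s: "level_base R m = fact m + 1" by (auto simp: level_base_def)
    have "r dvd fact m" using r2 r(2) by (intro dvd_fact) auto
    moreover have "r dvd r ^ h" using h by (simp add: dvd_power)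
    then have "r dvd (fact m + 1) ^ p" using eq s by simp
    moreover have "coprime (fact m :: nat) ((fact m + 1) ^ p)"
      using coprime_Suc_right_nat[of "fact m"] by (simp add: coprime_power_right_iff)
    ultimately have "is_unit r" using coprime_common_divisor by blast
    then show False using r2 by simp
  qed
qed

lemma log_block_base_irrational:
  assumes r: "r \<in> R" "r \<le> m" and h: "h \<ge> (1::nat)"
  shows "real h * log (real (block_base R m)) (real r) \<notin> \<int>"
proof
  let ?b = "block_base R m"
  have r2: "r \<ge> 2" using r R_bases by (auto simp: bases_def)
  assume "real h * log ?b r \<in> \<int>"
  then obtain p :: int where p: "real h * log ?b r = of_int p" by (auto elim: Ints_cases)
  moreover have "real h * log ?b r > 0" using h r2 block_base_ge[of m] by simp
  ultimately have "p > 0" by simp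
  then obtain q :: nat where q: "p = int q" "q \<ge> 1"
    by (metis One_nat_def Suc_leI of_nat_0_less_iff zero_less_imp_eq_int)
  have "log ?b (real r ^ h) = real q" using p q r2 block_base_ge[of m] by (simp add: log_nat_power)
  then have "real r ^ h = real ?b powr real q"
    using r2 block_base_ge[of m] powr_log_cancel[of "real ?b" "real r ^ h"] by simp
  then have "real r ^ h = real ?b ^ q" using block_base_ge[of m] by (simp add: powr_realpow)
  then have "r ^ h = ?b ^ q" by (metis of_nat_eq_iff of_nat_power)
  then have "r ^ h = level_base R m ^ (8 * q)" by (simp add: block_base_def power_mult)
  then show False using level_base_power_neq[OF r h, of "8 * q"] q by simp
qed

text \<open>Since \<open>j < 2 ^ j \<le> r ^ j < T'\<close>, the search bound \<open>j < T'\<close>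
  that keeps \<open>good_step\<close> decidable excludes no position of the window.\<close>

lemma window_alt:
  assumes "r \<ge> 2"
  shows "{j. j < T' \<and> (T \<le> r ^ j \<and> r ^ j < T')} = window r T T'"
    "{j. j < T' \<and> ((T \<le> r ^ j \<and> r ^ j < T') \<and> P j)} = {j \<in> window r T T'. P j}"
proof -
  have "j < T'" if "r ^ j < T'" for j
  proof -
    have "j < 2 ^ j" by (rule less_exp)
    also have "(2::nat) ^ j \<le> r ^ j" using assms by (rule power_mono) simp
    finally show ?thesis using that by simp
  qed
  then show "{j. j < T' \<and> (T \<le> r ^ j \<and> r ^ j < T')} = window r T T'"
    "{j. j < T' \<and> ((T \<le> r ^ j \<and> r ^ j < T') \<and> P j)} = {j \<in> window r T T'. P j}"
    by (auto simp: window_def)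
qed

text \<open>\<open>B\<close> depends on \<open>m\<close> only, so once \<open>T\<close> exceeds
  \<open>B ^ m\<close> a block with \<open>T' \<le> B * T\<close> counts as short:
  \<open>(B * T) ^ m \<le> T ^ Suc m\<close>.\<close>

lemma feasible_eventually:
  assumes m: "m \<ge> 1"
  shows "\<exists>T0. \<forall>T\<ge>T0. \<forall>X. feasible R m T X"
proof -
  let ?b = "block_base R m"
  let ?Q = "{r \<in> R. r \<le> m}"
  have Q: "r \<ge> 2 \<and> (\<forall>h::nat. h \<ge> 1 \<longrightarrow> real h * log ?b r \<notin> \<int>)" if "r \<in> ?Q" for r
    using that R_bases log_block_base_irrational by (auto simp: bases_def)
  have "finite ?Q" by simp
  from exists_good_block[OF block_base_ge m this Q, of "(?b * Suc m) ^ (m * m)"]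
  obtain B where B: "\<forall>T X. T \<ge> 1 \<longrightarrow> (\<exists>T' X'. T * (?b * Suc m) ^ (m * m) \<le> T' \<and> T' \<le> B * T \<and> X * T' \<le> X' * T \<and> X' * T \<le> X * T' + 2 * T'
     \<and> (\<forall>k. T \<le> ?b ^ k \<and> ?b ^ k < T' \<longrightarrow> (?b ^ k * X' mod T') * ?b < 2 * T')
     \<and> (\<forall>r\<in>?Q. \<forall>u<m. m\<^sup>2 * card {j\<in>window r T T'. u * T' \<le> m * (r ^ j * X' mod T') \<and> m * (r ^ j * X' mod T') < (u + 1) * T'}
           \<le> (m + 1) * card (window r T T')))" by (rule exE)
  have "feasible R m T X" if T: "T \<ge> B ^ m + 1" for T X
  proof -
    have T1: "T \<ge> 1" "B ^ m \<le> T" using T by auto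
    obtain T' X' where g: "T * (?b * Suc m) ^ (m * m) \<le> T'" "T' \<le> B * T" "X * T' \<le> X' * T" "X' * T \<le> X * T' + 2 * T'"
     "\<forall>k. T \<le> ?b ^ k \<and> ?b ^ k < T' \<longrightarrow> (?b ^ k * X' mod T') * ?b < 2 * T'"
     "\<forall>r\<in>?Q. \<forall>u<m. m\<^sup>2 * card {j\<in>window r T T'. u * T' \<le> m * (r ^ j * X' mod T') \<and> m * (r ^ j * X' mod T') < (u + 1) * T'}
           \<le> (m + 1) * card (window r T T')"
      using B T1(1) by blast
    have Tm: "T' ^ m \<le> T ^ Suc m"
    proof -
      have "T' ^ m \<le> (B * T) ^ m" using g(2) by (rule power_mono) simp
      also have "\<dots> = B ^ m * T ^ m" by (rule power_mult_distrib)
      also have "\<dots> \<le> T * T ^ m" using T1(2) by (rule mult_le_mono1)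
      finally show ?thesis by simp
    qed
    have "good_step R m T X T' X'"
      unfolding good_step_def
    proof (intro conjI allI impI)
      fix r u assume "r < Suc m" "r \<in> R" "u < m"
      moreover have "r \<ge> 2" using R_bases \<open>r \<in> R\<close> by (auto simp: bases_def)
      ultimately show "m * m * card {j. j < T' \<and> ((T \<le> r ^ j \<and> r ^ j < T') \<and> u * T' \<le> m * (r ^ j * X' mod T') \<and>
             m * (r ^ j * X' mod T') < Suc u * T')} \<le> Suc m * card {j. j < T' \<and> (T \<le> r ^ j \<and> r ^ j < T')}"
        using g(6) unfolding window_alt[OF \<open>r \<ge> 2\<close>] by (simp add: power2_eq_square)
    qed (use g Tm in auto)
    moreover have "T' < Suc (T ^ Suc m)"
    proof -
      have "T' \<le> T' ^ m" using m by (cases "T' = 0") (auto intro: self_le_power)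
      then show ?thesis using Tm by simp
    qed
    moreover have "X' < Suc ((X + 2) * T')"
    proof -
      have "X' * 1 \<le> X' * T" using T1(1) by (rule mult_le_mono2)
      moreover have "(X + 2) * T' = X * T' + 2 * T'" by (simp add: algebra_simps)
      ultimately show ?thesis using g(4) by linarith
    qed
    ultimately show ?thesis unfolding feasible_def by blast
  qed
  then show ?thesis by blast
qed

section \<open>Growth of denominators and levels\<close>

lemma top_level_le: "top_level R k T X \<le> k"
  unfolding top_level_def by (induction k) auto

lemma top_level_feasible: "top_level R k T X = m \<Longrightarrow> m > 0 \<Longrightarrow> feasible R m T X"
  unfolding top_level_def by (induction k) (auto split: if_splits)

lemma top_level_ge: "feasible R m T X \<Longrightarrow> m \<le> k \<Longrightarrow> m \<le> top_level R k T X"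
proof (induction k)
  case (Suc k)
  then show ?case by (cases "m = Suc k") (auto simp: top_level_def)
qed simp

lemma good_step_next:
  assumes "feasible R m T X" "m > 0"
  shows "good_step R m T X (next_den R m T X) (next_num R m T X)"
proof -
  have "\<exists>T'<Suc (T ^ Suc m). \<exists>X'<Suc ((X + 2) * T'). good_step R m T X T' X'"
    using assms(1) unfolding feasible_def .
  from first_below(1)[OF this] have "\<exists>X'<Suc ((X + 2) * next_den R m T X). good_step R m T X (next_den R m T X) X'"
    using assms(2) unfolding next_den_def by simp
  from first_below(1)[OF this] show ?thesis using assms(2) unfolding next_num_def by simp
qed

lemma state_Suc: "state R (Suc n) = advance R (state R n)"
  by (simp add: state_def)

lemma state_0: "lvl 0 = 0" "start 0 = 4" "den 0 = 4" "num 0 = 0"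
  by (simp_all add: state_def)

lemma den_Suc: "den (Suc n) = new_den R (state R n)"
  and num_Suc: "num (Suc n) = new_num R (state R n)"
  by (simp_all add: state_Suc advance_def)

lemma used_le: "used n \<le> lvl n"
  by (simp add: used_level_def top_level_le)

lemma used_good:
  assumes "used n > 0"
  shows "good_step R (used n) (den n) (num n) (den (Suc n)) (num (Suc n))"
  unfolding den_Suc num_Suc new_den_def new_num_def
  using assms by (intro good_step_next) (auto intro: top_level_feasible simp: used_level_def)

lemma step_basic:
  assumes "den n \<ge> 1"
  shows "2 * den n \<le> den (Suc n)" "num n * den (Suc n) \<le> num (Suc n) * den n"
    "num (Suc n) * den n \<le> num n * den (Suc n) + 2 * den (Suc n)"
proof -
  have "2 * den n \<le> den (Suc n) \<and> num n * den (Suc n) \<le> num (Suc n) * den n \<and>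
    num (Suc n) * den n \<le> num n * den (Suc n) + 2 * den (Suc n)"
  proof (cases "used n = 0")
    case True
    then show ?thesis by (simp add: den_Suc num_Suc new_den_def new_num_def next_den_def next_num_def)
  next
    case False
    then have g: "good_step R (used n) (den n) (num n) (den (Suc n)) (num (Suc n))"
      by (intro used_good) simp
    let ?c = "block_base R (used n) * Suc (used n)"
    have "2 * 1 \<le> ?c" using block_base_ge[of "used n"] by (intro mult_le_mono) auto
    moreover have "?c ^ 1 \<le> ?c ^ (used n * used n)"
      using False calculation by (intro power_increasing) auto
    ultimately have "2 \<le> ?c ^ (used n * used n)" by simp
    then have "den n * 2 \<le> den n * ?c ^ (used n * used n)" by (rule mult_le_mono2)
    moreover have "den n * ?c ^ (used n * used n) \<le> den (Suc n)" using g unfolding good_step_def by blast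
    ultimately have "2 * den n \<le> den (Suc n)" by linarith
    then show ?thesis using g unfolding good_step_def by blast
  qed
  then show "2 * den n \<le> den (Suc n)" "num n * den (Suc n) \<le> num (Suc n) * den n"
    "num (Suc n) * den n \<le> num n * den (Suc n) + 2 * den (Suc n)" by blast+
qed

lemma den_ge: "den n \<ge> 2 ^ (n + 2)"
proof (induction n)
  case 0
  then show ?case by (simp add: state_0)
next
  case (Suc n)
  have "(1::nat) \<le> 2 ^ (n + 2)" by simp
  then have "den n \<ge> 1" using Suc by linarith
  then show ?case using step_basic(1)[of n] Suc by simp
qed

lemma den_pos: "den n \<ge> 1"
  using den_ge[of n] one_le_power[of "2::nat" "n + 2"] by linarith

lemma den_mono: "i \<le> n \<Longrightarrow> den i \<le> den n"
proof (induction n rule: dec_induct)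
  case (step n)
  then show ?case using step_basic(1)[OF den_pos, of n] by linarith
qed simp

lemma den_unbounded: "n \<ge> M \<Longrightarrow> den n \<ge> M"
proof -
  assume "n \<ge> M"
  then have "M < 2 ^ (n + 2)" using less_exp[of "n + 2"] by linarith
  then show ?thesis using den_ge[of n] by linarith
qed

lemma lvl_Suc: "lvl (Suc n) = (if used n = lvl n \<and> start n ^ Suc (lvl n) \<le> den (Suc n) then Suc (lvl n) else lvl n)"
  and start_Suc: "start (Suc n) = (if used n = lvl n \<and> start n ^ Suc (lvl n) \<le> den (Suc n) then den (Suc n)
     else if used n = lvl n then start n else den (Suc n))"
  unfolding den_Suc by (simp_all add: state_Suc advance_def)

lemma lvl_mono: "i \<le> n \<Longrightarrow> lvl i \<le> lvl n"
  by (induction n rule: dec_induct) (auto simp: lvl_Suc)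

lemma run_invariant: "\<exists>a\<le>n. start n = den a \<and> (\<forall>i. a \<le> i \<and> i < n \<longrightarrow> used i = lvl n)"
proof (induction n)
  case 0
  then show ?case by (simp add: state_0)
next
  case (Suc n)
  then obtain a where a: "a \<le> n" "start n = den a" "\<forall>i. a \<le> i \<and> i < n \<longrightarrow> used i = lvl n" by blast
  show ?case
  proof (cases "used n = lvl n \<and> \<not> start n ^ Suc (lvl n) \<le> den (Suc n)")
    case True
    then have "start (Suc n) = den a" "lvl (Suc n) = lvl n" using a(2) unfolding start_Suc lvl_Suc by auto
    moreover have "\<forall>i. a \<le> i \<and> i < Suc n \<longrightarrow> used i = lvl n" using a(3) True by (auto simp: less_Suc_eq)
    ultimately show ?thesis using a(1) by (intro exI[of _ a]) auto
  next
    case False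
    then have "start (Suc n) = den (Suc n)" unfolding start_Suc by auto
    then show ?thesis by (intro exI[of _ "Suc n"]) auto
  qed
qed

text \<open>A level that stayed at \<open>k\<close> forever would be used at all late steps. The
  start of the run would then freeze while the denominators are unbounded, and the threshold for
  raising the level would be met.\<close>

lemma lvl_increases: "\<exists>n'\<ge>n. lvl n' = lvl n \<and> lvl (Suc n') = Suc (lvl n)"
proof (rule ccontr)
  assume no: "\<not> ?thesis"
  define k where "k = lvl n"
  have const: "lvl i = k" if "i \<ge> n" for i
    using that
  proof (induction i rule: dec_induct)
    case (step i)
    then show ?case using no k_def unfolding lvl_Suc by (metis lvl_Suc)
  qed (simp add: k_def)
  obtain T0 where T0: "\<And>T X. T \<ge> T0 \<Longrightarrow> k \<ge> 1 \<Longrightarrow> feasible R k T X"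
    using feasible_eventually[of k] by (cases "k \<ge> 1") auto
  define n1 where "n1 = max n T0"
  have used: "used i = k" if "i \<ge> n1" for i
  proof (cases "k \<ge> 1")
    case True
    have "i \<ge> T0" using that by (simp add: n1_def)
    then have "feasible R k (den i) (num i)" using T0[OF den_unbounded True] by blast
    then have "k \<le> used i" unfolding used_level_def using const[of i] that
      by (intro top_level_ge) (auto simp: n1_def)
    then show ?thesis using used_le[of i] const[of i] that by (simp add: n1_def)
  next
    case False
    then show ?thesis using used_le[of i] const[of i] that by (simp add: n1_def)
  qed
  have ne: "\<not> start i ^ Suc (lvl i) \<le> den (Suc i)" if "i \<ge> n1" for i
  proof
    assume "start i ^ Suc (lvl i) \<le> den (Suc i)"
    then have "lvl (Suc i) = Suc k" unfolding lvl_Suc using used[OF that] const[of i] that by (simp add: n1_def)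
    then show False using const[of "Suc i"] that by (simp add: n1_def)
  qed
  have start: "start i = start n1" if "i \<ge> n1" for i
    using that
  proof (induction i rule: dec_induct)
    case (step i)
    then show ?case unfolding start_Suc using ne[of i] used[of i] const[of i] by (simp add: n1_def)
  qed simp
  define i where "i = max n1 (start n1 ^ Suc k)"
  have "start i ^ Suc (lvl i) = start n1 ^ Suc k" using start[of i] const[of i] by (simp add: i_def n1_def)
  moreover have "start n1 ^ Suc k \<le> den (Suc i)" by (rule den_unbounded) (simp add: i_def)
  ultimately show False using ne[of i] by (simp add: i_def)
qed

lemma lvl_attains: "\<exists>n. lvl n = k"
proof (induction k)
  case 0
  then show ?case using state_0 by blast
next
  case (Suc k)
  then obtain n where "lvl n = k" by blast
  then show ?case using lvl_increases[of n] by metis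
qed

text \<open>Once level \<open>m\<close> is allowed and the denominators have passed its threshold of
  feasibility, the choice of the largest feasible level never falls below \<open>m\<close>
  again.\<close>

lemma used_unbounded: "\<exists>n0. \<forall>n\<ge>n0. used n \<ge> m"
proof (cases "m \<ge> 1")
  case True
  obtain n1 where n1: "lvl n1 = m" using lvl_attains by blast
  obtain T0 where T0: "\<And>T X. T \<ge> T0 \<Longrightarrow> feasible R m T X" using feasible_eventually[OF True] by blast
  have "used n \<ge> m" if "n \<ge> max n1 T0" for n
    unfolding used_level_def
    using T0[OF den_unbounded[of T0 n]] lvl_mono[of n1 n] n1 that by (intro top_level_ge) auto
  then show ?thesis by blast
qed auto

text \<open>The level counter rises by single units, so every \<open>k\<close> is left at some step,
  and it can be left only through the threshold in \<open>advance\<close>. Each level belonging to a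
  base outside \<open>R\<close> thus gets its long run.\<close>

lemma exists_long_run:
  shows "\<exists>a n. a \<le> n \<and> (\<forall>i. a \<le> i \<and> i \<le> n \<longrightarrow> used i = k) \<and> den a ^ Suc k \<le> den (Suc n)"
proof -
  obtain n0 where n0: "lvl n0 = k" using lvl_attains by blast
  obtain n where n: "lvl n = k" "lvl (Suc n) = Suc k" using lvl_increases[of n0] n0 by auto
  then have u: "used n = k" "start n ^ Suc k \<le> den (Suc n)" unfolding lvl_Suc by (auto split: if_splits)
  obtain a where a: "a \<le> n" "start n = den a" "\<forall>i. a \<le> i \<and> i < n \<longrightarrow> used i = lvl n" using run_invariant by blast
  show ?thesis
    by (rule exI[of _ a], rule exI[of _ n]) (use a u n in \<open>auto simp: le_less\<close>)
qed

section \<open>The limit and its rate of convergence\<close>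

definition approx :: "nat \<Rightarrow> real" where "approx n = real (num n) / real (den n)"

definition limit_point :: real where "limit_point = (SUP n. approx n)"

text \<open>A step moves the value by at most \<open>2 / den n\<close>, and denominators at least
  double; with the constant 4 the upper ends therefore decrease and nested intervals result.\<close>

lemma approx_Suc: "approx n \<le> approx (Suc n)" "approx (Suc n) + 4 / real (den (Suc n)) \<le> approx n + 4 / real (den n)"
proof -
  have p: "real (den n) > 0" "real (den (Suc n)) > 0"
    using den_pos[of n] den_pos[of "Suc n"] by linarith+
  have "real (num n * den (Suc n)) \<le> real (num (Suc n) * den n)"
    using step_basic(2)[OF den_pos] by (simp only: of_nat_le_iff)
  then show "approx n \<le> approx (Suc n)" using p by (simp add: approx_def field_simps)
  have "real (num (Suc n) * den n) \<le> real (num n * den (Suc n) + 2 * den (Suc n))"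
    using step_basic(3)[OF den_pos] by (simp only: of_nat_le_iff)
  then have 1: "approx (Suc n) \<le> approx n + 2 / real (den n)" using p by (simp add: approx_def field_simps)
  have "real (2 * den n) \<le> real (den (Suc n))" using step_basic(1)[OF den_pos] by (simp only: of_nat_le_iff)
  then have "4 / real (den (Suc n)) \<le> 2 / real (den n)" using p by (simp add: field_simps)
  then show "approx (Suc n) + 4 / real (den (Suc n)) \<le> approx n + 4 / real (den n)" using 1 by simp
qed

lemma limit_point_bounds: "approx n \<le> limit_point" "limit_point \<le> approx n + 4 / real (den n)"
proof -
  have inc: "i \<le> j \<Longrightarrow> approx i \<le> approx j" for i j
    using approx_Suc(1) by (rule lift_Suc_mono_le)
  have dec: "i \<le> j \<Longrightarrow> approx j + 4 / real (den j) \<le> approx i + 4 / real (den i)" for i j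
    using approx_Suc(2) by (rule lift_Suc_antimono_le[of "\<lambda>n. approx n + 4 / real (den n)"])
  have le: "approx i \<le> approx j + 4 / real (den j)" for i j
  proof (cases "i \<le> j")
    case True
    then show ?thesis using inc[of i j] by (simp add: add_increasing2)
  next
    case False
    then have "approx i + 4 / real (den i) \<le> approx j + 4 / real (den j)" using dec[of j i] by simp
    moreover have "4 / real (den i) \<ge> 0" by simp
    ultimately show ?thesis by linarith
  qed
  have "bdd_above (range approx)" using le[of _ 0] by (intro bdd_aboveI2) auto
  then show "approx n \<le> limit_point" unfolding limit_point_def by (intro cSUP_upper) auto
  show "limit_point \<le> approx n + 4 / real (den n)"
    unfolding limit_point_def by (intro cSUP_least le) auto
qed

lemma computable_limit_point: "computable_real_in R limit_point"
proof -
  have "computable_in R (\<lambda>n. 0)" by (rule rcomp_imp_computable_in) (rule rcomp_const)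
  moreover have "\<bar>limit_point - (real (num n) - real 0) / (real (den n - 1) + 1)\<bar> \<le> 1 / 2 ^ n" for n
  proof -
    have "real (den n - 1) + 1 = real (den n)" using den_pos[of n] by (simp add: of_nat_diff)
    then have "\<bar>limit_point - (real (num n) - real 0) / (real (den n - 1) + 1)\<bar> \<le> 4 / real (den n)"
      using limit_point_bounds[of n] by (simp add: approx_def)
    also have "\<dots> \<le> 4 / 2 ^ (n + 2)"
    proof -
      have "real (2 ^ (n + 2)) \<le> real (den n)" using den_ge[of n] by (simp only: of_nat_le_iff)
      then show ?thesis by (intro frac_le) auto
    qed
    finally show ?thesis by simp
  qed
  ultimately show ?thesis unfolding computable_real_in_def using computable_in_state by blast
qed

section \<open>Normality to the bases in R\<close>

lemma card_between_le:
  fixes a b :: real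
  assumes "a \<le> b"
  shows "real (card {u::nat. a < real u \<and> real u < b}) \<le> b - a + 1"
proof -
  have "{u::nat. a < real u \<and> real u < b} \<subseteq> nat ` {\<lfloor>a\<rfloor> + 1..\<lceil>b\<rceil> - 1}"
  proof
    fix u assume "u \<in> {u::nat. a < real u \<and> real u < b}"
    then have "\<lfloor>a\<rfloor> < int u" "int u < \<lceil>b\<rceil>" by (auto simp: floor_less_iff less_ceiling_iff)
    then have "int u \<in> {\<lfloor>a\<rfloor> + 1..\<lceil>b\<rceil> - 1}" by auto
    then show "u \<in> nat ` {\<lfloor>a\<rfloor> + 1..\<lceil>b\<rceil> - 1}" by (metis image_eqI nat_int)
  qed
  then have "card {u::nat. a < real u \<and> real u < b} \<le> card {\<lfloor>a\<rfloor> + 1..\<lceil>b\<rceil> - 1}"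
    by (meson card_image_le card_mono finite_atLeastAtMost_int finite_imageI order_trans)
  also have "\<dots> = nat (\<lceil>b\<rceil> - 1 - \<lfloor>a\<rfloor>)" by simp
  finally have "real (card {u::nat. a < real u \<and> real u < b}) \<le> real (nat (\<lceil>b\<rceil> - 1 - \<lfloor>a\<rfloor>))" by simp
  also have "\<dots> \<le> b - a + 1"
  proof -
    have "of_int (\<lceil>b\<rceil> - 1 - \<lfloor>a\<rfloor>) \<le> b - a + 1" by linarith
    then show ?thesis using assms by (cases "\<lceil>b\<rceil> - 1 - \<lfloor>a\<rfloor> \<ge> 0") auto
  qed
  finally show ?thesis .
qed

text \<open>The constant 13 is 4 + 9. At most \<open>4 * l\<close> late positions are discarded from
  a window of at least \<open>l * l\<close>. The at most \<open>l * (\<beta> - \<alpha>) + 4\<close>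
  relevant cells, each with relative excess \<open>1 / l\<close>, cost \<open>9 / l\<close> beyond
  the length of the interval.\<close>

lemma stage_count:
  assumes r: "r \<in> R" and l: "used i = l" "r \<le> l" and ab: "0 \<le> \<alpha>" "\<alpha> < \<beta>" "\<beta> \<le> 1"
  shows "real (card {j \<in> window r (den i) (den (Suc i)). \<alpha> \<le> frac (real r ^ j * limit_point) \<and> frac (real r ^ j * limit_point) < \<beta>})
     \<le> (\<beta> - \<alpha> + 13 / real l) * real (card (window r (den i) (den (Suc i))))"
proof -
  define T where "T = den i"
  define T' where "T' = den (Suc i)"
  define X' where "X' = num (Suc i)"
  define W where "W = window r T T'"
  have r2: "r \<ge> 2" using r R_bases by (auto simp: bases_def)
  have l2: "l \<ge> 2" using r2 l by simp
  have g: "good_step R l T (num i) T' X'"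
    using used_good[of i] l l2 unfolding T_def T'_def X'_def by simp
  have T: "T \<ge> 1" "T' \<ge> 1" unfolding T_def T'_def by (rule den_pos)+
  have W: "W = {ceillog r T..<ceillog r T'}" unfolding W_def by (rule window_eq[OF r2])
  have finW: "finite W" by (simp add: W)
  have cardW: "card W \<ge> l * l"
  proof -
    have "r \<le> 1 * Suc l" using l(2) by simp
    also have "1 * Suc l \<le> block_base R l * Suc l" using block_base_ge[of l] by (intro mult_le_mono1) simp
    finally have "r \<le> block_base R l * Suc l" .
    then have "r ^ (l * l) \<le> (block_base R l * Suc l) ^ (l * l)" by (rule power_mono) simp
    then have "T * r ^ (l * l) \<le> T * (block_base R l * Suc l) ^ (l * l)" by (rule mult_le_mono2)
    also have "\<dots> \<le> T'" using g unfolding good_step_def by blast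
    finally show ?thesis using ceillog_add_le[OF r2 T(1), of "l * l" T'] by (simp add: W)
  qed
  \<comment> \<open>Near the end of the window the error \<open>4 / T'\<close> of the approximation
    may be magnified beyond one cell width; these positions are given up.\<close>
  define late where "late = {j \<in> W. T' < 4 * l * r ^ j}"
  have late: "card late \<le> 4 * l"
  proof -
    have "late \<subseteq> {ceillog r T' - 4 * l..<ceillog r T'}"
    proof
      fix j assume j: "j \<in> late"
      have "\<not> j + 4 * l < ceillog r T'"
      proof
        assume "j + 4 * l < ceillog r T'"
        then have "r ^ (j + 4 * l) < T'" using less_ceillog_iff[OF r2] by blast
        moreover have "4 * l \<le> r ^ (4 * l)"
        proof -
          have "4 * l < 2 ^ (4 * l)" by (rule less_exp)
          also have "(2::nat) ^ (4 * l) \<le> r ^ (4 * l)" using r2 by (rule power_mono) simp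
          finally show ?thesis by simp
        qed
        then have "4 * l * r ^ j \<le> r ^ (j + 4 * l)" by (simp add: power_add)
        ultimately show False using j by (simp add: late_def)
      qed
      then show "j \<in> {ceillog r T' - 4 * l..<ceillog r T'}" using j by (auto simp: late_def W)
    qed
    then have "card late \<le> card {ceillog r T' - 4 * l..<ceillog r T'}" by (intro card_mono) auto
    then show ?thesis by simp
  qed
  define cell where "cell = (\<lambda>u. {j \<in> W. u * T' \<le> l * (r ^ j * X' mod T') \<and> l * (r ^ j * X' mod T') < Suc u * T'})"
  have cell: "l * l * card (cell u) \<le> Suc l * card W" if "u < l" for u
  proof -
    have "r < Suc l" using l(2) by simp
    then have "l * l * card {j. j < T' \<and> ((T \<le> r ^ j \<and> r ^ j < T') \<and> u * T' \<le> l * (r ^ j * X' mod T') \<and>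
             l * (r ^ j * X' mod T') < Suc u * T')} \<le> Suc l * card {j. j < T' \<and> (T \<le> r ^ j \<and> r ^ j < T')}"
      using g r that unfolding good_step_def by blast
    then show ?thesis unfolding window_alt[OF r2] cell_def W_def .
  qed
  \<comment> \<open>The true orbit point lies up to one cell to the right of its approximation, and
    locating the approximation in a cell costs another unit: hence
    \<open>real l * \<alpha> - 2\<close>. The last cell is included because its points may wrap
    around past 1.\<close>
  define U where "U = {u. u < l \<and> (real l * \<alpha> - 2 < real u \<and> real u < real l * \<beta> \<or> u = l - 1)}"
  have finU: "finite U" by (simp add: U_def)
  have cardU: "real (card U) \<le> real l * (\<beta> - \<alpha>) + 4"
  proof -
    have "card U \<le> card ({u::nat. real l * \<alpha> - 2 < real u \<and> real u < real l * \<beta>} \<union> {l - 1})"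
    proof (rule card_mono)
      have "{u::nat. real l * \<alpha> - 2 < real u \<and> real u < real l * \<beta>} \<subseteq> {..l}"
      proof
        fix u assume "u \<in> {u::nat. real l * \<alpha> - 2 < real u \<and> real u < real l * \<beta>}"
        moreover have "real l * \<beta> \<le> real l" using ab l2 by (simp add: mult_left_le)
        ultimately have "real u \<le> real l" by simp
        then show "u \<in> {..l}" by simp
      qed
      then have "finite {u::nat. real l * \<alpha> - 2 < real u \<and> real u < real l * \<beta>}"
        using finite_subset by blast
      then show "finite ({u::nat. real l * \<alpha> - 2 < real u \<and> real u < real l * \<beta>} \<union> {l - 1})" by simp
    qed (auto simp: U_def)
    also have "\<dots> \<le> card {u::nat. real l * \<alpha> - 2 < real u \<and> real u < real l * \<beta>} + card {l - 1}"
      by (rule card_Un_le)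
    finally have "real (card U) \<le> real (card {u::nat. real l * \<alpha> - 2 < real u \<and> real u < real l * \<beta>}) + 1" by simp
    moreover have "real l * \<alpha> - 2 \<le> real l * \<beta>"
      using mult_left_mono[of \<alpha> \<beta> "real l"] ab by simp
    ultimately show ?thesis using card_between_le[of "real l * \<alpha> - 2" "real l * \<beta>"] by (simp add: algebra_simps)
  qed
  define S where "S = {j \<in> W. \<alpha> \<le> frac (real r ^ j * limit_point) \<and> frac (real r ^ j * limit_point) < \<beta>}"
  have sub: "S \<subseteq> late \<union> (\<Union>u\<in>U. cell u)"
  proof
    fix j assume j: "j \<in> S"
    show "j \<in> late \<union> (\<Union>u\<in>U. cell u)"
    proof (cases "j \<in> late")
      case False
      have jW: "j \<in> W" using j by (simp add: S_def)
      define y where "y = frac (real r ^ j * limit_point)"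
      have y: "\<alpha> \<le> y" "y < \<beta>" using j by (auto simp: S_def y_def)
      define a where "a = r ^ j * X' mod T'"
      define \<theta> where "\<theta> = real a / real T'"
      have aT: "a < T'" using T by (simp add: a_def)
      have \<theta>: "\<theta> = frac (real r ^ j * approx (Suc i))"
        using frac_of_nat_divide[of T' "r ^ j * X'"] T
        by (simp add: \<theta>_def a_def approx_def X'_def T'_def)
      define \<delta> where "\<delta> = real r ^ j * (limit_point - approx (Suc i))"
      have \<delta>0: "\<delta> \<ge> 0" using limit_point_bounds(1)[of "Suc i"] by (simp add: \<delta>_def)
      have \<delta>1: "\<delta> \<le> 1 / real l"
      proof -
        have "real (4 * l * r ^ j) \<le> real T'" using False jW by (simp only: of_nat_le_iff late_def) auto
        then have le: "4 * real l * real r ^ j \<le> real T'" by simp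
        have "\<delta> \<le> real r ^ j * (4 / real T')"
          unfolding \<delta>_def T'_def using limit_point_bounds(2)[of "Suc i"] by (intro mult_left_mono) auto
        also have "\<dots> \<le> 1 / real l" using le T(2) l2 by (simp add: field_simps)
        finally show ?thesis .
      qed
      have eq: "real r ^ j * limit_point = \<theta> + \<delta> + of_int \<lfloor>real r ^ j * approx (Suc i)\<rfloor>"
        by (simp add: \<theta> \<delta>_def frac_def algebra_simps)
      then have y_eq: "y = frac (\<theta> + \<delta>)" unfolding y_def by simp
      have \<theta>01: "0 \<le> \<theta>" "\<theta> < 1" unfolding \<theta> by (auto simp: frac_lt_1)
      define u where "u = l * a div T'"
      have u1: "u * T' \<le> l * a" "l * a < Suc u * T'"
        using T div_mult_mod_eq[of "l * a" T'] mod_less_divisor[of T' "l * a"] unfolding u_def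
        by (simp, simp add: dividend_less_div_times)
      have ul: "u < l"
      proof -
        have "u * T' < l * T'" using u1(1) aT l2 mult_strict_left_mono[of a T' l] by linarith
        then show ?thesis by simp
      qed
      have ur: "real u \<le> real l * \<theta>" "real l * \<theta> < real u + 1"
      proof -
        have "real (u * T') \<le> real (l * a)" using u1(1) by (simp only: of_nat_le_iff)
        then show "real u \<le> real l * \<theta>" using T by (simp add: \<theta>_def field_simps)
        have "real (l * a) < real (Suc u * T')" using u1(2) by (simp only: of_nat_less_iff)
        then show "real l * \<theta> < real u + 1" using T by (simp add: \<theta>_def field_simps)
      qed
      have "u \<in> U"
      proof (cases "\<theta> + \<delta> < 1")
        case True
        then have yy: "y = \<theta> + \<delta>" unfolding y_eq using \<theta>01 \<delta>0 by (simp add: frac_eq)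
        have "real l * \<theta> \<le> real l * y" using \<delta>0 yy l2 by (intro mult_left_mono) auto
        moreover have "real l * y < real l * \<beta>" using y l2 by simp
        moreover have "real l * y \<le> real l * \<theta> + 1"
          using mult_left_mono[OF \<delta>1, of "real l"] l2 yy by (simp add: distrib_left)
        moreover have "real l * \<alpha> \<le> real l * y" using y by (intro mult_left_mono) auto
        ultimately have "real l * \<alpha> - 2 < real u" "real u < real l * \<beta>" using ur by linarith+
        then show ?thesis using ul by (simp add: U_def)
      next
        case False
        then have "\<theta> \<ge> 1 - 1 / real l" using \<delta>1 by linarith
        then have "real l * (1 - 1 / real l) \<le> real l * \<theta>" by (intro mult_left_mono) auto
        then have "real l - 1 \<le> real l * \<theta>" using l2 by (simp add: right_diff_distrib)
        then have "real l < real u + 2" using ur by linarith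
        then have "u = l - 1" using ul by linarith
        then show ?thesis using l2 by (simp add: U_def)
      qed
      moreover have "j \<in> cell u" using jW u1 by (simp add: cell_def a_def)
      ultimately show ?thesis by blast
    qed simp
  qed
  have "card S \<le> card (late \<union> (\<Union>u\<in>U. cell u))"
    using sub finU finW by (intro card_mono) (auto simp: late_def cell_def)
  also have "\<dots> \<le> card late + card (\<Union>u\<in>U. cell u)" by (rule card_Un_le)
  also have "\<dots> \<le> 4 * l + (\<Sum>u\<in>U. card (cell u))" using late card_UN_le[OF finU] by (rule add_mono)
  finally have "real (card S) \<le> real (4 * l + (\<Sum>u\<in>U. card (cell u)))" by (simp only: of_nat_le_iff)
  also have "\<dots> = 4 * real l + (\<Sum>u\<in>U. real (card (cell u)))" by simp
  also have "(\<Sum>u\<in>U. real (card (cell u))) \<le> (\<Sum>u\<in>U. (real l + 1) / (real l * real l) * real (card W))"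
  proof (rule sum_mono)
    fix u assume "u \<in> U"
    then have "real (l * l * card (cell u)) \<le> real (Suc l * card W)"
      using cell[of u] by (simp only: of_nat_le_iff U_def) auto
    then have "real l * real l * real (card (cell u)) \<le> (real l + 1) * real (card W)" by (simp add: algebra_simps)
    then show "real (card (cell u)) \<le> (real l + 1) / (real l * real l) * real (card W)"
      using l2 by (simp add: field_simps)
  qed
  also have "\<dots> = real (card U) * ((real l + 1) / (real l * real l) * real (card W))" by simp
  also have "\<dots> \<le> (real l * (\<beta> - \<alpha>) + 4) * ((real l + 1) / (real l * real l) * real (card W))"
    using cardU by (rule mult_right_mono) simp
  also have "\<dots> \<le> (\<beta> - \<alpha> + 9 / real l) * real (card W)"
  proof -
    have "(real l * (\<beta> - \<alpha>) + 4) * ((real l + 1) / (real l * real l)) \<le> \<beta> - \<alpha> + 9 / real l"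
    proof -
      have "(real l * (\<beta> - \<alpha>) + 4) * (real l + 1) = real l * real l * (\<beta> - \<alpha>) + real l * (\<beta> - \<alpha>) + 4 * real l + 4"
        by (simp add: algebra_simps)
      also have "\<dots> \<le> real l * real l * (\<beta> - \<alpha>) + real l + 4 * real l + 4 * real l"
        using l2 ab by (intro add_mono) (auto simp: mult_left_le)
      also have "\<dots> = (\<beta> - \<alpha> + 9 / real l) * (real l * real l)" using l2 by (simp add: field_simps)
      finally show ?thesis using l2 by (simp add: divide_le_eq)
    qed
    then have "(real l * (\<beta> - \<alpha>) + 4) * ((real l + 1) / (real l * real l)) * real (card W) \<le> (\<beta> - \<alpha> + 9 / real l) * real (card W)"
      by (rule mult_right_mono) simp
    then show ?thesis by (simp only: mult.assoc)
  qed
  also have "4 * real l \<le> 4 / real l * real (card W)"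
  proof -
    have "real (l * l) \<le> real (card W)" using cardW by (simp only: of_nat_le_iff)
    then show ?thesis using l2 by (simp add: field_simps)
  qed
  finally have "real (card S) \<le> (4 / real l + (\<beta> - \<alpha> + 9 / real l)) * real (card W)"
    by (simp only: distrib_right)
  also have "4 / real l + (\<beta> - \<alpha> + 9 / real l) = \<beta> - \<alpha> + 13 / real l" by simp
  finally have "real (card S) \<le> (\<beta> - \<alpha> + 13 / real l) * real (card W)" .
  then show ?thesis unfolding S_def W_def T_def T'_def .
qed

text \<open>The constant 15 consists of 13 from completed stages, 1 from the unfinished stage, which
  is counted in full, and 1 that absorbs everything before level \<open>m\<close> is reached
  together with the rounding.\<close>

lemma orbit_count_upper:
  assumes r: "r \<in> R" and \<epsilon>: "\<epsilon> > 0"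
  shows "\<exists>N0. \<forall>N\<ge>N0. \<forall>\<alpha> \<beta>. 0 \<le> \<alpha> \<longrightarrow> \<alpha> < \<beta> \<longrightarrow> \<beta> \<le> 1 \<longrightarrow>
    real (card {j. j < N \<and> \<alpha> \<le> frac (real r ^ j * limit_point) \<and> frac (real r ^ j * limit_point) < \<beta>}) \<le> (\<beta> - \<alpha> + \<epsilon>) * real N"
proof -
  have r2: "r \<ge> 2" using r R_bases by (auto simp: bases_def)
  define m where "m = r + nat \<lceil>15 / \<epsilon>\<rceil>"
  have m: "m \<ge> r" "real m \<ge> 15 / \<epsilon>" "m \<ge> 1" using r2 unfolding m_def by linarith+
  have m\<epsilon>: "15 / real m \<le> \<epsilon>" using m \<epsilon> by (simp add: field_simps)
  obtain n0 where n0: "\<And>n. n \<ge> n0 \<Longrightarrow> used n \<ge> m" using used_unbounded by blast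
  define e where "e = (\<lambda>i. ceillog r (den i))"
  have e_mono: "e i \<le> e j" if "i \<le> j" for i j
    unfolding e_def ceillog_le_iff[OF r2]
    using den_mono[OF that] le_power_ceillog[OF r2, of "den j"] by linarith
  \<comment> \<open>The shortness condition of \<open>good_step\<close> in terms of exponents; the
    final 1 pays for rounding in \<open>ceillog\<close>.\<close>
  have gap: "real (e (Suc i)) \<le> real (e i) + real (e i) / real m + 1" if "i \<ge> n0" for i
  proof (cases "e (Suc i)")
    case (Suc d)
    define l where "l = used i"
    have l: "l \<ge> m" "l > 0" using n0[OF that] m by (auto simp: l_def)
    have g: "den (Suc i) ^ l \<le> den i ^ Suc l" using used_good[of i] l unfolding l_def good_step_def by simp
    have "r ^ d < den (Suc i)" using less_ceillog_iff[OF r2, of d "den (Suc i)"] Suc by (simp add: e_def)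
    then have "(r ^ d) ^ l < den (Suc i) ^ l" using l by (intro power_strict_mono) auto
    also have "\<dots> \<le> den i ^ Suc l" by (rule g)
    also have "\<dots> \<le> (r ^ e i) ^ Suc l" unfolding e_def by (rule power_mono[OF le_power_ceillog[OF r2]]) simp
    finally have "r ^ (d * l) < r ^ (e i * Suc l)" by (simp only: power_mult)
    then have "d * l < e i * Suc l" using r2 by (simp add: power_strict_increasing_iff)
    then have "real (d * l) \<le> real (e i * Suc l)" by (simp only: of_nat_le_iff)
    then have "real d * real l \<le> real (e i) * (real l + 1)" by (simp add: algebra_simps)
    then have "real d \<le> real (e i) + real (e i) / real l" using l by (simp add: field_simps)
    also have "real (e i) / real l \<le> real (e i) / real m" using l m by (intro divide_left_mono) auto
    finally show ?thesis using Suc by simp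
  qed simp
  have "real (card {j. j < N \<and> \<alpha> \<le> frac (real r ^ j * limit_point) \<and> frac (real r ^ j * limit_point) < \<beta>}) \<le> (\<beta> - \<alpha> + \<epsilon>) * real N"
    if N: "N \<ge> max (e n0) (m * (e n0 + 1))" and ab: "0 \<le> \<alpha>" "\<alpha> < \<beta>" "\<beta> \<le> 1" for N \<alpha> \<beta>
  proof -
    define P where "P = (\<lambda>j. \<alpha> \<le> frac (real r ^ j * limit_point) \<and> frac (real r ^ j * limit_point) < \<beta>)"
    define c where "c = \<beta> - \<alpha> + 13 / real m"
    have c0: "c \<ge> 0" using ab by (simp add: c_def)
    have stage: "real (card {j \<in> {e i..<e (Suc i)}. P j}) \<le> c * (real (e (Suc i)) - real (e i))" if "i \<ge> n0" for i
    proof -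
      have w: "window r (den i) (den (Suc i)) = {e i..<e (Suc i)}" unfolding e_def by (rule window_eq[OF r2])
      have "real (card {j \<in> {e i..<e (Suc i)}. P j}) \<le> (\<beta> - \<alpha> + 13 / real (used i)) * real (card {e i..<e (Suc i)})"
        using stage_count[OF r refl _ ab, of i] n0[OF that] m unfolding w P_def by simp
      also have "\<dots> \<le> c * real (card {e i..<e (Suc i)})"
        unfolding c_def using n0[OF that] m by (intro mult_right_mono add_left_mono divide_left_mono) auto
      finally show ?thesis using e_mono[of i "Suc i"] by (simp add: of_nat_diff)
    qed
    have upto: "real (card {j. j < e I \<and> P j}) \<le> real (e n0) + c * (real (e I) - real (e n0))" if "I \<ge> n0" for I
      using that
    proof (induction I rule: dec_induct)
      case base
      have "card {j. j < e n0 \<and> P j} \<le> card {..<e n0}" by (intro card_mono) auto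
      then show ?case by simp
    next
      case (step I)
      have "{j. j < e (Suc I) \<and> P j} \<subseteq> {j. j < e I \<and> P j} \<union> {j \<in> {e I..<e (Suc I)}. P j}" by auto
      then have "card {j. j < e (Suc I) \<and> P j} \<le> card ({j. j < e I \<and> P j} \<union> {j \<in> {e I..<e (Suc I)}. P j})"
        by (intro card_mono) auto
      also have "\<dots> \<le> card {j. j < e I \<and> P j} + card {j \<in> {e I..<e (Suc I)}. P j}" by (rule card_Un_le)
      finally have "real (card {j. j < e (Suc I) \<and> P j}) \<le> real (card {j. j < e I \<and> P j}) + real (card {j \<in> {e I..<e (Suc I)}. P j})"
        by linarith
      then show ?case using step.IH stage[of I] step.hyps by (simp add: algebra_simps)
    qed
    obtain I where I: "I \<ge> n0" "e I \<le> N" "N < e (Suc I)"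
    proof -
      have ex: "N < e (Suc (r ^ N))"
        unfolding e_def less_ceillog_iff[OF r2] using den_unbounded[of "Suc (r ^ N)" "Suc (r ^ N)"] by simp
      define J where "J = (LEAST i. N < e i)"
      have J: "N < e J" unfolding J_def using ex by (rule LeastI)
      have "J > n0"
      proof (rule ccontr)
        assume "\<not> J > n0"
        then have "e J \<le> e n0" by (intro e_mono) simp
        then show False using J N by simp
      qed
      then obtain I where "J = Suc I" "I \<ge> n0" by (cases J) auto
      moreover have "e I \<le> N" using not_less_Least[of I "\<lambda>i. N < e i"] \<open>J = Suc I\<close> unfolding J_def by auto
      ultimately show ?thesis using that J by blast
    qed
    have "{j. j < N \<and> P j} \<subseteq> {j. j < e I \<and> P j} \<union> {e I..<e (Suc I)}" using I by auto
    then have "card {j. j < N \<and> P j} \<le> card ({j. j < e I \<and> P j} \<union> {e I..<e (Suc I)})" by (intro card_mono) auto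
    also have "\<dots> \<le> card {j. j < e I \<and> P j} + card {e I..<e (Suc I)}" by (rule card_Un_le)
    finally have "real (card {j. j < N \<and> P j}) \<le> real (card {j. j < e I \<and> P j}) + (real (e (Suc I)) - real (e I))"
      using e_mono[of I "Suc I"] by simp
    also have "\<dots> \<le> (real (e n0) + c * real N) + (real N / real m + 1)"
    proof (rule add_mono)
      have "c * (real (e I) - real (e n0)) \<le> c * real N" using c0 I by (intro mult_left_mono) auto
      then show "real (card {j. j < e I \<and> P j}) \<le> real (e n0) + c * real N" using upto[OF I(1)] by linarith
      have "real (e I) / real m \<le> real N / real m" using I by (intro divide_right_mono) auto
      then show "real (e (Suc I)) - real (e I) \<le> real N / real m + 1" using gap[OF I(1)] by linarith
    qed
    also have "\<dots> \<le> (\<beta> - \<alpha> + 15 / real m) * real N"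
    proof -
      have "real (m * (e n0 + 1)) \<le> real N" using N by (simp only: of_nat_le_iff)
      then have "real (e n0) + 1 \<le> real N / real m" using m by (simp add: field_simps)
      moreover have "(\<beta> - \<alpha> + 15 / real m) * real N = c * real N + real N / real m + real N / real m"
      proof -
        have eq: "\<beta> - \<alpha> + 15 / real m = c + 1 / real m + 1 / real m" by (simp add: c_def)
        show ?thesis unfolding eq by (simp add: distrib_right)
      qed
      moreover have "real (e n0) + x + (y + 1) \<le> x + y + y" if "real (e n0) + 1 \<le> y" for x y :: real
        using that by linarith
      ultimately show ?thesis by metis
    qed
    also have "\<dots> \<le> (\<beta> - \<alpha> + \<epsilon>) * real N" using m\<epsilon> by (intro mult_right_mono) auto
    finally show ?thesis unfolding P_def .
  qed
  then show ?thesis by blast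
qed

lemma orbit_nth: "n < N \<Longrightarrow> orbit r \<xi> N ! n = frac (real r ^ n * \<xi>)" "length (orbit r \<xi> N) = N"
  by (simp_all add: orbit_def)

lemma normal_limit_point:
  assumes r: "r \<in> R"
  shows "normal_to_base r limit_point"
  unfolding normal_to_base_def
proof (rule LIMSEQ_I)
  fix \<epsilon> :: real assume "0 < \<epsilon>"
  then have "\<epsilon> / 3 > 0" by simp
  from orbit_count_upper[OF r this] obtain N0 where N0: "\<And>N \<alpha> \<beta>. N \<ge> N0 \<Longrightarrow> 0 \<le> \<alpha> \<Longrightarrow> \<alpha> < \<beta> \<Longrightarrow> \<beta> \<le> 1 \<Longrightarrow>
    real (card {j. j < N \<and> \<alpha> \<le> frac (real r ^ j * limit_point) \<and> frac (real r ^ j * limit_point) < \<beta>}) \<le> (\<beta> - \<alpha> + \<epsilon> / 3) * real N"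
    by blast
  have "norm (discrepancy (orbit r limit_point N) - 0) < \<epsilon>" if N: "N \<ge> max N0 1" for N
  proof -
    define C where "C = (\<lambda>u v. card {j. j < N \<and> u \<le> frac (real r ^ j * limit_point) \<and> frac (real r ^ j * limit_point) < v})"
    \<comment> \<open>The degenerate case \<open>u = v\<close> occurs below for the complementary
      intervals when \<open>u = 0\<close> or \<open>v = 1\<close>.\<close>
    have up: "real (C u v) \<le> (v - u + \<epsilon> / 3) * real N" if "0 \<le> u" "u \<le> v" "v \<le> 1" for u v
    proof (cases "u = v")
      case True
      then have "C u v = 0" by (auto simp: C_def)
      then show ?thesis using True \<open>0 < \<epsilon>\<close> by simp
    next
      case False
      then show ?thesis unfolding C_def using N0[of N u v] N that by simp
    qed
    have Npos: "real N > 0" using N by simp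
    have bnd: "\<bar>real (C u v) / real N - (v - u)\<bar> \<le> 2 * \<epsilon> / 3" if uv: "0 \<le> u" "u < v" "v \<le> 1" for u v
    proof -
      have "real (C u v) / real N \<le> v - u + \<epsilon> / 3" using up[of u v] uv Npos by (simp add: divide_le_eq)
      moreover have "v - u - 2 * \<epsilon> / 3 \<le> real (C u v) / real N"
      proof -
        have "{..<N} \<subseteq> {j. j < N \<and> 0 \<le> frac (real r ^ j * limit_point) \<and> frac (real r ^ j * limit_point) < u}
           \<union> ({j. j < N \<and> u \<le> frac (real r ^ j * limit_point) \<and> frac (real r ^ j * limit_point) < v}
           \<union> {j. j < N \<and> v \<le> frac (real r ^ j * limit_point) \<and> frac (real r ^ j * limit_point) < 1})"
          by (auto simp: frac_lt_1)
        then have "card {..<N} \<le> card ({j. j < N \<and> 0 \<le> frac (real r ^ j * limit_point) \<and> frac (real r ^ j * limit_point) < u}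
           \<union> ({j. j < N \<and> u \<le> frac (real r ^ j * limit_point) \<and> frac (real r ^ j * limit_point) < v}
           \<union> {j. j < N \<and> v \<le> frac (real r ^ j * limit_point) \<and> frac (real r ^ j * limit_point) < 1}))"
          by (intro card_mono) auto
        also have "\<dots> \<le> C 0 u + (C u v + C v 1)"
          unfolding C_def by (meson add_left_mono card_Un_le order_trans)
        finally have "real N \<le> real (C 0 u) + (real (C u v) + real (C v 1))" by simp
        moreover have "real (C 0 u) \<le> (u + \<epsilon> / 3) * real N" using up[of 0 u] uv by simp
        moreover have "real (C v 1) \<le> (1 - v + \<epsilon> / 3) * real N" using up[of v 1] uv by simp
        ultimately have "(v - u - 2 * \<epsilon> / 3) * real N \<le> real (C u v)" by (simp add: algebra_simps)
        then show ?thesis using Npos by (simp add: le_divide_eq)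
      qed
      ultimately show ?thesis using \<open>0 < \<epsilon>\<close> by linarith
    qed
    have set_eq: "{n. n < length (orbit r limit_point N) \<and> u \<le> orbit r limit_point N ! n \<and> orbit r limit_point N ! n < v}
      = {j. j < N \<and> u \<le> frac (real r ^ j * limit_point) \<and> frac (real r ^ j * limit_point) < v}" for u v
      by (auto simp: orbit_nth)
    define f where "f = (\<lambda>(u, v). \<bar>real (C u v) / real N - (v - u)\<bar>)"
    define A :: "(real \<times> real) set" where "A = {(u, v). 0 \<le> u \<and> u < v \<and> v \<le> 1}"
    have disc: "discrepancy (orbit r limit_point N) = (SUP p\<in>A. f p)"
      unfolding discrepancy_def f_def A_def set_eq C_def by (simp add: orbit_nth case_prod_beta)
    have fb: "f p \<le> 2 * \<epsilon> / 3" if "p \<in> A" for p using bnd that by (auto simp: f_def A_def)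
    have A1: "(0, 1) \<in> A" by (simp add: A_def)
    have "(SUP p\<in>A. f p) \<le> 2 * \<epsilon> / 3" using A1 fb by (intro cSUP_least) auto
    moreover have "f (0, 1) \<le> (SUP p\<in>A. f p)" 
      by (rule cSUP_upper[OF A1 bdd_aboveI2]) (rule fb)
    moreover have "f (0, 1) \<ge> 0" by (simp add: f_def)
    ultimately show ?thesis using disc \<open>0 < \<epsilon>\<close> by simp
  qed
  then show "\<exists>no. \<forall>n\<ge>no. norm (discrepancy (orbit r limit_point n) - 0) < \<epsilon>" by blast
qed

section \<open>Failure of simple normality outside R\<close>

text \<open>The block condition gives \<open>2 / b\<close> for the approximation. Two positions of
  distance from the end of the block keep the contribution of all later steps within another
  \<open>2 / b\<close>, and the sum stays below 1, so nothing wraps around.\<close>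

lemma zero_digits_in_run:
  assumes l: "used i = k" "k \<ge> 1" and b: "block_base R k = b"
    and \<kappa>: "ceillog b (den i) \<le> \<kappa>" "\<kappa> + 2 < ceillog b (den (Suc i))"
  shows "frac (real b ^ \<kappa> * limit_point) < 4 / real b"
proof -
  have b2: "b \<ge> 2" using block_base_ge[of k] b by simp
  have b4: "real b \<ge> 4"
  proof -
    have "(2::nat) ^ 8 \<le> b" unfolding b[symmetric] block_base_def using level_base_ge by (rule power_mono) simp
    then show ?thesis by simp
  qed
  define T' where "T' = den (Suc i)"
  define X' where "X' = num (Suc i)"
  have T': "T' \<ge> 1" unfolding T'_def by (rule den_pos)
  have g: "good_step R k (den i) (num i) T' X'" using used_good[of i] l by (simp add: T'_def X'_def)
  have p1: "den i \<le> b ^ \<kappa>" using \<kappa> ceillog_le_iff[OF b2] by blast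
  have p2: "b ^ (\<kappa> + 2) < T'" using \<kappa> less_ceillog_iff[OF b2] by (simp add: T'_def)
  have p3: "b ^ \<kappa> < T'" using p2 b2 power_increasing[of \<kappa> "\<kappa> + 2" b] by linarith
  have "\<kappa> < T'"
  proof -
    have "\<kappa> < 2 ^ \<kappa>" by (rule less_exp)
    also have "(2::nat) ^ \<kappa> \<le> b ^ \<kappa>" using b2 by (rule power_mono) simp
    finally show ?thesis using p3 by simp
  qed
  then have "(b ^ \<kappa> * X' mod T') * b < 2 * T'" using g p1 p3 b unfolding good_step_def by blast
  then have "real ((b ^ \<kappa> * X' mod T') * b) < real (2 * T')" by (simp only: of_nat_less_iff)
  then have th: "real (b ^ \<kappa> * X' mod T') / real T' < 2 / real b" using T' b2 by (simp add: field_simps)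
  define \<theta> where "\<theta> = frac (real b ^ \<kappa> * approx (Suc i))"
  have \<theta>: "\<theta> < 2 / real b" "\<theta> \<ge> 0"
    using th frac_of_nat_divide[of T' "b ^ \<kappa> * X'"] T'
    by (simp_all add: \<theta>_def approx_def X'_def T'_def)
  define \<delta> where "\<delta> = real b ^ \<kappa> * (limit_point - approx (Suc i))"
  have \<delta>0: "\<delta> \<ge> 0" using limit_point_bounds(1)[of "Suc i"] by (simp add: \<delta>_def)
  have \<delta>1: "\<delta> \<le> 2 / real b"
  proof -
    have "real (b ^ (\<kappa> + 2)) \<le> real T'" using p2 by (simp only: of_nat_le_iff)
    then have le: "real b ^ \<kappa> * (real b * real b) \<le> real T'" by (simp add: power_add power2_eq_square mult_ac)
    have "2 * real b \<le> real b * real b" using b4 by simp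
    then have "real b ^ \<kappa> * (2 * real b) \<le> real b ^ \<kappa> * (real b * real b)" by (intro mult_left_mono) auto
    then have le2: "real b ^ \<kappa> * (2 * real b) \<le> real T'" using le by linarith
    have "\<delta> \<le> real b ^ \<kappa> * (4 / real T')"
      unfolding \<delta>_def T'_def using limit_point_bounds(2)[of "Suc i"] by (intro mult_left_mono) auto
    also have "\<dots> \<le> 2 / real b" using le2 T' b2 by (simp add: field_simps)
    finally show ?thesis .
  qed
  have eq: "real b ^ \<kappa> * limit_point = \<theta> + \<delta> + of_int \<lfloor>real b ^ \<kappa> * approx (Suc i)\<rfloor>"
    by (simp add: \<theta>_def \<delta>_def frac_def algebra_simps)
  have sum: "\<theta> + \<delta> < 4 / real b" using \<theta> \<delta>1 by (simp add: field_simps)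
  moreover have "4 / real b \<le> 1" using b4 by simp
  ultimately have "frac (\<theta> + \<delta>) = \<theta> + \<delta>" using \<theta> \<delta>0 by (simp add: frac_eq)
  then show ?thesis using sum unfolding eq by simp
qed

lemma biased_digits:
  assumes s: "s \<in> bases - R"
  shows "\<exists>N\<ge>k0. N > 0 \<and> 5 * N \<le> 8 * card {p. p < N \<and> frac (real s ^ p * limit_point) < 1 / real s}"
proof -
  have s2: "s \<ge> 2" "s \<notin> R" using s by (auto simp: bases_def)
  \<comment> \<open>The second component forces the level up: \<open>k \<ge> 24\<close> feeds the
    constants 25 and 576 below, and \<open>k \<ge> k0\<close> makes \<open>N\<close> large.\<close>
  define k where "k = prod_encode (s, k0 + 24)"
  have k: "k \<ge> k0 + 24" unfolding k_def by (rule le_prod_encode_2)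
  have lb: "level_base R k = s" using s2 by (simp add: level_base_def k_def)
  define b where "b = s ^ 8"
  have b: "block_base R k = b" by (simp add: block_base_def lb b_def)
  have b2: "b \<ge> 2" using block_base_ge[of k] b by simp
  obtain a n where an: "a \<le> n" "\<And>i. a \<le> i \<Longrightarrow> i \<le> n \<Longrightarrow> used i = k" "den a ^ Suc k \<le> den (Suc n)"
    using exists_long_run[of k] by blast
  define E where "E = (\<lambda>i. ceillog b (den i))"
  define G where "G = {\<kappa>. frac (real b ^ \<kappa> * limit_point) < 4 / real b}"
  have E_step: "E i + k * k \<le> E (Suc i)" if "a \<le> i" "i \<le> n" for i
  proof -
    have g: "good_step R k (den i) (num i) (den (Suc i)) (num (Suc i))"
      using used_good[of i] an(2)[OF that] k by simp
    have "b ^ (k * k) \<le> (b * Suc k) ^ (k * k)" by (intro power_mono) auto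
    then have "den i * b ^ (k * k) \<le> den i * (b * Suc k) ^ (k * k)" by (rule mult_le_mono2)
    also have "\<dots> \<le> den (Suc i)" using g b unfolding good_step_def by blast
    finally show ?thesis unfolding E_def by (rule ceillog_add_le[OF b2 den_pos])
  qed
  \<comment> \<open>Each step spoils at most its last two positions. The second conjunct bounds the
    number of steps, so these losses are a small share of the run.\<close>
  have count: "E n' \<le> E a + card {\<kappa> \<in> G. E a \<le> \<kappa> \<and> \<kappa> < E n'} + 2 * (n' - a) \<and> E a + (n' - a) * (k * k) \<le> E n'"
    if "a \<le> n'" "n' \<le> Suc n" for n'
    using that
  proof (induction n' rule: dec_induct)
    case base
    then show ?case by simp
  next
    case (step i)
    have i: "a \<le> i" "i \<le> n" using step by auto
    have IH: "E i \<le> E a + card {\<kappa> \<in> G. E a \<le> \<kappa> \<and> \<kappa> < E i} + 2 * (i - a)" "E a + (i - a) * (k * k) \<le> E i"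
      using step.IH i by auto
    have new: "{E i..<E (Suc i) - 2} \<subseteq> G"
      using zero_digits_in_run[OF an(2)[OF i] _ b] k unfolding G_def E_def by auto
    have "card {\<kappa> \<in> G. E a \<le> \<kappa> \<and> \<kappa> < E i} + card {E i..<E (Suc i) - 2}
       = card ({\<kappa> \<in> G. E a \<le> \<kappa> \<and> \<kappa> < E i} \<union> {E i..<E (Suc i) - 2})"
      by (intro card_Un_disjoint[symmetric]) auto
    also have "\<dots> \<le> card {\<kappa> \<in> G. E a \<le> \<kappa> \<and> \<kappa> < E (Suc i)}"
    proof (rule card_mono)
      show "{\<kappa> \<in> G. E a \<le> \<kappa> \<and> \<kappa> < E i} \<union> {E i..<E (Suc i) - 2} \<subseteq> {\<kappa> \<in> G. E a \<le> \<kappa> \<and> \<kappa> < E (Suc i)}"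
        using new IH(2) E_step[OF i] by auto
    qed auto
    finally have c: "card {\<kappa> \<in> G. E a \<le> \<kappa> \<and> \<kappa> < E i} + (E (Suc i) - 2 - E i) \<le> card {\<kappa> \<in> G. E a \<le> \<kappa> \<and> \<kappa> < E (Suc i)}"
      by simp
    have d: "Suc i - a = Suc (i - a)" using i by simp
    show ?case unfolding d using c IH E_step[OF i] by auto
  qed
  define c where "c = Suc n - a"
  define GG where "GG = {\<kappa> \<in> G. E a \<le> \<kappa> \<and> \<kappa> < E (Suc n)}"
  have c1: "c \<ge> 1" using an(1) by (simp add: c_def)
  have k24: "24 * 24 \<le> k * k" using k by (intro mult_le_mono) auto
  have f1: "E (Suc n) \<le> E a + card GG + 2 * c" "E a + c * (k * k) \<le> E (Suc n)"
    using count[of "Suc n"] an(1) unfolding c_def GG_def by auto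
  have "c * 576 \<le> c * (k * k)" using k24 by (intro mult_le_mono2) simp
  then have f2: "E a + 576 * c \<le> E (Suc n)" using f1 by linarith
  have f3: "25 * (E a - 1) \<le> E (Suc n)"
  proof (cases "E a")
    case (Suc d)
    have "b ^ d < den a" using less_ceillog_iff[OF b2, of d "den a"] Suc by (simp add: E_def)
    then have "(b ^ d) ^ Suc k \<le> den a ^ Suc k" by (intro power_mono) auto
    also have "\<dots> \<le> den (Suc n)" by (rule an(3))
    also have "\<dots> \<le> b ^ E (Suc n)" unfolding E_def by (rule le_power_ceillog[OF b2])
    finally have "b ^ (d * Suc k) \<le> b ^ E (Suc n)" by (simp only: power_mult)
    then have "d * Suc k \<le> E (Suc n)" using b2 by (simp add: power_increasing_iff)
    moreover have "d * 25 \<le> d * Suc k" using k by (intro mult_le_mono2) simp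
    ultimately have "d * 25 \<le> E (Suc n)" by (meson order_trans)
    then show ?thesis using Suc by simp
  qed simp
  \<comment> \<open>Up to one unit, at most 1/25 of the positions precede the run, and at most 2/576
    are lost at block ends; together this is less than a sixth.\<close>
  have main: "5 * E (Suc n) \<le> 6 * card GG" using f1(1) f2 f3 c1 by linarith
  define N where "N = 8 * E (Suc n)"
  have Nk: "N \<ge> k0" "N > 0"
  proof -
    have "k * 1 \<le> k * k" using k by (intro mult_le_mono2) simp
    moreover have "1 * (k * k) \<le> c * (k * k)" using c1 by (rule mult_le_mono1)
    ultimately have "k \<le> E (Suc n)" using f1(2) by linarith
    then show "N \<ge> k0" "N > 0" using k by (auto simp: N_def)
  qed
  \<comment> \<open>Each good position \<open>\<kappa>\<close> in base \<open>s ^ 8\<close> yields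
    six zeros in base \<open>s\<close>, because \<open>4 / s ^ 8 \<le> 1 / s ^ 6\<close>.\<close>
  let ?h = "\<lambda>(\<kappa>, e). 8 * \<kappa> + e :: nat"
  have inj: "inj_on ?h (GG \<times> {..<6})"
  proof (rule inj_onI)
    fix x y assume "x \<in> GG \<times> {..<6}" "y \<in> GG \<times> {..<6::nat}" "?h x = ?h y"
    then have "8 * fst x + snd x = 8 * fst y + snd y" "snd x < 6" "snd y < 6"
      by (auto simp: case_prod_beta mem_Times_iff)
    then have "fst x = fst y \<and> snd x = snd y" by presburger
    then show "x = y" by (simp add: prod_eq_iff)
  qed
  have sub: "?h ` (GG \<times> {..<6}) \<subseteq> {p. p < N \<and> frac (real s ^ p * limit_point) < 1 / real s}"
  proof
    fix p assume "p \<in> ?h ` (GG \<times> {..<6})"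
    then obtain \<kappa> e where p: "p = 8 * \<kappa> + e" "\<kappa> \<in> GG" "e < 6" by auto
    define y where "y = frac (real b ^ \<kappa> * limit_point)"
    have y: "y < 4 / real b" "y \<ge> 0" using p(2) by (auto simp: GG_def G_def y_def)
    have rs: "real s \<ge> 2" using s2 by simp
    have "real s ^ e * y < 1 / real s"
    proof -
      have "real s ^ e \<le> real s ^ 5" using rs p(3) by (intro power_increasing) auto
      then have "real s ^ e * y \<le> real s ^ 5 * y" using y by (intro mult_right_mono) auto
      also have "\<dots> < real s ^ 5 * (4 / real b)" using y rs by (intro mult_strict_left_mono) auto
      also have "4 / real b \<le> (real s ^ 2) / real s ^ 8"
      proof -
        have "2 ^ 2 \<le> real s ^ 2" using rs by (intro power_mono) auto
        then show ?thesis unfolding b_def by (simp add: divide_right_mono)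
      qed
      then have "real s ^ 5 * (4 / real b) \<le> real s ^ 5 * ((real s ^ 2) / real s ^ 8)" by (intro mult_left_mono) auto
      also have "\<dots> = 1 / real s"
      proof -
        have "real s ^ 8 = real s ^ 5 * real s ^ 2 * real s" by (simp flip: power_add power_Suc2)
        then show ?thesis using rs by simp
      qed
      finally show ?thesis .
    qed
    moreover have "frac (real s ^ p * limit_point) = real s ^ e * y"
    proof -
      have "real s ^ p * limit_point = real s ^ e * (real b ^ \<kappa> * limit_point)"
        unfolding p(1) b_def power_add power_mult by simp
      also have "real b ^ \<kappa> * limit_point = y + of_int \<lfloor>real b ^ \<kappa> * limit_point\<rfloor>" by (simp add: y_def frac_def)
      also have "real s ^ e * (y + of_int \<lfloor>real b ^ \<kappa> * limit_point\<rfloor>) = real s ^ e * y + of_int (int s ^ e * \<lfloor>real b ^ \<kappa> * limit_point\<rfloor>)"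
        by (simp add: distrib_left)
      finally have "frac (real s ^ p * limit_point) = frac (real s ^ e * y)" by (simp add: frac_def del: of_int_mult of_int_power)
      also have "\<dots> = real s ^ e * y"
      proof -
        have "1 / real s < 1" using rs by simp
        then have "real s ^ e * y < 1" using \<open>real s ^ e * y < 1 / real s\<close> by linarith
        then show ?thesis using y by (simp add: frac_eq)
      qed
      finally show ?thesis .
    qed
    moreover have "p < N" using p by (simp add: GG_def N_def)
    ultimately show "p \<in> {p. p < N \<and> frac (real s ^ p * limit_point) < 1 / real s}" by simp
  qed
  have "card GG * 6 = card (?h ` (GG \<times> {..<6}))" by (subst card_image[OF inj]) (simp add: card_cartesian_product)
  also have "\<dots> \<le> card {p. p < N \<and> frac (real s ^ p * limit_point) < 1 / real s}"
    using sub by (intro card_mono) auto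
  finally have "5 * N \<le> 8 * card {p. p < N \<and> frac (real s ^ p * limit_point) < 1 / real s}"
    using main by (simp add: N_def)
  then show ?thesis using Nk by blast
qed

text \<open>At arbitrarily large lengths the digit 0 has frequency at least 5/8, while its expected
  frequency \<open>1 / s\<close> is at most 1/2; the discrepancy returns to 1/8 or more.\<close>

lemma not_simply_normal_limit_point:
  assumes s: "s \<in> bases - R"
  shows "\<not> simply_normal_to_base s limit_point"
proof
  have s2: "s \<ge> 2" using s by (auto simp: bases_def)
  assume "simply_normal_to_base s limit_point"
  then have "eventually (\<lambda>N. discrepancy_on (digit_intervals s) (orbit s limit_point N) < 1 / 8) sequentially"
    unfolding simply_normal_to_base_def by (rule order_tendstoD(2)) simp
  then obtain N0 where N0: "\<And>N. N \<ge> N0 \<Longrightarrow> discrepancy_on (digit_intervals s) (orbit s limit_point N) < 1 / 8"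
    unfolding eventually_sequentially by blast
  obtain N where N: "N \<ge> N0" "N > 0" "5 * N \<le> 8 * card {p. p < N \<and> frac (real s ^ p * limit_point) < 1 / real s}"
    using biased_digits[OF s, of N0] by blast
  let ?I = "{real 0 / real s..<(real 0 + 1) / real s}"
  let ?f = "\<lambda>I. \<bar>real (card {n. n < length (orbit s limit_point N) \<and> orbit s limit_point N ! n \<in> I}) / real (length (orbit s limit_point N)) - measure lborel I\<bar>"
  have "digit_intervals s = (\<lambda>a. {real a / real s..<(real a + 1) / real s}) ` {..<s}"
    unfolding digit_intervals_def by auto
  then have "finite (digit_intervals s)" by simp
  moreover have "?I \<in> digit_intervals s" unfolding digit_intervals_def
    by (rule CollectI, rule exI[of _ 0]) (use s2 in simp)
  ultimately have le: "?f ?I \<le> discrepancy_on (digit_intervals s) (orbit s limit_point N)"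
    unfolding discrepancy_on_def by (intro cSUP_upper bdd_above_finite finite_imageI)
  have set: "{n. n < length (orbit s limit_point N) \<and> orbit s limit_point N ! n \<in> ?I}
     = {p. p < N \<and> frac (real s ^ p * limit_point) < 1 / real s}"
    unfolding orbit_nth(2) by (intro Collect_cong conj_cong refl) (simp add: orbit_nth(1))
  have "real (5 * N) \<le> real (8 * card {p. p < N \<and> frac (real s ^ p * limit_point) < 1 / real s})"
    using N(3) by (simp only: of_nat_le_iff)
  then have "5 / 8 \<le> real (card {p. p < N \<and> frac (real s ^ p * limit_point) < 1 / real s}) / real N"
    using N(2) by (simp add: field_simps)
  moreover have "measure lborel ?I \<le> 1 / 2" using s2 by simp
  ultimately have "1 / 8 \<le> ?f ?I" unfolding set unfolding orbit_nth(2) by linarith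
  then show False using le N0[OF N(1)] by linarith
qed

end

theorem theorem5:
  fixes R :: "nat set"
  assumes "R \<subseteq> bases"
    and "closed_mult_dependent R"
  shows "\<exists>\<xi>::real. (\<forall>r\<in>R. normal_to_base r \<xi>)
           \<and> (\<forall>s\<in>bases - R. \<not> simply_normal_to_base s \<xi>)
           \<and> computable_real_in R \<xi>"
proof -
  interpret dependence_closed R by unfold_locales (fact assms)+
  show ?thesis
    using normal_limit_point not_simply_normal_limit_point computable_limit_point by blast
qed

end
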